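(* Let $w\in S_n$ be a Grassmannian permutation. Then (1) $\mathfrak{G}_w$ has saturated Newton polytope and $\mathrm{Newton}(\mathfrak{G}_w)$ is a generalized polymatroid; and (2) if $\alpha\in\mathrm{supp}(\mathfrak{G}_w)$ and $|\alpha|<\deg\mathfrak{G}_w$, then there exists $\beta\in\mathrm{supp}(\mathfrak{G}_w)$ with $\alpha<\beta$ componentwise and $|\beta|=|\alpha|+1$.
   Context: A permutation is Grassmannian if it has exactly one descent (an index $i$ with $w(i)>w(i+1)$). Permutations act on the right; $s_j$ swaps positions $j,j+1$. With $\partial_j f=\frac{f-s_jf}{x_j-x_{j+1}}$ ($s_jf$ swaps $x_j,x_{j+1}$) and $\overline{\partial}_j f=\partial_j((1-x_{j+1})f)$, the Grothendieck polynomial is defined by $\mathfrak{G}_{w_0}=x_1^{n-1}\cdots x_{n-1}$ for $w_0=n(n-1)\cdots1$ and $\mathfrak{G}_w=\overline{\partial}_j\mathfrak{G}_{ws_j}$ when $w(j)<w(j+1)$. $\mathrm{supp}(f)$ is the set of exponent vectors with nonzero coefficient, $\mathrm{Newton}(f)$ its convex hull; $f$ has saturated Newton polytope (SNP) if $\mathrm{Newton}(f)\cap\mathbb{Z}^n=\mathrm{supp}(f)$. $|\alpha|=\sum_i\alpha_i$; $\alpha<\beta$ means $\alpha_i\le\beta_i$ for all $i$ and $\alpha\neq\beta$. A function $z:2^{[n]}\to\mathbb{R}$ is submodular if $z(I)+z(J)\ge z(I\cup J)+z(I\cap J)$ for all $I,J$, and $y$ is supermodular if $-y$ is submodular. A pair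 $(y,z)$ is paramodular if $y$ is supermodular, $z$ submodular, and $z(I)-y(J)\ge z(I\setminus J)-y(J\setminus I)$ for all $I,J\subseteq[n]$. A generalized polymatroid is a polytope of the form $\{t\in\mathbb{R}^n: y(I)\le\sum_{i\in I}t_i\le z(I)\ \forall I\subseteq[n]\}$ for a paramodular pair $(y,z)$. *)

theory Defs
  imports Complex_Main "HOL-Library.Poly_Mapping" "HOL-Combinatorics.Permutations"
begin

type_synonym mpoly = "(nat \<Rightarrow>\<^sub>0 nat) \<Rightarrow>\<^sub>0 int"

definition var :: "nat \<Rightarrow> mpoly" where
  "var i = Poly_Mapping.single (Poly_Mapping.single i 1) 1"

definition swapidx :: "nat \<Rightarrow> nat \<Rightarrow> nat" where
  "swapidx j i = (if i = j then j + 1 else if i = j + 1 then j else i)"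

definition swap_exp :: "nat \<Rightarrow> (nat \<Rightarrow>\<^sub>0 nat) \<Rightarrow> (nat \<Rightarrow>\<^sub>0 nat)" where
  "swap_exp j a = Abs_poly_mapping (\<lambda>i. Poly_Mapping.lookup a (swapidx j i))"

definition swap_poly :: "nat \<Rightarrow> mpoly \<Rightarrow> mpoly" where
  "swap_poly j f = Abs_poly_mapping (\<lambda>a. Poly_Mapping.lookup f (swap_exp j a))"

definition ddiff :: "nat \<Rightarrow> mpoly \<Rightarrow> mpoly" where
  "ddiff j f = (THE g. (var j - var (j + 1)) * g = f - swap_poly j f)"

definition ddiff_bar :: "nat \<Rightarrow> mpoly \<Rightarrow> mpoly" where
  "ddiff_bar j f = ddiff j ((1 - var (j + 1)) * f)"

text \<open>Permutations of {1..n} (identity outside) act on the right: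
  w s_j = w \<circ> s_j swaps the entries in positions j and j+1.\<close>
definition longest :: "nat \<Rightarrow> nat \<Rightarrow> nat" where
  "longest n i = (if i \<in> {1..n} then n + 1 - i else i)"

definition s :: "nat \<Rightarrow> nat \<Rightarrow> nat" where
  "s j = swapidx j"

inductive is_groth :: "nat \<Rightarrow> (nat \<Rightarrow> nat) \<Rightarrow> mpoly \<Rightarrow> bool" for n where
  top: "is_groth n (longest n) (\<Prod>i\<in>{1..<n}. var i ^ (n - i))"
| step: "\<lbrakk> is_groth n (w \<circ> s j) G; j \<in> {1..<n}; w permutes {1..n}; w j < w (j + 1) \<rbrakk>
          \<Longrightarrow> is_groth n w (ddiff_bar j G)"

text \<open>The Grothendieck polynomial of w in S_n (well-definedness is the classical fact
  that the result is independent of the chosen reduction path).\<close>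
definition groth :: "nat \<Rightarrow> (nat \<Rightarrow> nat) \<Rightarrow> mpoly" where
  "groth n w = (THE G. is_groth n w G)"

definition grassmannian :: "nat \<Rightarrow> (nat \<Rightarrow> nat) \<Rightarrow> bool" where
  "grassmannian n w \<longleftrightarrow> card {i \<in> {1..<n}. w i > w (i + 1)} = 1"

definition supp :: "mpoly \<Rightarrow> (nat \<Rightarrow>\<^sub>0 nat) set" where
  "supp f = {a. Poly_Mapping.lookup f a \<noteq> 0}"

definition absv :: "(nat \<Rightarrow>\<^sub>0 nat) \<Rightarrow> nat" where
  "absv a = (\<Sum>i\<in>Poly_Mapping.keys a. Poly_Mapping.lookup a i)"

definition total_deg :: "mpoly \<Rightarrow> nat" where
  "total_deg f = Max (absv ` supp f)"

definition exp_vec :: "(nat \<Rightarrow>\<^sub>0 nat) \<Rightarrow> (nat \<Rightarrow> real)" where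
  "exp_vec a = (\<lambda>i. real (Poly_Mapping.lookup a i))"

definition newton :: "mpoly \<Rightarrow> (nat \<Rightarrow> real) set" where
  "newton f = {t. \<exists>S u. finite S \<and> S \<noteq> {} \<and> S \<subseteq> supp f \<and> (\<forall>a\<in>S. u a \<ge> 0)
       \<and> sum u S = 1 \<and> (\<forall>i. t i = (\<Sum>a\<in>S. u a * exp_vec a i))}"

definition SNP :: "mpoly \<Rightarrow> bool" where
  "SNP f \<longleftrightarrow> (\<forall>t \<in> newton f. (\<forall>i. t i \<in> \<int>) \<longrightarrow> t \<in> exp_vec ` supp f)"

definition submodular_on :: "nat set \<Rightarrow> (nat set \<Rightarrow> real) \<Rightarrow> bool" where
  "submodular_on E z \<longleftrightarrow>
     (\<forall>I J. I \<subseteq> E \<longrightarrow> J \<subseteq> E \<longrightarrow> z I + z J \<ge> z (I \<union> J) + z (I \<inter> J))"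

definition supermodular_on :: "nat set \<Rightarrow> (nat set \<Rightarrow> real) \<Rightarrow> bool" where
  "supermodular_on E y \<longleftrightarrow> submodular_on E (\<lambda>I. - y I)"

definition paramodular_on :: "nat set \<Rightarrow> (nat set \<Rightarrow> real) \<Rightarrow> (nat set \<Rightarrow> real) \<Rightarrow> bool" where
  "paramodular_on E y z \<longleftrightarrow> supermodular_on E y \<and> submodular_on E z \<and>
     (\<forall>I J. I \<subseteq> E \<longrightarrow> J \<subseteq> E \<longrightarrow> z I - y J \<ge> z (I - J) - y (J - I))"

definition gen_polymatroid :: "nat \<Rightarrow> (nat \<Rightarrow> real) set \<Rightarrow> bool" where
  "gen_polymatroid n P \<longleftrightarrow> (\<exists>y z. paramodular_on {1..n} y z \<and>
     P = {t. (\<forall>i. i \<notin> {1..n} \<longrightarrow> t i = 0) \<and>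
             (\<forall>I. I \<subseteq> {1..n} \<longrightarrow> y I \<le> (\<Sum>i\<in>I. t i) \<and> (\<Sum>i\<in>I. t i) \<le> z I)})"

end

theory Submission
  imports Defs "HOL-Library.FuncSet"
begin

text \<open>Let k be the descent of w. The reversal of the first k entries makes w dominant, so its Grothendieck
  polynomial is a monomial with strictly decreasing exponents (a partition plus a staircase), and the one
  of w arises from it by the isobaric operator of the longest element of S_k. Rewriting this operator as
  the plain one applied to the monomial times a product of factors 1 - x_l and multiplying out
  gives Lenart's expansion: Schur polynomials of all partitions mu with nu_i \<le> mu_i \<le> nu_i + i - 1, each with
  sign determined by its degree. Hence nothing cancels, and the
  support is the union of the supports of these Schur polynomials, which are given by dominance.
  This union is the set of lattice points cut out by sums of the smallest parts of nu
  and of the largest parts of the maximal such mu, a paramodular pair, so integrality of generalized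
  polymatroids yields (1); submodularity of the upper bound yields (2), since the union of tight sets is tight.\<close>

section \<open>Swaps and divided differences\<close>

text \<open>\<open>groth\<close> and \<open>ddiff\<close> are definite descriptions, so nothing can
  be computed before independence of the reduction path is known: the braid and commutation
  relations close the diamond of two ascents. No fractions occur; operator identities are proved in
  the division-free form of \<open>dd_eq\<close> by cancelling differences of variables. Schur
  polynomials have no definition of their own: the one of mu is the plain operator of the longest
  element applied to the monomial with exponents mu plus staircase. Its support comes from a
  branching rule that splits off the last variable. The isobaric and the plain operator are at first
  compared only up to the factor \<open>dd_longest 0 k (weight k)\<close>; evaluation at the
  staircase monomial shows that it is 1. The weight contains 1 - x_l with exponent l - 1, and each
  factor can raise a part by at most one: this is the origin of the bound nu_i + i - 1. Divided
  differences create signs, so nonnegativity, up to a sign fixed by the degree, is carried through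
  the inductions together with the support.\<close>

lemma var_power: "var i ^ m = Poly_Mapping.single (Poly_Mapping.single i m) 1"
  by (induction m) (auto simp: var_def mult_single simp flip: single_add)

lemma prod_var_eq_single:
  "finite A \<Longrightarrow> (\<Prod>i\<in>A. var i ^ c i) = Poly_Mapping.single (\<Sum>i\<in>A. Poly_Mapping.single i (c i)) 1"
  by (induction A rule: finite_induct) (auto simp: var_power mult_single)

lemma poly_mapping_sum_single:
  "(\<Sum>i\<in>Poly_Mapping.keys e. Poly_Mapping.single i (Poly_Mapping.lookup e i)) = e"
  by (rule poly_mapping_eqI) (auto simp: lookup_sum lookup_single when_def in_keys_iff)

text \<open>The variables and 1 generate the ring; closure under differences is what induction over
  the free abelian group on exponent vectors (\<open>frag_induction\<close>) asks for.\<close>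

lemma mpoly_induct [case_names one var diff mult]:
  fixes f :: mpoly
  assumes one: "P 1" and var: "\<And>i. P (var i)"
    and diff: "\<And>f g. P f \<Longrightarrow> P g \<Longrightarrow> P (f - g)" and mult: "\<And>f g. P f \<Longrightarrow> P g \<Longrightarrow> P (f * g)"
  shows "P f"
proof -
  have pow: "P (var i ^ m)" for i m by (induction m) (auto intro: one var mult)
  have prod: "P (\<Prod>i\<in>A. var i ^ c i)" if "finite A" for A and c :: "nat \<Rightarrow> nat"
    using that by (induction A rule: finite_induct) (auto intro: one mult pow)
  show ?thesis
  proof (rule frag_induction[of f UNIV])
    show "P 0" using diff[OF one one] by simp
    fix e show "P (frag_of e)"
      using prod[of "Poly_Mapping.keys e" "Poly_Mapping.lookup e"]
      by (simp add: prod_var_eq_single poly_mapping_sum_single)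
  qed (auto intro: diff)
qed

lemma swapidx_swapidx [simp]: "swapidx j (swapidx j i) = i"
  by (auto simp: swapidx_def)

lemma lookup_swap_exp [simp]: "Poly_Mapping.lookup (swap_exp j a) i = Poly_Mapping.lookup a (swapidx j i)"
proof -
  have "{i. Poly_Mapping.lookup a (swapidx j i) \<noteq> 0} \<subseteq> swapidx j ` {i. Poly_Mapping.lookup a i \<noteq> 0}"
    by (smt (verit, ccfv_threshold) image_iff mem_Collect_eq subsetI swapidx_swapidx)
  then have "finite {i. Poly_Mapping.lookup a (swapidx j i) \<noteq> 0}"
    using finite_lookup finite_surj by blast
  then show ?thesis unfolding swap_exp_def by simp
qed

lemma swap_exp_swap_exp [simp]: "swap_exp j (swap_exp j a) = a"
  by (rule poly_mapping_eqI) simp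

lemma lookup_swap_poly [simp]: "Poly_Mapping.lookup (swap_poly j f) a = Poly_Mapping.lookup f (swap_exp j a)"
proof -
  have "{a. Poly_Mapping.lookup f (swap_exp j a) \<noteq> 0} \<subseteq> swap_exp j ` {i. Poly_Mapping.lookup f i \<noteq> 0}"
    by (smt (verit, ccfv_threshold) image_iff mem_Collect_eq subsetI swap_exp_swap_exp)
  then have "finite {a. Poly_Mapping.lookup f (swap_exp j a) \<noteq> 0}"
    using finite_lookup finite_surj by blast
  then show ?thesis unfolding swap_poly_def by simp
qed

lemma swap_poly_0 [simp]: "swap_poly j 0 = 0"
  and swap_poly_add: "swap_poly j (f + g) = swap_poly j f + swap_poly j g"
  and swap_poly_diff: "swap_poly j (f - g) = swap_poly j f - swap_poly j g"
  and swap_poly_uminus: "swap_poly j (- f) = - swap_poly j f"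
  and swap_poly_swap_poly [simp]: "swap_poly j (swap_poly j f) = f"
  by (auto intro!: poly_mapping_eqI simp: lookup_add lookup_minus)

lemma swap_exp_eq_iff: "swap_exp j a = b \<longleftrightarrow> a = swap_exp j b"
  by auto

lemma swap_poly_single: "swap_poly j (Poly_Mapping.single e c) = Poly_Mapping.single (swap_exp j e) c"
  by (rule poly_mapping_eqI) (auto simp: lookup_single when_def swap_exp_eq_iff)

lemma swap_exp_add: "swap_exp j (a + b) = swap_exp j a + swap_exp j b"
  by (rule poly_mapping_eqI) (simp add: lookup_add)

lemma swap_poly_mult: "swap_poly j (f * g) = swap_poly j f * swap_poly j g"
proof (rule frag_induction[of f UNIV])
  fix e
  show "swap_poly j (frag_of e * g) = swap_poly j (frag_of e) * swap_poly j g"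
    by (rule frag_induction[of g UNIV])
      (auto simp: swap_poly_single swap_exp_add mult_single swap_poly_diff right_diff_distrib)
qed (auto simp: swap_poly_diff left_diff_distrib)

lemma swap_poly_1 [simp]: "swap_poly j 1 = 1"
proof -
  have "swap_exp j 0 = 0" by (rule poly_mapping_eqI) simp
  then show ?thesis using swap_poly_single[of j 0 1] by simp
qed

lemma swap_poly_of_nat [simp]: "swap_poly j (of_nat m) = of_nat m"
  by (induction m) (auto simp: swap_poly_add)

lemma swap_poly_of_int [simp]: "swap_poly j (of_int m) = of_int m"
  by (cases m rule: int_cases2) (auto simp: swap_poly_uminus)

lemma swap_poly_var: "swap_poly j (var i) = var (swapidx j i)"
proof -
  have "swap_exp j (Poly_Mapping.single i 1) = Poly_Mapping.single (swapidx j i) 1"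
    by (rule poly_mapping_eqI) (auto simp: lookup_single when_def)
  then show ?thesis by (simp add: var_def swap_poly_single)
qed

lemma swap_poly_power: "swap_poly j (f ^ m) = swap_poly j f ^ m"
  by (induction m) (auto simp: swap_poly_mult)

lemma swap_poly_sum: "swap_poly j (\<Sum>i\<in>A. f i) = (\<Sum>i\<in>A. swap_poly j (f i))"
  by (induction A rule: infinite_finite_induct) (auto simp: swap_poly_add)

lemma swap_poly_prod: "swap_poly j (\<Prod>i\<in>A. f i) = (\<Prod>i\<in>A. swap_poly j (f i))"
  by (induction A rule: infinite_finite_induct) (auto simp: swap_poly_mult)

lemmas swap_poly_simps = swap_poly_add swap_poly_diff swap_poly_uminus swap_poly_mult swap_poly_var
  swap_poly_power swap_poly_sum swap_poly_prod

lemma swapidx_simps [simp]: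
  "swapidx j j = Suc j" "swapidx j (Suc j) = j" "i \<noteq> j \<Longrightarrow> i \<noteq> Suc j \<Longrightarrow> swapidx j i = i"
  by (auto simp: swapidx_def)

section \<open>Existence, uniqueness and basic laws of divided differences\<close>

lemma var_eq_iff [simp]: "var i = var j \<longleftrightarrow> i = j"
  by (metis frag_of_eq lookup_single_eq lookup_single_not_eq var_def zero_neq_one)

lemma ddiff_unique: "(var j - var (j + 1)) * g = f - swap_poly j f \<Longrightarrow> ddiff j f = g"
  unfolding ddiff_def
proof (rule the_equality)
  fix h assume "(var j - var (j + 1)) * g = f - swap_poly j f" "(var j - var (j + 1)) * h = f - swap_poly j f"
  then have "(var j - var (j + 1)) * h = (var j - var (j + 1)) * g" by simp
  then show "h = g" by simp
qed

lemma ddiff_exists: "\<exists>g. (var j - var (j + 1)) * g = f - swap_poly j f"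
proof (induction f rule: mpoly_induct)
  case one
  show ?case by (auto intro: exI[of _ 0])
next
  case (var i)
  consider "i = j" | "i = Suc j" | "i \<noteq> j" "i \<noteq> Suc j" by blast
  then show ?case
  proof cases
    case 1 then show ?thesis by (auto simp: swap_poly_var intro!: exI[of _ 1])
  next
    case 2 then show ?thesis by (auto simp: swap_poly_var intro!: exI[of _ "- 1"])
  next
    case 3 then show ?thesis by (auto simp: swap_poly_var intro!: exI[of _ 0])
  qed
next
  case (diff f g)
  then obtain a b where "(var j - var (j + 1)) * a = f - swap_poly j f"
    "(var j - var (j + 1)) * b = g - swap_poly j g" by blast
  then show ?case by (intro exI[of _ "a - b"]) (simp add: swap_poly_diff right_diff_distrib)
next
  case (mult f g)
  then obtain a b where "(var j - var (j + 1)) * a = f - swap_poly j f"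
    "(var j - var (j + 1)) * b = g - swap_poly j g" by blast
  \<comment> \<open>Twisted Leibniz rule: f g - s(f) s(g) = (f - s(f)) g + s(f) (g - s(g)).\<close>
  then have "(var j - var (j + 1)) * (a * g + swap_poly j f * b) = f * g - swap_poly j (f * g)"
    by (simp add: swap_poly_mult) algebra
  then show ?case by blast
qed

lemma ddiff_eq: "(var j - var (j + 1)) * ddiff j f = f - swap_poly j f"
  using ddiff_exists ddiff_unique by metis

text \<open>The case t = 0 is the plain divided difference, t = 1 is the isobaric one used for
  Grothendieck polynomials; both satisfy the relations of a Hecke algebra with quadratic relation
  D D = t D, which allows a uniform treatment.\<close>

definition dd :: "int \<Rightarrow> nat \<Rightarrow> mpoly \<Rightarrow> mpoly" where
  "dd t j f = ddiff j ((1 - of_int t * var (j + 1)) * f)"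

lemma ddiff_bar_eq_dd: "ddiff_bar j = dd 1 j"
  by (simp add: ddiff_bar_def dd_def fun_eq_iff)

lemma dd_eq: "(var j - var (Suc j)) * dd t j f =
    (1 - of_int t * var (Suc j)) * f - (1 - of_int t * var j) * swap_poly j f"
  using ddiff_eq[of j] by (simp add: dd_def swap_poly_simps)

lemma dd_unique: "(var j - var (Suc j)) * g =
    (1 - of_int t * var (Suc j)) * f - (1 - of_int t * var j) * swap_poly j f \<Longrightarrow> dd t j f = g"
  unfolding dd_def by (rule ddiff_unique) (simp add: swap_poly_simps)

lemma dd_add: "dd t j (f + g) = dd t j f + dd t j g"
  by (rule dd_unique) (simp add: distrib_left dd_eq swap_poly_add)

lemma dd_diff: "dd t j (f - g) = dd t j f - dd t j g"
  by (rule dd_unique) (simp add: right_diff_distrib dd_eq swap_poly_diff)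

lemma dd_0 [simp]: "dd t j 0 = 0"
  by (rule dd_unique) simp

lemma dd_sum: "dd t j (\<Sum>i\<in>A. f i) = (\<Sum>i\<in>A. dd t j (f i))"
  by (induction A rule: infinite_finite_induct) (auto simp: dd_add)

lemma dd_mult_left: "swap_poly j p = p \<Longrightarrow> dd t j (p * f) = p * dd t j f"
  by (rule dd_unique) (simp add: mult.left_commute dd_eq swap_poly_mult right_diff_distrib)

lemma swap_poly_dd: "swap_poly j (dd t j f) = dd t j f"
proof -
  have "swap_poly j ((var j - var (Suc j)) * dd t j f) = - ((var j - var (Suc j)) * dd t j f)"
    unfolding dd_eq by (simp add: swap_poly_simps)
  then have "(var j - var (Suc j)) * swap_poly j (dd t j f) = (var j - var (Suc j)) * dd t j f"
    by (simp add: swap_poly_simps algebra_simps)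
  then show ?thesis by simp
qed

lemma dd_symmetric: "swap_poly j f = f \<Longrightarrow> dd t j f = of_int t * f"
  by (rule dd_unique) (simp add: algebra_simps)

lemma dd_dd: "dd t j (dd t j f) = of_int t * dd t j f"
  by (simp add: dd_symmetric swap_poly_dd)

lemma swap_poly_commute:
  "i + 1 < j \<or> j + 1 < i \<Longrightarrow> swap_poly i (swap_poly j f) = swap_poly j (swap_poly i f)"
  by (rule poly_mapping_eqI, simp, rule arg_cong[of _ _ "Poly_Mapping.lookup f"])
    (rule poly_mapping_eqI, auto simp: swapidx_def)

lemma swap_poly_braid:
  "swap_poly i (swap_poly (Suc i) (swap_poly i f)) = swap_poly (Suc i) (swap_poly i (swap_poly (Suc i) f))"
  by (rule poly_mapping_eqI, simp, rule arg_cong[of _ _ "Poly_Mapping.lookup f"])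
    (rule poly_mapping_eqI, auto simp: swapidx_def)

lemma swap_poly_dd_commute:
  assumes "i + 1 < j \<or> j + 1 < i"
  shows "swap_poly i (dd t j f) = dd t j (swap_poly i f)"
proof (rule dd_unique[symmetric])
  have "swap_poly i ((var j - var (Suc j)) * dd t j f) = (var j - var (Suc j)) * swap_poly i (dd t j f)"
    using assms by (auto simp: swap_poly_simps)
  moreover have "swap_poly i ((var j - var (Suc j)) * dd t j f) =
     (1 - of_int t * var (Suc j)) * swap_poly i f - (1 - of_int t * var j) * swap_poly j (swap_poly i f)"
    unfolding dd_eq using assms by (auto simp: swap_poly_simps swap_poly_commute[of i j])
  ultimately show "(var j - var (Suc j)) * swap_poly i (dd t j f) =
    (1 - of_int t * var (Suc j)) * swap_poly i f - (1 - of_int t * var j) * swap_poly j (swap_poly i f)"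
    by simp
qed

lemma dd_commute:
  assumes "i + 1 < j \<or> j + 1 < i"
  shows "dd t i (dd t j f) = dd t j (dd t i f)"
proof (rule dd_unique)
  have "(var i - var (Suc i)) * dd t j (dd t i f) = dd t j ((var i - var (Suc i)) * dd t i f)"
    using assms by (subst dd_mult_left) (auto simp: swap_poly_simps)
  also have "\<dots> = dd t j ((1 - of_int t * var (Suc i)) * f) - dd t j ((1 - of_int t * var i) * swap_poly i f)"
    by (simp add: dd_eq dd_diff)
  also have "\<dots> = (1 - of_int t * var (Suc i)) * dd t j f - (1 - of_int t * var i) * swap_poly i (dd t j f)"
    using assms by (subst (1 2) dd_mult_left) (auto simp: swap_poly_simps swap_poly_dd_commute)
  finally show "(var i - var (Suc i)) * dd t j (dd t i f) =
    (1 - of_int t * var (Suc i)) * dd t j f - (1 - of_int t * var i) * swap_poly i (dd t j f)" .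
qed

section \<open>Hecke relations and longest elements\<close>

text \<open>\<open>a\<close>, \<open>b\<close>, \<open>c\<close> stand for consecutive variables and
  \<open>sf\<close>, \<open>tg1\<close>, \<open>stf\<close> and so on for images under the swaps s
  and t; the hypotheses are instances of \<open>dd_eq\<close> with swaps applied. Abstracting from
  the operators leaves a polynomial identity between atoms. The letter s acts twice, so a second
  factor a - b is needed to clear denominators.\<close>

lemma braid_lhs:
  fixes a b c t :: "'a::idom"
  defines "p \<equiv> \<lambda>x. 1 - t * x"
  assumes "a \<noteq> b"
    and 1: "(a - b) * g1 = p b * f - p a * sf" and 2: "(b - c) * g2 = p c * g1 - p b * tg1"
    and 3: "(a - c) * tg1 = p c * tf - p a * tsf" and 4: "(a - b) * g3 = p b * g2 - p a * sg2"
    and 5: "(a - c) * sg2 = p c * g1 - p a * stg1" and 6: "(b - c) * stg1 = p c * stf - p b * stsf"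
  shows "(a - b) * (a - c) * (b - c) * g3 = p b * p c ^ 2 * f - p a * p c ^ 2 * sf - p b ^ 2 * p c * tf
    + p b ^ 2 * p a * tsf + p a ^ 2 * p c * stf - p a ^ 2 * p b * stsf"
    (is "?L = ?E")
proof -
  have "(a - b) * ?L = (a - b) * (a - c) * (b - c) * ((a - b) * g3)" by algebra
  also have "\<dots> = p b * (a - b) * (a - c) * ((b - c) * g2) - p a * (a - b) * (b - c) * ((a - c) * sg2)"
    unfolding 4 by algebra
  also have "\<dots> = p b * p c * (a - c) * ((a - b) * g1) - p b ^ 2 * (a - b) * ((a - c) * tg1)
      - p a * p c * (b - c) * ((a - b) * g1) + p a ^ 2 * (a - b) * ((b - c) * stg1)"
    unfolding 2 5 by algebra
  \<comment> \<open>The form of p enters through p b (a - c) - p a (b - c) = p c (a - b), which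
    turns the coefficient of (a - b) g1 into p c ^ 2 (a - b) and so releases the extra
    factor.\<close>
  also have "\<dots> = (a - b) * ?E"
    unfolding 1 3 6 unfolding p_def by algebra
  finally show ?thesis using \<open>a \<noteq> b\<close> by simp
qed

text \<open>The mirror computation with extra factor b - c, which is released by (a - c) - (a - b) =
  b - c in the terms with h1.\<close>

lemma braid_rhs:
  fixes a b c t :: "'a::idom"
  defines "p \<equiv> \<lambda>x. 1 - t * x"
  assumes "b \<noteq> c"
    and 1: "(b - c) * h1 = p c * f - p b * tf" and 2: "(a - b) * h2 = p b * h1 - p a * sh1"
    and 3: "(a - c) * sh1 = p c * sf - p a * stf" and 4: "(b - c) * h3 = p c * h2 - p b * th2"
    and 5: "(a - c) * th2 = p c * h1 - p a * tsh1" and 6: "(a - b) * tsh1 = p b * tsf - p a * tstf"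
  shows "(a - b) * (a - c) * (b - c) * h3 = p b * p c ^ 2 * f - p a * p c ^ 2 * sf - p b ^ 2 * p c * tf
    + p b ^ 2 * p a * tsf + p a ^ 2 * p c * stf - p a ^ 2 * p b * tstf"
    (is "?L = ?E")
proof -
  have "(b - c) * ?L = (a - b) * (a - c) * (b - c) * ((b - c) * h3)" by algebra
  also have "\<dots> = p c * (b - c) * (a - c) * ((a - b) * h2) - p b * (a - b) * (b - c) * ((a - c) * th2)"
    unfolding 4 by algebra
  also have "\<dots> = p c * p b * (a - c) * ((b - c) * h1) - p c * p a * (b - c) * ((a - c) * sh1)
      - p b * p c * (a - b) * ((b - c) * h1) + p b * p a * (b - c) * ((a - b) * tsh1)"
    unfolding 2 5 by algebra
  also have "\<dots> = (b - c) * ?E"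
    unfolding 1 3 6 by algebra
  finally show ?thesis using \<open>b \<noteq> c\<close> by simp
qed

text \<open>Both sides, multiplied by the Vandermonde determinant of the three variables, are the same
  alternating sum over the six permutations of these variables.\<close>

lemma dd_braid: "dd t i (dd t (Suc i) (dd t i f)) = dd t (Suc i) (dd t i (dd t (Suc i) f))"
proof -
  let ?a = "var i" and ?b = "var (Suc i)" and ?c = "var (Suc (Suc i))"
  let ?s = "swap_poly i" and ?t = "swap_poly (Suc i)"
  let ?p = "\<lambda>x::mpoly. 1 - of_int t * x"
  let ?g1 = "dd t i f" and ?h1 = "dd t (Suc i) f"
  let ?g2 = "dd t (Suc i) ?g1" and ?h2 = "dd t i ?h1"
  have [simp]: "swapidx (Suc i) i = i" "swapidx i (Suc (Suc i)) = Suc (Suc i)"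
    by auto
  have [simp]: "?s ?g1 = ?g1" "?t ?h1 = ?h1" by (simp_all add: swap_poly_dd)
  have A: "(?a - ?b) * (?a - ?c) * (?b - ?c) * dd t i ?g2 = ?p ?b * ?p ?c ^ 2 * f - ?p ?a * ?p ?c ^ 2 * ?s f
    - ?p ?b ^ 2 * ?p ?c * ?t f + ?p ?b ^ 2 * ?p ?a * ?t (?s f) + ?p ?a ^ 2 * ?p ?c * ?s (?t f)
    - ?p ?a ^ 2 * ?p ?b * ?s (?t (?s f))"
  proof (rule braid_lhs)
    show "?a \<noteq> ?b" by simp
    show g1: "(?a - ?b) * ?g1 = ?p ?b * f - ?p ?a * ?s f" by (rule dd_eq)
    show g2: "(?b - ?c) * ?g2 = ?p ?c * ?g1 - ?p ?b * ?t ?g1" by (rule dd_eq)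
    show g1': "(?a - ?c) * ?t ?g1 = ?p ?c * ?t f - ?p ?a * ?t (?s f)"
      using arg_cong[OF g1, of ?t] by (simp add: swap_poly_simps)
    show "(?a - ?b) * dd t i ?g2 = ?p ?b * ?g2 - ?p ?a * ?s ?g2" by (rule dd_eq)
    show "(?a - ?c) * ?s ?g2 = ?p ?c * ?g1 - ?p ?a * ?s (?t ?g1)"
      using arg_cong[OF g2, of ?s] by (simp add: swap_poly_simps)
    show "(?b - ?c) * ?s (?t ?g1) = ?p ?c * ?s (?t f) - ?p ?b * ?s (?t (?s f))"
      using arg_cong[OF g1', of ?s] by (simp add: swap_poly_simps)
  qed
  have B: "(?a - ?b) * (?a - ?c) * (?b - ?c) * dd t (Suc i) ?h2 = ?p ?b * ?p ?c ^ 2 * f - ?p ?a * ?p ?c ^ 2 * ?s f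
    - ?p ?b ^ 2 * ?p ?c * ?t f + ?p ?b ^ 2 * ?p ?a * ?t (?s f) + ?p ?a ^ 2 * ?p ?c * ?s (?t f)
    - ?p ?a ^ 2 * ?p ?b * ?t (?s (?t f))"
  proof (rule braid_rhs)
    show "?b \<noteq> ?c" by simp
    show h1: "(?b - ?c) * ?h1 = ?p ?c * f - ?p ?b * ?t f" by (rule dd_eq)
    show h2: "(?a - ?b) * ?h2 = ?p ?b * ?h1 - ?p ?a * ?s ?h1" by (rule dd_eq)
    show h1': "(?a - ?c) * ?s ?h1 = ?p ?c * ?s f - ?p ?a * ?s (?t f)"
      using arg_cong[OF h1, of ?s] by (simp add: swap_poly_simps)
    show "(?b - ?c) * dd t (Suc i) ?h2 = ?p ?c * ?h2 - ?p ?b * ?t ?h2" by (rule dd_eq)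
    show "(?a - ?c) * ?t ?h2 = ?p ?c * ?h1 - ?p ?a * ?t (?s ?h1)"
      using arg_cong[OF h2, of ?t] by (simp add: swap_poly_simps)
    show "(?a - ?b) * ?t (?s ?h1) = ?p ?b * ?t (?s f) - ?p ?a * ?t (?s (?t f))"
      using arg_cong[OF h1', of ?t] by (simp add: swap_poly_simps)
  qed
  have "(?a - ?b) * (?a - ?c) * (?b - ?c) * dd t i ?g2 = (?a - ?b) * (?a - ?c) * (?b - ?c) * dd t (Suc i) ?h2"
    unfolding A B by (simp add: swap_poly_braid)
  then show ?thesis by simp
qed

section \<open>Operators of cycles and of longest elements\<close>

fun dd_cycle :: "int \<Rightarrow> nat \<Rightarrow> mpoly \<Rightarrow> mpoly" where
  "dd_cycle t 0 f = f"
| "dd_cycle t (Suc m) f = dd t (Suc m) (dd_cycle t m f)"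

text \<open>With D_j for \<open>dd t j\<close>, \<open>dd_cycle t m\<close> is D_m ... D_1, where
  D_1 acts first. The index of \<open>dd_longest\<close> counts variables: it follows a reduced word
  of the longest element of S_m, so only D_1, ..., D_(m-1) occur.\<close>

fun dd_longest :: "int \<Rightarrow> nat \<Rightarrow> mpoly \<Rightarrow> mpoly" where
  "dd_longest t 0 f = f"
| "dd_longest t (Suc m) f = dd_longest t m (dd_cycle t m f)"

lemma dd_cycle_add: "dd_cycle t m (f + g) = dd_cycle t m f + dd_cycle t m g"
  and dd_cycle_0 [simp]: "dd_cycle t m 0 = 0"
  and dd_cycle_mult_left: "(\<And>j. 1 \<le> j \<Longrightarrow> j \<le> m \<Longrightarrow> swap_poly j p = p) \<Longrightarrow> dd_cycle t m (p * f) = p * dd_cycle t m f"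
  by (induction m) (auto simp: dd_add dd_mult_left)

lemma dd_longest_add: "dd_longest t m (f + g) = dd_longest t m f + dd_longest t m g"
  and dd_longest_0 [simp]: "dd_longest t m 0 = 0"
  by (induction m arbitrary: f g) (auto simp: dd_cycle_add)

lemma dd_longest_uminus: "dd_longest t m (- f) = - dd_longest t m f"
  using dd_longest_add[of t m f "- f"] by (simp add: eq_neg_iff_add_eq_0 add.commute)

lemma dd_longest_diff: "dd_longest t m (f - g) = dd_longest t m f - dd_longest t m g"
  using dd_longest_add[of t m f "- g"] by (simp add: dd_longest_uminus)

lemma dd_longest_sum: "dd_longest t m (\<Sum>i\<in>A. f i) = (\<Sum>i\<in>A. dd_longest t m (f i))"
  by (induction A rule: infinite_finite_induct) (auto simp: dd_longest_add)

lemma dd_longest_mult_left: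
  "(\<And>j. 1 \<le> j \<Longrightarrow> j < m \<Longrightarrow> swap_poly j p = p) \<Longrightarrow> dd_longest t m (p * f) = p * dd_longest t m f"
proof (induction m arbitrary: f)
  case (Suc m)
  then show ?case by (simp add: dd_cycle_mult_left)
qed simp

lemma dd_cycle_commute: "m + 1 < j \<Longrightarrow> dd_cycle t m (dd t j f) = dd t j (dd_cycle t m f)"
  by (induction m) (auto simp: dd_commute)

lemma dd_longest_commute: "m < j \<Longrightarrow> dd_longest t m (dd t j f) = dd t j (dd_longest t m f)"
  by (induction m arbitrary: f) (auto simp: dd_cycle_commute)

text \<open>The braid relation moves a letter through the cycle and lowers its index, (D_m ... D_1)
  D_j = D_(j-1) (D_m ... D_1) for j > 1; for j = 1 the letter meets its equal and the quadratic
  relation applies.\<close>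

lemma dd_cycle_dd:
  assumes "1 \<le> m" "1 \<le> j" "j \<le> m"
  shows "dd_cycle t m (dd t j f) = (if j = 1 then of_int t * dd_cycle t m f else dd t (j - 1) (dd_cycle t m f))"
  using assms
proof (induction m)
  case (Suc m)
  show ?case
  proof (cases "m = 0")
    case True
    then show ?thesis using Suc.prems by (simp add: dd_dd)
  next
    case False
    then obtain p where p: "m = Suc p" by (cases m) auto
    show ?thesis
    proof (cases "j \<le> m")
      case True
      then show ?thesis using Suc False by (auto simp: dd_mult_left dd_commute)
    next
      case False
      then have j: "j = Suc m" using Suc.prems by simp
      show ?thesis unfolding j p by (simp add: dd_cycle_commute dd_braid)
    qed
  qed
qed simp

text \<open>Each cycle of the word lowers the index of the letter by one until it is 1, where the
  letter becomes the scalar t.\<close>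

lemma dd_longest_dd:
  "1 \<le> j \<Longrightarrow> j < m \<Longrightarrow> dd_longest t m (dd t j f) = of_int t * dd_longest t m f"
proof (induction m arbitrary: j f)
  case (Suc m)
  then show ?case
    by (cases "j = 1") (auto simp: dd_cycle_dd dd_longest_mult_left)
qed simp

text \<open>Moving D_q ... D_1 through the longer cycle absorbs D_1 and lowers the other letters.
  This serves to absorb the top letter when it acts last.\<close>

lemma dd_cycle_dd_cycle:
  "1 \<le> q \<Longrightarrow> q \<le> m \<Longrightarrow> dd_cycle t m (dd_cycle t q f) = of_int t * dd_cycle t (q - 1) (dd_cycle t m f)"
proof (induction q)
  case (Suc q)
  show ?case
  proof (cases "q = 0")
    case True then show ?thesis using Suc by (simp add: dd_cycle_dd)
  next
    case False
    then obtain r where r: "q = Suc r" by (cases q) auto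
    have "dd_cycle t m (dd_cycle t (Suc q) f) = dd t q (dd_cycle t m (dd_cycle t q f))"
      using Suc False by (simp add: dd_cycle_dd)
    also have "\<dots> = of_int t * dd t q (dd_cycle t (q - 1) (dd_cycle t m f))"
      using Suc False by (simp add: dd_mult_left)
    finally show ?thesis by (simp add: r)
  qed
qed simp

lemma dd_dd_longest:
  "1 \<le> j \<Longrightarrow> j < m \<Longrightarrow> dd t j (dd_longest t m f) = of_int t * dd_longest t m f"
proof (induction m arbitrary: f)
  case (Suc m)
  show ?case
  proof (cases "j < m")
    case True then show ?thesis using Suc by simp
  next
    case False
    then have "j = m" using Suc.prems by simp
    then obtain p where m: "m = Suc p" and j: "j = Suc p" using Suc.prems by (cases m) auto
    \<comment> \<open>D_(p+1) commutes with the operators of the first p variables and prolongs the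
      next cycle D_p ... D_1.\<close>
    have "dd t j (dd_longest t (Suc m) f) = dd_longest t p (dd_cycle t (Suc p) (dd_cycle t (Suc p) f))"
      unfolding m j by (simp flip: dd_longest_commute)
    also have "\<dots> = dd_longest t p (of_int t * dd_cycle t p (dd_cycle t (Suc p) f))"
      by (subst dd_cycle_dd_cycle) auto
    also have "\<dots> = of_int t * dd_longest t (Suc m) f"
      by (simp add: dd_longest_mult_left m)
    finally show ?thesis .
  qed
qed simp

lemma swap_poly_dd_longest_1:
  assumes "1 \<le> j" "j < m"
  shows "swap_poly j (dd_longest 1 m f) = dd_longest 1 m f"
  using swap_poly_dd[of j 1 "dd_longest 1 m f"] dd_dd_longest[OF assms, of 1 f] by simp

text \<open>Such an f is D_j (x_j f) for the plain D_j, and D_j is absorbed with the scalar t =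
  0.\<close>

lemma dd_longest_0_symmetric:
  assumes "1 \<le> j" "j < m" "swap_poly j f = f"
  shows "dd_longest 0 m f = 0"
proof -
  have "dd 0 j (f * var j) = f"
    unfolding dd_mult_left[OF assms(3)] by (subst dd_unique[of _ 1]) (auto simp: swap_poly_simps)
  then show ?thesis using dd_longest_dd[OF assms(1,2), of 0 "f * var j"] by simp
qed

lemma dd_longest_0_swap_poly:
  assumes "1 \<le> j" "j < m"
  shows "dd_longest 0 m (swap_poly j f) = - dd_longest 0 m f"
proof -
  have "dd_longest 0 m (f + swap_poly j f) = 0"
    using assms by (rule dd_longest_0_symmetric) (simp add: swap_poly_add add.commute)
  then show ?thesis by (simp add: dd_longest_add eq_neg_iff_add_eq_0 add.commute)
qed

text \<open>The factors 1 - x of all isobaric operators in the word of the longest element can be collected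
  in a single weight with staircase exponents.\<close>

definition weight :: "nat \<Rightarrow> mpoly" where
  "weight k = (\<Prod>j\<in>{1..k}. (1 - var j) ^ (j - 1))"

text \<open>The exponents of the weight at j and j + 1 differ by one, so a single factor 1 - x_(j+1)
  is left over and all else is symmetric under s_j.\<close>

lemma weight_factor:
  assumes "1 \<le> j" "j < k"
  obtains M where "weight k = (1 - var (Suc j)) * M" "swap_poly j M = M"
proof
  let ?A = "{1..k} - {j, Suc j}"
  let ?M = "((1 - var j) * (1 - var (Suc j))) ^ (j - 1) * (\<Prod>i\<in>?A. (1 - var i) ^ (i - 1))"
  have "{1..k} = insert j (insert (Suc j) ?A)" using assms by auto
  then have "weight k = (\<Prod>i\<in>insert j (insert (Suc j) ?A). (1 - var i) ^ (i - 1))"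
    by (simp add: weight_def)
  also have "\<dots> = (1 - var j) ^ (j - 1) * ((1 - var (Suc j)) ^ j * (\<Prod>i\<in>?A. (1 - var i) ^ (i - 1)))"
    by (subst prod.insert; simp)+
  also have "(1 - var (Suc j)) ^ j = (1 - var (Suc j)) * (1 - var (Suc j)) ^ (j - 1)"
    using assms by (cases j) auto
  finally show "weight k = (1 - var (Suc j)) * ?M" by (simp add: power_mult_distrib mult_ac)
  have "(\<Prod>i\<in>?A. swap_poly j ((1 - var i) ^ (i - 1))) = (\<Prod>i\<in>?A. (1 - var i) ^ (i - 1))"
    by (intro prod.cong) (auto simp: swap_poly_simps)
  then show "swap_poly j ?M = ?M" by (simp add: swap_poly_simps mult_ac)
qed

text \<open>The plain operator is antisymmetric under s_j, so twice its value at F is its value at F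
  - s_j F. For F = \<open>weight k * dd 1 j f\<close> this difference contains (x_j - x_(j+1)) times
  \<open>dd 1 j f\<close>, and the defining equation turns it into the same difference for
  \<open>weight k * f\<close>.\<close>

lemma dd_longest_0_weight_dd:
  assumes "1 \<le> j" "j < k"
  shows "dd_longest 0 k (weight k * dd 1 j f) = dd_longest 0 k (weight k * f)"
proof -
  obtain M where M: "weight k = (1 - var (Suc j)) * M" "swap_poly j M = M"
    using weight_factor[OF assms] .
  let ?F = "dd_longest 0 k" and ?g = "dd 1 j f"
  have eq: "(var j - var (Suc j)) * ?g = (1 - var (Suc j)) * f - (1 - var j) * swap_poly j f"
    using dd_eq[of j 1 f] by simp
  have "swap_poly j (weight k * ?g) = (1 - var j) * M * ?g"
    by (simp add: M swap_poly_simps swap_poly_dd)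
  then have "?F ((1 - var j) * M * ?g) = - ?F (weight k * ?g)"
    using dd_longest_0_swap_poly[OF assms] by metis
  then have "2 * ?F (weight k * ?g) = ?F (weight k * ?g - (1 - var j) * M * ?g)"
    by (simp add: dd_longest_diff)
  also have "weight k * ?g - (1 - var j) * M * ?g = M * ((var j - var (Suc j)) * ?g)"
    unfolding M by algebra
  also have "\<dots> = weight k * f - swap_poly j (weight k * f)"
    unfolding eq M by (simp add: swap_poly_simps M algebra_simps)
  also have "?F \<dots> = 2 * ?F (weight k * f)"
    by (simp add: dd_longest_diff dd_longest_0_swap_poly[OF assms])
  finally show ?thesis by simp
qed

lemma dd_longest_0_weight_dd_cycle:
  "m < k \<Longrightarrow> dd_longest 0 k (weight k * dd_cycle 1 m f) = dd_longest 0 k (weight k * f)"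
  by (induction m) (auto simp: dd_longest_0_weight_dd)

lemma dd_longest_0_weight_dd_longest:
  "m \<le> k \<Longrightarrow> dd_longest 0 k (weight k * dd_longest 1 m f) = dd_longest 0 k (weight k * f)"
  by (induction m arbitrary: f) (auto simp: dd_longest_0_weight_dd_cycle)

text \<open>The isobaric image is symmetric and can be pulled out of the plain operator; hence the
  two operators agree up to a factor independent of f.\<close>

lemma dd_longest_1_mult_weight:
  "dd_longest 1 k f * dd_longest 0 k (weight k) = dd_longest 0 k (weight k * f)"
proof -
  have "dd_longest 0 k (dd_longest 1 k f * weight k) = dd_longest 1 k f * dd_longest 0 k (weight k)"
    by (rule dd_longest_mult_left) (rule swap_poly_dd_longest_1)
  then show ?thesis using dd_longest_0_weight_dd_longest[of k k f] by (simp add: mult.commute)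
qed

section \<open>Grothendieck polynomials of Grassmannian permutations\<close>

definition monomial :: "nat \<Rightarrow> (nat \<Rightarrow> nat) \<Rightarrow> mpoly" where
  "monomial k c = (\<Prod>i\<in>{1..k}. var i ^ c i)"

lemma monomial_cong: "(\<And>i. 1 \<le> i \<Longrightarrow> i \<le> k \<Longrightarrow> c i = d i) \<Longrightarrow> monomial k c = monomial k d"
  unfolding monomial_def by (intro prod.cong) auto

lemma monomial_split:
  assumes "1 \<le> j" "j < k"
  shows "monomial k c = (var j ^ c j * var (Suc j) ^ c (Suc j)) * (\<Prod>i\<in>{1..k} - {j, Suc j}. var i ^ c i)"
proof -
  let ?A = "{1..k} - {j, Suc j}"
  have "{1..k} = insert j (insert (Suc j) ?A)" using assms by auto
  then have "monomial k c = (\<Prod>i\<in>insert j (insert (Suc j) ?A). var i ^ c i)" by (simp add: monomial_def)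
  then show ?thesis by simp
qed

lemma swap_poly_monomial:
  assumes "1 \<le> j" "j < k"
  shows "swap_poly j (monomial k c) = monomial k (c \<circ> swapidx j)"
proof -
  have "monomial k (c \<circ> swapidx j) = (\<Prod>i\<in>{1..k}. var (swapidx j i) ^ c i)"
    unfolding monomial_def
    by (rule prod.reindex_bij_witness[of _ "swapidx j" "swapidx j"])
      (use assms in \<open>auto simp: swapidx_def split: if_splits\<close>)
  then show ?thesis by (simp add: monomial_def swap_poly_simps)
qed

lemma dd_monomial_split:
  assumes "1 \<le> j" "j < k"
  shows "dd t j (monomial k c) = (\<Prod>i\<in>{1..k} - {j, Suc j}. var i ^ c i) * dd t j (var j ^ c j * var (Suc j) ^ c (Suc j))"
  unfolding monomial_split[OF assms] mult.commute[of "_ * _"]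
proof (rule dd_mult_left)
  show "swap_poly j (\<Prod>i\<in>{1..k} - {j, Suc j}. var i ^ c i) = (\<Prod>i\<in>{1..k} - {j, Suc j}. var i ^ c i)"
    unfolding swap_poly_prod by (intro prod.cong) (auto simp: swap_poly_simps)
qed

lemma monomial_upd_split:
  assumes "1 \<le> j" "j < k"
  shows "monomial k (c(j := p, Suc j := q)) = (\<Prod>i\<in>{1..k} - {j, Suc j}. var i ^ c i) * (var j ^ p * var (Suc j) ^ q)"
proof -
  have "(\<Prod>i\<in>{1..k} - {j, Suc j}. var i ^ (c(j := p, Suc j := q)) i) = (\<Prod>i\<in>{1..k} - {j, Suc j}. var i ^ c i)"
    by (intro prod.cong) auto
  then show ?thesis unfolding monomial_split[OF assms] by simp
qed

text \<open>The isobaric operator sends x_j to 1, and what remains after splitting off one x_j has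
  equal exponents at j and j + 1, hence is symmetric.\<close>

lemma dd_1_monomial:
  assumes "1 \<le> j" "j < k" "c j = Suc (c (Suc j))"
  shows "dd 1 j (monomial k c) = monomial k (c(j := c (Suc j)))"
proof -
  have "dd 1 j (var j ^ c j * var (Suc j) ^ c (Suc j)) = var j ^ c (Suc j) * var (Suc j) ^ c (Suc j)"
    by (rule dd_unique) (simp add: assms(3) swap_poly_simps algebra_simps)
  then show ?thesis
    unfolding dd_monomial_split[OF assms(1,2)]
    using monomial_upd_split[OF assms(1,2), of c "c (Suc j)" "c (Suc j)"]
    by (simp add: fun_upd_idem)
qed

lemma telescope_powers:
  fixes x y :: "'a::comm_ring_1"
  shows "(x - y) * (\<Sum>d\<in>{q..<q + r}. x ^ d * y ^ (q + r + q - 1 - d)) = x ^ (q + r) * y ^ q - x ^ q * y ^ (q + r)"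
proof -
  have "(\<Sum>d\<in>{q..<q + r}. x ^ d * y ^ (q + r + q - 1 - d)) = (\<Sum>d<r. x ^ (q + d) * y ^ (q + (r - Suc d)))"
    by (rule sum.reindex_bij_witness[of _ "\<lambda>d. q + d" "\<lambda>d. d - q"])
      (auto intro!: arg_cong[of _ _ "\<lambda>e. _ * y ^ e"])
  also have "\<dots> = (x * y) ^ q * (\<Sum>d<r. y ^ (r - Suc d) * x ^ d)"
    unfolding sum_distrib_left by (intro sum.cong refl) (simp only: power_mult_distrib power_add mult_ac)
  also have "(x - y) * \<dots> = (x * y) ^ q * (x ^ r - y ^ r)"
    by (simp add: power_diff_sumr2[of x r y])
  finally show ?thesis
    by (simp add: power_add power_mult_distrib algebra_simps)
qed

text \<open>The geometric sum for x^p y^q - x^q y^p. Both new exponents lie in the half-open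
  interval from q to p, the origin of the intervals in \<open>box\<close>.\<close>

lemma dd_0_monomial:
  assumes "1 \<le> j" "j < k" "c (Suc j) \<le> c j"
  shows "dd 0 j (monomial k c) = (\<Sum>d\<in>{c (Suc j)..<c j}. monomial k (c(j := d, Suc j := c j + c (Suc j) - 1 - d)))"
proof -
  obtain r where r: "c j = c (Suc j) + r" using assms(3) le_Suc_ex by blast
  have "dd 0 j (var j ^ c j * var (Suc j) ^ c (Suc j)) =
    (\<Sum>d\<in>{c (Suc j)..<c j}. var j ^ d * var (Suc j) ^ (c j + c (Suc j) - 1 - d))"
    using telescope_powers[of "var j" "var (Suc j)" "c (Suc j)" r]
    by (intro dd_unique) (simp add: r swap_poly_simps mult.commute)
  then show ?thesis
    unfolding dd_monomial_split[OF assms(1,2)] monomial_upd_split[OF assms(1,2)] by (simp add: sum_distrib_left)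
qed

section \<open>Well-definedness of Grothendieck polynomials\<close>

lemma involution_permutes:
  "(\<And>x. f (f x) = x) \<Longrightarrow> (\<And>x. x \<notin> A \<Longrightarrow> f x = x) \<Longrightarrow> f permutes A"
  unfolding permutes_def by metis

lemma s_permutes: "j \<in> {1..<n} \<Longrightarrow> s j permutes {1..n}"
  by (rule involution_permutes) (auto simp: s_def swapidx_def)

text \<open>A termination measure in place of the number of inversions: swapping an ascent at j
  lowers it by w(j+1) - w(j).\<close>

definition perm_weight :: "nat \<Rightarrow> (nat \<Rightarrow> nat) \<Rightarrow> nat" where
  "perm_weight n w = (\<Sum>i\<in>{1..n}. i * w i)"

lemma perm_weight_less:
  assumes "j \<in> {1..<n}" "w j < w (Suc j)"
  shows "perm_weight n (w \<circ> s j) < perm_weight n w"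
proof -
  let ?A = "{1..n} - {j, Suc j}"
  have "{1..n} = insert j (insert (Suc j) ?A)" using assms by auto
  then have split: "perm_weight n v = j * v j + Suc j * v (Suc j) + (\<Sum>i\<in>?A. i * v i)" for v
    unfolding perm_weight_def by (metis (no_types, lifting) Diff_iff add.assoc finite_Diff finite_atLeastAtMost
        finite_insert insertCI insertE n_not_Suc_n sum.insert)
  have "(\<Sum>i\<in>?A. i * (w \<circ> s j) i) = (\<Sum>i\<in>?A. i * w i)"
    by (intro sum.cong) (auto simp: s_def)
  then show ?thesis using assms(2) by (simp add: split s_def)
qed

lemma longest_longest: "longest m (longest m i) = i"
  by (auto simp: longest_def)

lemma longest_permutes: "m \<le> n \<Longrightarrow> longest m permutes {1..n}"
  by (rule involution_permutes) (simp add: longest_longest, auto simp: longest_def)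

text \<open>The values are bounded above from position 1 onwards and below from position n
  backwards; the two bounds meet.\<close>

lemma no_ascent_imp_longest:
  assumes "w permutes {1..n}" "\<And>i. i \<in> {1..<n} \<Longrightarrow> w (Suc i) < w i"
  shows "w = longest n"
proof
  fix i
  have upper: "1 \<le> i \<Longrightarrow> i \<le> n \<Longrightarrow> w i + i \<le> n + 1" for i
  proof (induction i rule: dec_induct)
    case base
    then show ?case using permutes_in_image[OF assms(1), of 1] by auto
  next
    case (step i)
    then show ?case using assms(2)[of i] by auto
  qed
  have lower: "i \<le> n \<Longrightarrow> 1 \<le> i \<Longrightarrow> n + 1 \<le> w i + i" for i
  proof (induction i rule: inc_induct)
    case base
    then show ?case using permutes_in_image[OF assms(1), of n] by auto
  next
    case (step i)
    then show ?case using assms(2)[of i] by auto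
  qed
  show "w i = longest n i"
    using upper[of i] lower[of i] permutes_not_in[OF assms(1), of i] by (auto simp: longest_def)
qed

lemma ascent_exists:
  assumes "w permutes {1..n}" "w \<noteq> longest n"
  obtains j where "j \<in> {1..<n}" "w j < w (Suc j)"
proof -
  obtain j where "j \<in> {1..<n}" "\<not> w (Suc j) < w j" using no_ascent_imp_longest assms by blast
  moreover have "w (Suc j) \<noteq> w j" using permutes_inj[OF assms(1)] by (metis injD n_not_Suc_n)
  ultimately show ?thesis using that by auto
qed

lemma is_groth_exists:
  "w permutes {1..n} \<Longrightarrow> \<exists>G. is_groth n w G"
proof (induction w rule: measure_induct_rule[of "perm_weight n"])
  case (less w)
  show ?case
  proof (cases "w = longest n")
    case True then show ?thesis using is_groth.top by blast
  next
    case False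
    then obtain j where j: "j \<in> {1..<n}" "w j < w (Suc j)" using ascent_exists less.prems by blast
    then have "(w \<circ> s j) permutes {1..n}" using permutes_compose[OF s_permutes less.prems] by blast
    then obtain G where "is_groth n (w \<circ> s j) G" using less.IH[OF perm_weight_less[OF j]] by blast
    then show ?thesis using is_groth.step[of n w j G] j less.prems by auto
  qed
qed

lemma is_groth_step':
  assumes "is_groth n u G" "u = w \<circ> s j" "j \<in> {1..<n}" "w permutes {1..n}" "w j < w (Suc j)"
  shows "is_groth n w (dd 1 j G)"
  using is_groth.step[of n w j G] assms by (simp add: ddiff_bar_eq_dd)

text \<open>A diamond argument: if the last steps use different ascents i and j of w, then w s_i and
  w s_j both lead on to a common permutation u, and the braid or commutation relation of the
  operators identifies the two results.\<close>

lemma is_groth_unique: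
  assumes "is_groth n w G" "is_groth n w H" "w permutes {1..n}"
  shows "G = H"
  using assms
proof (induction w arbitrary: G H rule: measure_induct_rule[of "perm_weight n"])
  case (less w)
  note perm = \<open>w permutes {1..n}\<close>
  have perm_s: "(v \<circ> s j) permutes {1..n}" if "v permutes {1..n}" "j \<in> {1..<n}" for v j
    using that permutes_compose[OF s_permutes] by blast
  have longest: "\<not> w j < w (Suc j)" if "w = longest n" "j \<in> {1..<n}" for j
    using that by (auto simp: longest_def)
  have diamond: "dd 1 i K = dd 1 j L"
    if K: "is_groth n (w \<circ> s i) K" and L: "is_groth n (w \<circ> s j) L"
      and i: "i \<in> {1..<n}" "w i < w (Suc i)" and j: "j \<in> {1..<n}" "w j < w (Suc j)" and "i < j" for i j K L
  proof (cases "j = Suc i")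
    case True
    \<comment> \<open>The entries of w at i, i + 1, i + 2 increase; u reverses them and is reached
      along either word of length three.\<close>
    let ?u = "w \<circ> s i \<circ> s j \<circ> s i"
    have u_eq: "?u = w \<circ> s j \<circ> s i \<circ> s j"
      by (auto simp: fun_eq_iff s_def swapidx_def True)
    obtain U where U: "is_groth n ?u U" using is_groth_exists perm_s perm i j by meson
    have "is_groth n (w \<circ> s i \<circ> s j) (dd 1 i U)"
      by (rule is_groth_step'[OF U]) (use True perm perm_s i j in \<open>auto simp: s_def swapidx_def\<close>)
    then have "is_groth n (w \<circ> s i) (dd 1 j (dd 1 i U))"
      by (rule is_groth_step') (use True perm perm_s i j in \<open>auto simp: s_def swapidx_def\<close>)
    then have "K = dd 1 j (dd 1 i U)"
      using less.IH[OF perm_weight_less[OF i]] K perm_s perm i by blast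
    moreover
    have "is_groth n (w \<circ> s j \<circ> s i) (dd 1 j U)"
      by (rule is_groth_step'[OF U]) (use True perm perm_s i j in \<open>auto simp: u_eq s_def swapidx_def\<close>)
    then have "is_groth n (w \<circ> s j) (dd 1 i (dd 1 j U))"
      by (rule is_groth_step') (use True perm perm_s i j in \<open>auto simp: s_def swapidx_def\<close>)
    then have "L = dd 1 i (dd 1 j U)"
      using less.IH[OF perm_weight_less[OF j]] L perm_s perm j by blast
    ultimately show ?thesis by (simp add: True dd_braid)
  next
    case False
    let ?u = "w \<circ> s i \<circ> s j"
    have u_eq: "?u = w \<circ> s j \<circ> s i"
      using False \<open>i < j\<close> by (auto simp: fun_eq_iff s_def swapidx_def)
    obtain U where U: "is_groth n ?u U" using is_groth_exists perm_s perm i j by meson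
    have "is_groth n (w \<circ> s i) (dd 1 j U)"
      by (rule is_groth_step'[OF U]) (use False \<open>i < j\<close> perm perm_s i j in \<open>auto simp: s_def swapidx_def\<close>)
    then have "K = dd 1 j U"
      using less.IH[OF perm_weight_less[OF i]] K perm_s perm i by blast
    moreover have "is_groth n (w \<circ> s j) (dd 1 i U)"
      by (rule is_groth_step'[OF U]) (use False \<open>i < j\<close> perm perm_s i j in \<open>auto simp: u_eq s_def swapidx_def\<close>)
    then have "L = dd 1 i U"
      using less.IH[OF perm_weight_less[OF j]] L perm_s perm j by blast
    ultimately show ?thesis using False \<open>i < j\<close> by (auto intro: dd_commute)
  qed
  show ?case
    using \<open>is_groth n w G\<close>
  proof cases
    case top
    show ?thesis using \<open>is_groth n w H\<close> by cases (use top longest in auto)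
  next
    case (step i K)
    note i = step
    show ?thesis using \<open>is_groth n w H\<close>
    proof cases
      case top
      then show ?thesis using longest i by auto
    next
      case (step j L)
      consider "i = j" | "i < j" | "j < i" by linarith
      then show ?thesis
      proof cases
        case 1
        have "K = L"
        proof (rule less.IH[of "w \<circ> s i"])
          show "perm_weight n (w \<circ> s i) < perm_weight n w" using perm_weight_less i by auto
        qed (use i step perm_s[OF perm, of i] 1 in blast)+
        then show ?thesis using i step 1 by simp
      next
        case 2
        then show ?thesis using diamond[of i K j L] i step by (simp add: ddiff_bar_eq_dd)
      next
        case 3
        then show ?thesis using diamond[of j L i K] i step by (simp add: ddiff_bar_eq_dd)
      qed
    qed
  qed
qed

lemma groth_eqI: "is_groth n w G \<Longrightarrow> w permutes {1..n} \<Longrightarrow> groth n w = G"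
  unfolding groth_def using is_groth_unique by blast

section \<open>Lehmer codes and dominant permutations\<close>

definition code :: "nat \<Rightarrow> (nat \<Rightarrow> nat) \<Rightarrow> nat \<Rightarrow> nat" where
  "code n w i = card {l. i < l \<and> l \<le> n \<and> w l < w i}"

lemma finite_code_set [simp]: "finite {l::nat. i < l \<and> l \<le> n \<and> P l}"
  by (rule finite_subset[of _ "{..n}"]) auto

lemma code_mono_ascent:
  assumes "w i < w (Suc i)"
  shows "code n w i \<le> code n w (Suc i)"
  unfolding code_def
proof (intro card_mono subsetI)
  fix l assume l: "l \<in> {l. i < l \<and> l \<le> n \<and> w l < w i}"
  then have "l \<noteq> Suc i" using assms by auto
  then show "l \<in> {l. Suc i < l \<and> l \<le> n \<and> w l < w (Suc i)}" using l assms by auto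
qed simp

lemma code_descent:
  assumes "i < n" "w (Suc i) < w i"
  shows "code n w (Suc i) < code n w i"
  unfolding code_def
proof (rule psubset_card_mono)
  let ?A = "{l. Suc i < l \<and> l \<le> n \<and> w l < w (Suc i)}" and ?B = "{l. i < l \<and> l \<le> n \<and> w l < w i}"
  have "?A \<subseteq> ?B"
  proof
    fix l assume "l \<in> ?A"
    then show "l \<in> ?B" using less_trans[of "w l" "w (Suc i)" "w i"] assms(2) by simp
  qed
  moreover have "Suc i \<in> ?B" "Suc i \<notin> ?A" using assms by simp_all
  ultimately show "?A \<subset> ?B" by blast
qed simp

text \<open>The larger entry, moved to position j, sees the same smaller entries to its right as
  before and in addition the one that it has passed.\<close>

lemma code_comp_s:
  assumes "j \<in> {1..<n}" "w j < w (Suc j)"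
  shows "code n (w \<circ> s j) = (code n w)(j := Suc (code n w (Suc j)), Suc j := code n w j)"
proof
  fix i
  have s_simps: "s j j = Suc j" "s j (Suc j) = j" "\<And>l. l \<noteq> j \<Longrightarrow> l \<noteq> Suc j \<Longrightarrow> s j l = l"
    and ss: "\<And>l. s j (s j l) = l"
    by (simp_all add: s_def)
  have le: "s j l \<le> n \<longleftrightarrow> l \<le> n" for l using assms(1) by (auto simp: s_def swapidx_def)
  consider "i = j" | "i = Suc j" | "i \<noteq> j" "i \<noteq> Suc j" by blast
  then show "code n (w \<circ> s j) i = ((code n w)(j := Suc (code n w (Suc j)), Suc j := code n w j)) i"
  proof cases
    case 1
    have "{l. j < l \<and> l \<le> n \<and> w (s j l) < w (Suc j)} = insert (Suc j) {l. Suc j < l \<and> l \<le> n \<and> w l < w (Suc j)}"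
    proof (rule set_eqI)
      fix l
      consider "l = j" | "l = Suc j" | "l \<noteq> j" "l \<noteq> Suc j" by blast
      then show "l \<in> {l. j < l \<and> l \<le> n \<and> w (s j l) < w (Suc j)} \<longleftrightarrow>
          l \<in> insert (Suc j) {l. Suc j < l \<and> l \<le> n \<and> w l < w (Suc j)}"
      proof cases
        case 3
        then have "j < l \<longleftrightarrow> Suc j < l" by linarith
        with 3 show ?thesis by (simp add: s_simps)
      qed (use assms in \<open>simp_all add: s_simps\<close>)
    qed
    then show ?thesis by (simp add: code_def 1 s_simps)
  next
    case 2
    have "{l. Suc j < l \<and> l \<le> n \<and> w (s j l) < w j} = {l. j < l \<and> l \<le> n \<and> w l < w j}"
    proof (rule set_eqI)
      fix l
      consider "l = j" | "l = Suc j" | "l \<noteq> j" "l \<noteq> Suc j" by blast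
      then show "l \<in> {l. Suc j < l \<and> l \<le> n \<and> w (s j l) < w j} \<longleftrightarrow> l \<in> {l. j < l \<and> l \<le> n \<and> w l < w j}"
      proof cases
        case 3
        then have "j < l \<longleftrightarrow> Suc j < l" by linarith
        with 3 show ?thesis by (simp add: s_simps)
      qed (use assms(2) in \<open>simp_all add: s_simps\<close>)
    qed
    then show ?thesis by (simp add: code_def 2 s_simps)
  next
    case 3
    then have less: "i < s j l \<longleftrightarrow> i < l" for l by (auto simp: s_def swapidx_def)
    have "bij_betw (s j) {l. i < l \<and> l \<le> n \<and> w (s j l) < w i} {l. i < l \<and> l \<le> n \<and> w l < w i}"
      by (rule bij_betw_byWitness[of _ "s j"]) (auto simp: ss le less)
    then show ?thesis using 3 by (simp add: code_def s_simps bij_betw_same_card)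
  qed
qed

text \<open>Permutations whose code is a partition are the dominant ones.\<close>

lemma is_groth_dominant:
  assumes "w permutes {1..n}" "\<And>i. i \<in> {1..<n} \<Longrightarrow> code n w (Suc i) \<le> code n w i"
  shows "is_groth n w (monomial n (code n w))"
  using assms
proof (induction w rule: measure_induct_rule[of "perm_weight n"])
  case (less w)
  show ?case
  proof (cases "w = longest n")
    case True
    have "code n (longest n) i = n - i" if "1 \<le> i" "i \<le> n" for i
    proof -
      have "{l. i < l \<and> l \<le> n \<and> longest n l < longest n i} = {i<..n}"
        using that by (auto simp: longest_def)
      then show ?thesis by (simp add: code_def)
    qed
    then have "monomial n (code n (longest n)) = monomial n (\<lambda>i. n - i)" by (intro monomial_cong) auto
    also have "\<dots> = (\<Prod>i\<in>{1..<n}. var i ^ (n - i))"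
      unfolding monomial_def by (rule prod.mono_neutral_right) auto
    finally show ?thesis using is_groth.top True by metis
  next
    case False
    \<comment> \<open>The first ascent: all earlier positions are descents, so the code drops
      strictly just before j and remains weakly decreasing when its value at j is raised by
      one.\<close>
    define j where "j = (LEAST j. j \<in> {1..<n} \<and> w j < w (Suc j))"
    have "\<exists>j. j \<in> {1..<n} \<and> w j < w (Suc j)" using ascent_exists False less.prems(1) by blast
    then have j: "j \<in> {1..<n}" "w j < w (Suc j)" unfolding j_def by (metis (mono_tags, lifting) LeastI_ex)+
    have less_j: "w (Suc i) < w i" if "1 \<le> i" "i < j" for i
    proof -
      have "\<not> w i < w (Suc i)" using not_less_Least[of i, folded j_def] that j
        using j_def not_less_Least by fastforce
      moreover have "w i \<noteq> w (Suc i)" using permutes_inj[OF less.prems(1)] by (metis injD n_not_Suc_n)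
      ultimately show ?thesis by simp
    qed
    let ?c = "code n w" and ?d = "code n (w \<circ> s j)"
    note d = code_comp_s[OF j]
    \<comment> \<open>At an ascent the code weakly increases, and by assumption it weakly decreases.
      Equality makes the exponents for w s_j at j and j + 1 differ by exactly one, as
      \<open>dd_1_monomial\<close> demands.\<close>
    have eq: "?c j = ?c (Suc j)"
      using code_mono_ascent[of w j n] j less.prems(2)[of j] by simp
    have "?d (Suc i) \<le> ?d i" if i: "i \<in> {1..<n}" for i
    proof -
      consider "i = j" | "i = Suc j" | "Suc i = j" | "i \<noteq> j" "i \<noteq> Suc j" "Suc i \<noteq> j" by blast
      then show ?thesis
      proof cases
        case 3
        then show ?thesis using code_descent[of i n w] less_j[of i] i eq by (auto simp: d)
      qed (use less.prems(2)[of i] i eq in \<open>auto simp: d\<close>)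
    qed
    moreover have "(w \<circ> s j) permutes {1..n}" using permutes_compose[OF s_permutes less.prems(1)] j by blast
    ultimately have "is_groth n (w \<circ> s j) (monomial n ?d)" using less.IH[OF perm_weight_less[OF j]] by blast
    then have "is_groth n w (dd 1 j (monomial n ?d))" by (rule is_groth_step') (use j less.prems in auto)
    also have "dd 1 j (monomial n ?d) = monomial n (?d(j := ?d (Suc j)))"
      by (rule dd_1_monomial) (use j eq in \<open>auto simp: d\<close>)
    also have "?d(j := ?d (Suc j)) = ?c" by (auto simp: d eq)
    finally show ?thesis .
  qed
qed

section \<open>Reversing an initial block of entries\<close>

definition cycle :: "nat \<Rightarrow> nat \<Rightarrow> nat" where
  "cycle p i = (if 1 \<le> i \<and> i \<le> p then Suc i else if i = Suc p then 1 else i)"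

lemma cycle_comp_s: "cycle (Suc p) \<circ> s (Suc p) = cycle p"
  by (auto simp: fun_eq_iff cycle_def s_def swapidx_def)

lemma cycle_Suc: "cycle (Suc p) = cycle p \<circ> s (Suc p)"
  by (auto simp: fun_eq_iff cycle_def s_def swapidx_def)

lemma cycle_permutes: "p < n \<Longrightarrow> cycle p permutes {1..n}"
proof (induction p)
  case 0
  have "cycle 0 = id" by (auto simp: cycle_def)
  then show ?case by (metis permutes_id)
next
  case (Suc p)
  then show ?case unfolding cycle_Suc by (intro permutes_compose s_permutes) auto
qed

text \<open>Composing with \<open>cycle p\<close> moves the first entry to position p + 1. As the
  largest of the block it passes smaller entries only, so each move creates an ascent, as a step of
  \<open>is_groth\<close> requires.\<close>

lemma is_groth_cycle:
  assumes "is_groth n u G" "u permutes {1..n}" "\<And>i. 1 \<le> i \<Longrightarrow> i < m \<Longrightarrow> u (Suc i) < u i" "m \<le> n" "p < m"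
  shows "is_groth n (u \<circ> cycle p) (dd_cycle 1 p G)"
  using \<open>p < m\<close>
proof (induction p)
  case 0
  have "u \<circ> cycle 0 = u" by (auto simp: cycle_def)
  then show ?case using assms(1) by simp
next
  case (Suc p)
  have desc: "u (Suc i) < u 1" if "1 \<le> i" "i < m" for i
    using that
  proof (induction i rule: dec_induct)
    case base
    then show ?case using assms(3)[of 1] by simp
  next
    case (step i)
    then show ?case using assms(3)[of "Suc i"] by simp
  qed
  have "is_groth n (u \<circ> cycle p) (dd_cycle 1 p G)" using Suc Suc_lessD by blast
  then have "is_groth n (u \<circ> cycle (Suc p)) (dd 1 (Suc p) (dd_cycle 1 p G))"
  proof (rule is_groth_step')
    show "u \<circ> cycle p = u \<circ> cycle (Suc p) \<circ> s (Suc p)" by (simp add: cycle_comp_s comp_assoc)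
    show "(u \<circ> cycle (Suc p)) permutes {1..n}"
      using assms Suc.prems by (intro permutes_compose cycle_permutes) auto
    show "(u \<circ> cycle (Suc p)) (Suc p) < (u \<circ> cycle (Suc p)) (Suc (Suc p))"
      using desc[of "Suc p"] Suc.prems by (simp add: cycle_def)
  qed (use assms Suc.prems in auto)
  then show ?case by (metis dd_cycle.simps(2))
qed

text \<open>A block is reversed by moving its first entry to the end and reversing the remaining
  ones, which is the recursion of \<open>dd_longest\<close>.\<close>

lemma is_groth_longest:
  assumes "is_groth n u G" "u permutes {1..n}" "\<And>i. 1 \<le> i \<Longrightarrow> i < m \<Longrightarrow> u (Suc i) < u i" "m \<le> n"
  shows "is_groth n (u \<circ> longest m) (dd_longest 1 m G)"
  using assms
proof (induction m arbitrary: u G)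
  case 0
  have "u \<circ> longest 0 = u" by (auto simp: longest_def)
  then show ?case using 0 by simp
next
  case (Suc m)
  have "is_groth n (u \<circ> cycle m) (dd_cycle 1 m G)" using is_groth_cycle[OF Suc.prems, of m] by auto
  moreover have "(u \<circ> cycle m) permutes {1..n}"
    using Suc.prems by (intro permutes_compose cycle_permutes) auto
  moreover have "(u \<circ> cycle m) (Suc i) < (u \<circ> cycle m) i" if "1 \<le> i" "i < m" for i
    using that Suc.prems(3)[of "Suc i"] by (simp add: cycle_def)
  ultimately have "is_groth n (u \<circ> cycle m \<circ> longest m) (dd_longest 1 m (dd_cycle 1 m G))"
    using Suc.IH Suc.prems(4) Suc_leD by blast
  moreover have "cycle m \<circ> longest m = longest (Suc m)"
    by (auto simp: fun_eq_iff cycle_def longest_def)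
  ultimately show ?case by (metis comp_assoc dd_longest.simps(2))
qed

definition strict_decr :: "nat \<Rightarrow> (nat \<Rightarrow> nat) \<Rightarrow> bool" where
  "strict_decr k a \<longleftrightarrow> (\<forall>i. 1 \<le> i \<and> i < k \<longrightarrow> a (Suc i) < a i)"

lemma groth_grassmannian:
  assumes "w permutes {1..n}" "grassmannian n w"
  obtains k a where "1 \<le> k" "k < n" "strict_decr k a" "groth n w = dd_longest 1 k (monomial k a)"
proof -
  obtain k where k: "{i \<in> {1..<n}. w i > w (i + 1)} = {k}"
    using assms(2) unfolding grassmannian_def by (auto simp: card_1_singleton_iff)
  then have "k \<in> {i \<in> {1..<n}. w i > w (i + 1)}" by blast
  then have k1: "1 \<le> k" "k < n" by auto
  have incr: "w i < w (Suc i)" if "1 \<le> i" "i < n" "i \<noteq> k" for i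
  proof -
    have "i \<notin> {i \<in> {1..<n}. w i > w (i + 1)}" using k that by auto
    moreover have "w i \<noteq> w (Suc i)" using permutes_inj[OF assms(1)] by (metis injD n_not_Suc_n)
    ultimately show ?thesis using that by auto
  qed
  \<comment> \<open>The entries of w increase on 1..k and on k+1..n; reversing the first block makes
    the code strictly decreasing on 1..k and zero beyond.\<close>
  let ?v = "w \<circ> longest k"
  have perm: "?v permutes {1..n}" using assms(1) longest_permutes[of k n] k1 by (intro permutes_compose) auto
  have desc: "?v (Suc i) < ?v i" if "1 \<le> i" "i < k" for i
    using incr[of "k - i"] that k1 by (auto simp: longest_def Suc_diff_le)
  have "?v i < ?v l" if "k < i" "i < l" "l \<le> n" for i l
  proof -
    have "Suc i \<le> l" using that by simp
    then have "l \<le> n \<longrightarrow> ?v i < ?v l"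
    proof (induction l rule: dec_induct)
      case base
      then show ?case using incr[of i] that by (auto simp: longest_def)
    next
      case (step l)
      then show ?case using incr[of l] that by (auto simp: longest_def)
    qed
    then show ?thesis using that by simp
  qed
  then have zero: "code n ?v i = 0" if "k < i" for i
    using that unfolding code_def by (auto simp: card_eq_0_iff) (meson order_less_asym)
  have decr: "code n ?v (Suc i) < code n ?v i" if "1 \<le> i" "i < k" for i
    using code_descent[of i n ?v] desc[OF that] that k1 by simp
  have "is_groth n ?v (monomial n (code n ?v))"
  proof (rule is_groth_dominant[OF perm])
    fix i assume "i \<in> {1..<n}"
    then show "code n ?v (Suc i) \<le> code n ?v i"
      using decr[of i] zero[of "Suc i"] by (cases "i < k") auto
  qed
  also have "monomial n (code n ?v) = monomial k (code n ?v)"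
    unfolding monomial_def by (rule prod.mono_neutral_right) (use k1 zero in auto)
  finally have "is_groth n (?v \<circ> longest k) (dd_longest 1 k (monomial k (code n ?v)))"
    by (rule is_groth_longest[OF _ perm desc]) (use k1 in auto)
  moreover have "?v \<circ> longest k = w" by (simp add: fun_eq_iff longest_longest)
  ultimately have "groth n w = dd_longest 1 k (monomial k (code n ?v))"
    using assms(1) groth_eqI by metis
  then show ?thesis using that[of k "code n ?v"] k1 decr by (simp add: strict_decr_def)
qed

section \<open>Branching of Schur polynomials\<close>

text \<open>The letters m + 1, ..., m + d that remain of a cycle after its first m letters have
  acted; the branching rule applies them one at a time.\<close>

fun dd_from :: "nat \<Rightarrow> nat \<Rightarrow> mpoly \<Rightarrow> mpoly" where
  "dd_from m 0 f = f"
| "dd_from m (Suc d) f = dd_from (Suc m) d (dd 0 (Suc m) f)"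

lemma dd_from_dd_cycle: "dd_from m d (dd_cycle 0 m f) = dd_cycle 0 (m + d) f"
proof (induction d arbitrary: m)
  case (Suc d)
  show ?case using Suc[of "Suc m"] by simp
qed simp

lemma dd_from_sum: "dd_from m d (\<Sum>i\<in>A. f i) = (\<Sum>i\<in>A. dd_from m d (f i))"
  by (induction d arbitrary: m f) (auto simp: dd_sum)

lemma swap_poly_dd_from: "j < m \<Longrightarrow> swap_poly j (dd_from m d f) = dd_from m d (swap_poly j f)"
  by (induction d arbitrary: m f) (auto simp: swap_poly_dd_commute)

text \<open>The transposition (p, q+1) is (p, q) conjugated by s_q, so the sign changes three
  times.\<close>

lemma antisymmetric_transpose:
  fixes F :: "(nat \<Rightarrow> nat) \<Rightarrow> 'a::group_add"
  assumes adj: "\<And>c j. 1 \<le> j \<Longrightarrow> j < m \<Longrightarrow> F (c \<circ> swapidx j) = - F c"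
    and "1 \<le> p" "p < q" "q \<le> m"
  shows "F (c \<circ> transpose p q) = - F c"
proof -
  have "Suc p \<le> q" using assms by simp
  then have "q \<le> m \<longrightarrow> (\<forall>c. F (c \<circ> transpose p q) = - F c)"
  proof (induction q rule: dec_induct)
    case base
    have "transpose p (Suc p) = swapidx p" by (auto simp: fun_eq_iff transpose_def swapidx_def)
    then show ?case using adj[of p] assms(2-4) by (metis order_less_le_trans)
  next
    case (step q)
    have eq: "transpose p (Suc q) = swapidx q \<circ> transpose p q \<circ> swapidx q"
      using step(1) by (auto simp: fun_eq_iff transpose_def swapidx_def)
    show ?case
    proof (intro impI allI)
      fix c assume "Suc q \<le> m"
      then have "F (c \<circ> swapidx q \<circ> transpose p q \<circ> swapidx q) = - F (c \<circ> swapidx q \<circ> transpose p q)"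
        by (intro adj) (use assms step in auto)
      also have "F (c \<circ> swapidx q \<circ> transpose p q) = - F (c \<circ> swapidx q)"
        using step.IH \<open>Suc q \<le> m\<close> Suc_leD by blast
      also have "F (c \<circ> swapidx q) = - F c"
        using adj[of q c] assms step \<open>Suc q \<le> m\<close> by simp
      finally show "F (c \<circ> transpose p (Suc q)) = - F c" unfolding eq by (simp only: comp_assoc minus_minus)
    qed
  qed
  then show ?thesis using assms by simp
qed

text \<open>For j < m the swap s_j commutes with all letters above m and so reaches the outer plain
  operator, which is antisymmetric.\<close>

lemma dd_longest_dd_from_antisymmetric:
  assumes "m \<le> K" "1 \<le> p" "p < q" "q \<le> m" "m \<le> k"
  shows "dd_longest 0 K (dd_from m d (monomial k (c \<circ> transpose p q))) = - dd_longest 0 K (dd_from m d (monomial k c))"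
proof (rule antisymmetric_transpose[of m "\<lambda>c. dd_longest 0 K (dd_from m d (monomial k c))"])
  fix c j assume j: "1 \<le> j" "j < m"
  then have "monomial k (c \<circ> swapidx j) = swap_poly j (monomial k c)"
    using assms by (simp add: swap_poly_monomial)
  then show "dd_longest 0 K (dd_from m d (monomial k (c \<circ> swapidx j))) = - dd_longest 0 K (dd_from m d (monomial k c))"
    using j assms dd_longest_0_swap_poly[of j K] by (simp flip: swap_poly_dd_from)
qed (use assms in auto)

lemma sum_eq_0_by_involution:
  fixes F :: "'b \<Rightarrow> 'a::{idom, ring_char_0}"
  assumes "\<And>c. c \<in> R \<Longrightarrow> \<iota> c \<in> R" "\<And>c. c \<in> R \<Longrightarrow> \<iota> (\<iota> c) = c" "\<And>c. c \<in> R \<Longrightarrow> F (\<iota> c) = - F c"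
  shows "(\<Sum>c\<in>R. F c) = 0"
proof -
  have "(\<Sum>c\<in>R. F c) = (\<Sum>c\<in>R. - F c)"
    by (rule sum.reindex_bij_witness[of _ \<iota> \<iota>]) (use assms in auto)
  then have "(\<Sum>c\<in>R. F c) = - (\<Sum>c\<in>R. F c)" by (simp only: sum_negf)
  then have "2 * (\<Sum>c\<in>R. F c) = 0" by (metis mult_2 right_minus)
  then show ?thesis by simp
qed

lemma strict_decr_le:
  "strict_decr k a \<Longrightarrow> 1 \<le> i \<Longrightarrow> i \<le> j \<Longrightarrow> j \<le> k \<Longrightarrow> a j + (j - i) \<le> a i"
proof (induction j)
  case (Suc j)
  show ?case
  proof (cases "i = Suc j")
    case False
    moreover have "a (Suc j) < a j" using Suc.prems False unfolding strict_decr_def by auto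
    ultimately show ?thesis using Suc by fastforce
  qed simp
qed simp

text \<open>Interlacing in terms of exponents: after subtraction of the staircases, a (i+1) \<le> c
  i < a i says that the partition of c interlaces with that of a.\<close>

definition box :: "(nat \<Rightarrow> nat) \<Rightarrow> nat \<Rightarrow> (nat \<Rightarrow> nat) set" where
  "box a m = Pi\<^sub>E {1..m} (\<lambda>i. {a (Suc i)..<a i})"

text \<open>The exponents after the first m letters of a cycle. Position m + 1 holds what the total
  degree leaves; each of the m letters has lowered this degree by one, hence the subtraction of
  m.\<close>

definition box_exp :: "(nat \<Rightarrow> nat) \<Rightarrow> nat \<Rightarrow> (nat \<Rightarrow> nat) \<Rightarrow> nat \<Rightarrow> nat" where
  "box_exp a m c i = (if i \<le> m then c i
     else if i = Suc m then (\<Sum>l\<in>{1..Suc m}. a l) - m - (\<Sum>l\<in>{1..m}. c l) else a i)"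

lemma finite_box [simp]: "finite (box a m)"
  by (auto simp: box_def intro: finite_PiE)

lemma box_sum_le: "c \<in> box a m \<Longrightarrow> (\<Sum>l\<in>{1..m}. c l) + m \<le> (\<Sum>l\<in>{1..m}. a l)"
proof -
  assume "c \<in> box a m"
  then have "(\<Sum>l\<in>{1..m}. c l + 1) \<le> (\<Sum>l\<in>{1..m}. a l)"
    by (intro sum_mono) (auto simp: box_def PiE_def Pi_def Suc_le_eq)
  then show ?thesis by (simp add: sum_Suc)
qed

lemma sum_upd_Suc: "(\<Sum>l\<in>{1..m}. (c(Suc m := d)) l) = (\<Sum>l\<in>{1..m}. (c l :: nat))"
  by (intro sum.cong) auto

lemma sum_box_Suc:
  "(\<Sum>c\<in>box a (Suc m). F c) = (\<Sum>c\<in>box a m. \<Sum>d\<in>{a (Suc (Suc m))..<a (Suc m)}. F (c(Suc m := d)))"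
proof -
  have "{1..Suc m} = insert (Suc m) {1..m}" by auto
  then have "box a (Suc m) = (\<lambda>(d, c). c(Suc m := d)) ` ({a (Suc (Suc m))..<a (Suc m)} \<times> box a m)"
    unfolding box_def by (simp only: PiE_insert_eq)
  moreover have "inj_on (\<lambda>(d, c). c(Suc m := d)) ({a (Suc (Suc m))..<a (Suc m)} \<times> box a m)"
    unfolding box_def by (rule inj_combinator) auto
  ultimately have "(\<Sum>c\<in>box a (Suc m). F c) =
     (\<Sum>(d, c)\<in>{a (Suc (Suc m))..<a (Suc m)} \<times> box a m. F (c(Suc m := d)))"
    by (simp add: sum.reindex case_prod_unfold comp_def)
  then show ?thesis by (simp add: sum.cartesian_product[symmetric] sum.swap[of _ "box a m"])
qed

text \<open>The exponents produced by the next divided difference that do not interlace with the sequence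
  cancel in pairs: exchange the last exponent with the one lying in the same interval.\<close>

lemma interlacing_cancel:
  fixes d :: nat
  assumes a: "strict_decr k a" and "Suc m < k" "Suc m \<le> K"
  defines "F \<equiv> \<lambda>c. dd_longest 0 K (dd_from (Suc m) d (monomial k (box_exp a (Suc m) c)))"
  shows "(\<Sum>c\<in>box a m. \<Sum>e\<in>{a (Suc m)..<box_exp a m c (Suc m)}. F (c(Suc m := e))) = 0"
proof -
  \<comment> \<open>Appending e to c as entry m + 1 turns the double sum into a sum over R; the
    degree condition expresses e < \<open>box_exp a m c (Suc m)\<close>.\<close>
  define R where "R = {c \<in> extensional {1..Suc m}. (\<forall>i\<in>{1..m}. a (Suc i) \<le> c i \<and> c i < a i) \<and>
    a (Suc m) \<le> c (Suc m) \<and> (\<Sum>l\<in>{1..Suc m}. c l) + Suc m \<le> (\<Sum>l\<in>{1..Suc m}. a l)}"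
  have "(\<Sum>c\<in>box a m. \<Sum>e\<in>{a (Suc m)..<box_exp a m c (Suc m)}. F (c(Suc m := e))) =
    (\<Sum>(c, e)\<in>Sigma (box a m) (\<lambda>c. {a (Suc m)..<box_exp a m c (Suc m)}). F (c(Suc m := e)))"
    by (rule sum.Sigma) auto
  also have "\<dots> = (\<Sum>c\<in>R. F c)"
  proof (rule sum.reindex_bij_witness[of _ "\<lambda>c. (restrict c {1..m}, c (Suc m))" "\<lambda>(c, e). c(Suc m := e)"])
    fix p assume "p \<in> Sigma (box a m) (\<lambda>c. {a (Suc m)..<box_exp a m c (Suc m)})"
    then obtain c e where p: "p = (c, e)" "c \<in> box a m" "a (Suc m) \<le> e" "e < box_exp a m c (Suc m)" by auto
    have ext: "c \<in> extensional {1..m}" using p(2) by (simp add: box_def PiE_def)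
    then show "(restrict ((\<lambda>(c, e). c(Suc m := e)) p) {1..m}, ((\<lambda>(c, e). c(Suc m := e)) p) (Suc m)) = p"
      by (auto simp: p fun_eq_iff restrict_def extensional_def)
    have "(\<Sum>l\<in>{1..m}. c l) + e + Suc m \<le> (\<Sum>l\<in>{1..Suc m}. a l)"
      using p(4) by (simp add: box_exp_def)
    then show "(case p of (c, e) \<Rightarrow> c(Suc m := e)) \<in> R"
      using p ext sum_upd_Suc[of c m e] unfolding R_def
      by (auto simp: box_def PiE_def Pi_def extensional_def)
  next
    fix c assume c: "c \<in> R"
    have r: "(restrict c {1..m})(Suc m := c (Suc m)) = c"
      using c by (auto simp: R_def fun_eq_iff restrict_def extensional_def)
    then show "(case (restrict c {1..m}, c (Suc m)) of (c, e) \<Rightarrow> c(Suc m := e)) = c" by simp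
    have "(\<Sum>l\<in>{1..m}. restrict c {1..m} l) = (\<Sum>l\<in>{1..m}. c l)" by (intro sum.cong) auto
    then show "(restrict c {1..m}, c (Suc m)) \<in> Sigma (box a m) (\<lambda>c. {a (Suc m)..<box_exp a m c (Suc m)})"
      using c by (auto simp: R_def box_def box_exp_def)
  qed auto
  also have "\<dots> = 0"
  proof -
    \<comment> \<open>The index of the half-open interval from a (i+1) to a i that contains x.
      Exchanging the entry of this index with the last one keeps both in the same interval, hence
      keeps the index and is an involution.\<close>
    define idx where "idx x = (LEAST i. 1 \<le> i \<and> a (Suc i) \<le> x)" for x
    have idx_eq: "idx x = i" if "1 \<le> i" "i \<le> m" "a (Suc i) \<le> x" "x < a i" for i x
      unfolding idx_def
    proof (rule Least_equality)
      fix i' assume i': "1 \<le> i' \<and> a (Suc i') \<le> x"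
      show "i \<le> i'"
      proof (rule ccontr)
        assume "\<not> i \<le> i'"
        then have "a i \<le> a (Suc i')"
          using strict_decr_le[OF a, of "Suc i'" i] i' that assms(2) by auto
        then show False using that i' by simp
      qed
    qed (use that in auto)
    have idx: "1 \<le> idx (c (Suc m))" "idx (c (Suc m)) \<le> m"
       "a (Suc (idx (c (Suc m)))) \<le> c (Suc m)" "c (Suc m) < a (idx (c (Suc m)))" if c: "c \<in> R" for c
    proof -
      have "m \<noteq> 0"
      proof
        assume "m = 0"
        then show False using c by (auto simp: R_def)
      qed
      then have ex: "1 \<le> m \<and> a (Suc m) \<le> c (Suc m)" using c by (auto simp: R_def)
      let ?x = "c (Suc m)"
      have i: "1 \<le> idx ?x \<and> a (Suc (idx ?x)) \<le> ?x" unfolding idx_def by (rule LeastI[of _ m]) (use ex in simp)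
      then show "1 \<le> idx ?x" "a (Suc (idx ?x)) \<le> ?x" by auto
      show "idx ?x \<le> m" unfolding idx_def by (rule Least_le) (use ex in simp)
      show "?x < a (idx ?x)"
      proof (cases "idx ?x = 1")
        case True
        \<comment> \<open>Only the total degree bounds the last entry from above: the others are at
          least a 2, ..., a (m+1), which leaves less than a 1.\<close>
        have "(\<Sum>l\<in>{1..m}. a (Suc l)) \<le> (\<Sum>l\<in>{1..m}. c l)"
          using c by (intro sum_mono) (auto simp: R_def)
        moreover have "(\<Sum>l\<in>{1..Suc m}. a l) = a 1 + (\<Sum>l\<in>{1..m}. a (Suc l))"
          by (simp add: sum.atLeast_Suc_atMost sum.shift_bounds_cl_Suc_ivl del: sum.cl_ivl_Suc)
        ultimately show ?thesis using c True by (auto simp: R_def)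
      next
        case False
        then obtain i' where i': "idx ?x = Suc i'" "1 \<le> i'" using i by (cases "idx ?x") auto
        have "\<not> (1 \<le> i' \<and> a (Suc i') \<le> ?x)"
          using not_less_Least[of i' "\<lambda>i. 1 \<le> i \<and> a (Suc i) \<le> ?x"] i' by (simp add: idx_def)
        then show ?thesis using i' by simp
      qed
    qed
    define \<iota> where "\<iota> c = c \<circ> transpose (idx (c (Suc m))) (Suc m)" for c :: "nat \<Rightarrow> nat"
    have sum_tr: "(\<Sum>l\<in>{1..Suc m}. (c \<circ> transpose i (Suc m)) l) = (\<Sum>l\<in>{1..Suc m}. (c l :: nat))"
      if "1 \<le> i" "i \<le> m" for c i
      unfolding comp_def
      by (rule sum.reindex_bij_witness[of _ "transpose i (Suc m)" "transpose i (Suc m)"])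
        (use that in \<open>auto simp: transpose_def split: if_splits\<close>)
    have idx': "idx (c (idx (c (Suc m)))) = idx (c (Suc m))" if c: "c \<in> R" for c
      using c idx[OF c] by (intro idx_eq) (auto simp: R_def)
    show ?thesis
    proof (rule sum_eq_0_by_involution[of R \<iota>])
      fix c assume c: "c \<in> R"
      let ?i = "idx (c (Suc m))"
      note i = idx[OF c]
      show "\<iota> (\<iota> c) = c" using idx'[OF c] by (simp add: \<iota>_def comp_assoc)
      have "\<iota> c \<in> extensional {1..Suc m}"
        using c i by (auto simp: R_def \<iota>_def extensional_def transpose_def)
      moreover have "a (Suc l) \<le> \<iota> c l \<and> \<iota> c l < a l" if "l \<in> {1..m}" for l
        using c i that by (auto simp: R_def \<iota>_def transpose_def)
      moreover have "a (Suc m) \<le> a (Suc ?i)"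
        using strict_decr_le[OF a, of "Suc ?i" "Suc m"] i assms(2) by auto
      moreover have "a (Suc ?i) \<le> c ?i" using c i by (auto simp: R_def)
      moreover have "\<iota> c (Suc m) = c ?i" by (simp add: \<iota>_def)
      ultimately show "\<iota> c \<in> R"
        using c sum_tr[OF i(1,2), of c] unfolding R_def \<iota>_def by auto
      \<comment> \<open>Position m + 2 depends only on the sum of the first m + 1 entries, which the
        exchange preserves.\<close>
      have "box_exp a (Suc m) (\<iota> c) = box_exp a (Suc m) c \<circ> transpose ?i (Suc m)"
        using i sum_tr[OF i(1,2), of c] unfolding \<iota>_def fun_eq_iff box_exp_def
        by (auto simp: transpose_def)
      then show "F (\<iota> c) = - F c"
        unfolding F_def using dd_longest_dd_from_antisymmetric[of "Suc m" K ?i "Suc m" k] i assms by simp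
    qed
  qed
  finally show ?thesis .
qed

lemma box_exp_Suc_ge:
  assumes "c \<in> box a m"
  shows "a (Suc m) \<le> box_exp a m c (Suc m)"
  using box_sum_le[OF assms] by (simp add: box_exp_def)

text \<open>The state after m letters of the top cycle: only interlacing prefixes have survived, and
  d letters are still to act.\<close>

lemma dd_longest_0_monomial_aux:
  assumes a: "strict_decr (Suc K) a" and "m + d = K"
  shows "dd_longest 0 (Suc K) (monomial (Suc K) a) =
    dd_longest 0 K (dd_from m d (\<Sum>c\<in>box a m. monomial (Suc K) (box_exp a m c)))"
  using assms(2)
proof (induction m arbitrary: d)
  case 0
  have "box a 0 = {\<lambda>i. undefined}" by (simp add: box_def)
  moreover have "monomial (Suc K) (box_exp a 0 (\<lambda>i. undefined)) = monomial (Suc K) a"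
    by (intro monomial_cong) (auto simp: box_exp_def)
  ultimately show ?case using dd_from_dd_cycle[of 0 K] 0 by simp
next
  case (Suc m)
  let ?\<Psi> = "\<lambda>f. dd_longest 0 K (dd_from (Suc m) d f)"
  have add: "?\<Psi> (sum f A) = (\<Sum>i\<in>A. ?\<Psi> (f i))" for f :: "(nat \<Rightarrow> nat) \<Rightarrow> mpoly" and A
    by (simp add: dd_from_sum dd_longest_sum)
  have add': "?\<Psi> (sum f A) = (\<Sum>i\<in>A. ?\<Psi> (f i))" for f :: "nat \<Rightarrow> mpoly" and A
    by (simp add: dd_from_sum dd_longest_sum)
  let ?F = "\<lambda>c. ?\<Psi> (monomial (Suc K) (box_exp a (Suc m) c))"
  \<comment> \<open>The new exponent e ranges up to \<open>box_exp a m c (Suc m)\<close>, which is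
    at least a (m+1). Splitting at a (m+1) separates the terms that prolong the box from those
    removed by \<open>interlacing_cancel\<close>.\<close>
  have dd: "?\<Psi> (dd 0 (Suc m) (monomial (Suc K) (box_exp a m c))) =
     (\<Sum>e\<in>{a (Suc (Suc m))..<a (Suc m)}. ?F (c(Suc m := e))) +
     (\<Sum>e\<in>{a (Suc m)..<box_exp a m c (Suc m)}. ?F (c(Suc m := e)))" if c: "c \<in> box a m" for c
  proof -
    let ?e = "box_exp a m c"
    have e2: "?e (Suc (Suc m)) = a (Suc (Suc m))" by (simp add: box_exp_def)
    have lt: "a (Suc (Suc m)) < a (Suc m)" using a Suc.prems unfolding strict_decr_def by auto
    note ge = box_exp_Suc_ge[OF c]
    have "dd 0 (Suc m) (monomial (Suc K) ?e) =
      (\<Sum>e\<in>{a (Suc (Suc m))..<?e (Suc m)}. monomial (Suc K) (?e(Suc m := e, Suc (Suc m) := ?e (Suc m) + a (Suc (Suc m)) - 1 - e)))"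
      unfolding e2[symmetric] by (rule dd_0_monomial) (use Suc.prems lt ge in \<open>auto simp: e2\<close>)
    also have "\<dots> = (\<Sum>e\<in>{a (Suc (Suc m))..<?e (Suc m)}. monomial (Suc K) (box_exp a (Suc m) (c(Suc m := e))))"
    proof (intro sum.cong refl monomial_cong)
      fix e i assume "e \<in> {a (Suc (Suc m))..<?e (Suc m)}"
      then show "(?e(Suc m := e, Suc (Suc m) := ?e (Suc m) + a (Suc (Suc m)) - 1 - e)) i = box_exp a (Suc m) (c(Suc m := e)) i"
        using box_sum_le[OF c] sum_upd_Suc[of c m e] by (auto simp: box_exp_def)
    qed
    finally have "?\<Psi> (dd 0 (Suc m) (monomial (Suc K) ?e)) = (\<Sum>e\<in>{a (Suc (Suc m))..<?e (Suc m)}. ?F (c(Suc m := e)))"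
      by (simp only: add')
    also have "{a (Suc (Suc m))..<?e (Suc m)} = {a (Suc (Suc m))..<a (Suc m)} \<union> {a (Suc m)..<?e (Suc m)}"
      using lt ge by auto
    also have "(\<Sum>e\<in>\<dots>. ?F (c(Suc m := e))) = (\<Sum>e\<in>{a (Suc (Suc m))..<a (Suc m)}. ?F (c(Suc m := e))) +
     (\<Sum>e\<in>{a (Suc m)..<?e (Suc m)}. ?F (c(Suc m := e)))"
      by (rule sum.union_disjoint) auto
    finally show ?thesis .
  qed
  have "dd_longest 0 (Suc K) (monomial (Suc K) a) = ?\<Psi> (dd 0 (Suc m) (\<Sum>c\<in>box a m. monomial (Suc K) (box_exp a m c)))"
    using Suc.IH[of "Suc d"] Suc.prems by simp
  also have "\<dots> = (\<Sum>c\<in>box a m. ?\<Psi> (dd 0 (Suc m) (monomial (Suc K) (box_exp a m c))))"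
    by (simp only: dd_sum add)
  also have "\<dots> = (\<Sum>c\<in>box a m. \<Sum>e\<in>{a (Suc (Suc m))..<a (Suc m)}. ?F (c(Suc m := e)))"
    using interlacing_cancel[OF a, of m K d] Suc.prems by (simp add: dd sum.distrib)
  also have "\<dots> = (\<Sum>c\<in>box a (Suc m). ?F c)"
    by (simp only: sum_box_Suc)
  also have "\<dots> = ?\<Psi> (\<Sum>c\<in>box a (Suc m). monomial (Suc K) (box_exp a (Suc m) c))"
    by (simp only: add)
  finally show ?case .
qed

text \<open>The branching rule of Schur polynomials: deleting the entries K + 1 of a tableau leaves
  an interlacing shape, and the deleted boxes give the power of the last variable.\<close>

lemma dd_longest_0_monomial:
  assumes a: "strict_decr (Suc K) a"
  shows "dd_longest 0 (Suc K) (monomial (Suc K) a) = (\<Sum>c\<in>box a K.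
    var (Suc K) ^ ((\<Sum>l\<in>{1..Suc K}. a l) - K - (\<Sum>l\<in>{1..K}. c l)) * dd_longest 0 K (monomial K c))"
proof -
  have "monomial (Suc K) (box_exp a K c) =
     var (Suc K) ^ ((\<Sum>l\<in>{1..Suc K}. a l) - K - (\<Sum>l\<in>{1..K}. c l)) * monomial K c" for c
  proof -
    have "(\<Prod>i\<in>{1..K}. var i ^ box_exp a K c i) = monomial K c"
      unfolding monomial_def by (intro prod.cong) (auto simp: box_exp_def)
    then show ?thesis by (simp add: monomial_def box_exp_def)
  qed
  moreover have "dd_longest 0 K (var (Suc K) ^ p * f) = var (Suc K) ^ p * dd_longest 0 K f" for p f
    by (rule dd_longest_mult_left) (auto simp: swap_poly_simps)
  ultimately show ?thesis
    using dd_longest_0_monomial_aux[OF a, of K 0] by (simp add: dd_longest_sum)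
qed

section \<open>Supports of Schur polynomials\<close>

text \<open>Entries are filled up to u from the left, so at most one entry r is intermediate. The
  threshold matters later: before r, prefix sums are those of u, and beyond r the tail is that of
  l.\<close>

lemma greedy_fill:
  fixes l u :: "nat \<Rightarrow> nat"
  assumes "\<And>i. 1 \<le> i \<Longrightarrow> i \<le> k \<Longrightarrow> l i \<le> u i" "(\<Sum>i\<in>{1..k}. l i) \<le> d" "d \<le> (\<Sum>i\<in>{1..k}. u i)"
  shows "\<exists>v r. r \<le> k \<and> (\<forall>i\<in>{1..k}. l i \<le> v i \<and> v i \<le> u i) \<and> (\<Sum>i\<in>{1..k}. v i) = d \<and>
    (\<forall>i. 1 \<le> i \<and> i < r \<longrightarrow> v i = u i) \<and> (\<forall>i. r < i \<and> i \<le> k \<longrightarrow> v i = l i)"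
  using assms
proof (induction k arbitrary: d)
  case (Suc k)
  show ?case
  proof (cases "d \<le> (\<Sum>i\<in>{1..k}. u i) + l (Suc k)")
    case True
    have "\<exists>v r. r \<le> k \<and> (\<forall>i\<in>{1..k}. l i \<le> v i \<and> v i \<le> u i) \<and> (\<Sum>i\<in>{1..k}. v i) = d - l (Suc k) \<and>
      (\<forall>i. 1 \<le> i \<and> i < r \<longrightarrow> v i = u i) \<and> (\<forall>i. r < i \<and> i \<le> k \<longrightarrow> v i = l i)"
      by (rule Suc.IH) (use Suc.prems True in auto)
    then obtain v r where v: "r \<le> k" "\<forall>i\<in>{1..k}. l i \<le> v i \<and> v i \<le> u i" "(\<Sum>i\<in>{1..k}. v i) = d - l (Suc k)"
      "\<forall>i. 1 \<le> i \<and> i < r \<longrightarrow> v i = u i" "\<forall>i. r < i \<and> i \<le> k \<longrightarrow> v i = l i" by blast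
    let ?v = "v(Suc k := l (Suc k))"
    have "l (Suc k) \<le> d" using Suc.prems(2) by simp
    then have "(\<Sum>i\<in>{1..Suc k}. ?v i) = d" using v(3) sum_upd_Suc[of v k "l (Suc k)"] by simp
    moreover have "\<forall>i\<in>{1..Suc k}. l i \<le> ?v i \<and> ?v i \<le> u i" using v(2) Suc.prems(1)[of "Suc k"] by auto
    ultimately show ?thesis using v(1,4,5) by (intro exI[of _ ?v] exI[of _ r]) auto
  next
    case False
    let ?v = "u(Suc k := d - (\<Sum>i\<in>{1..k}. u i))"
    have "(\<Sum>i\<in>{1..Suc k}. ?v i) = d" using False sum_upd_Suc[of u k] by simp
    moreover have "\<forall>i\<in>{1..Suc k}. l i \<le> ?v i \<and> ?v i \<le> u i" using False Suc.prems by auto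
    ultimately show ?thesis by (intro exI[of _ ?v] exI[of _ "Suc k"]) auto
  qed
qed simp

text \<open>Rado's inequalities for the convex hull of the rearrangements of mu; sums over all
  subsets replace sorting alpha.\<close>

definition dominated :: "nat \<Rightarrow> (nat \<Rightarrow> nat) \<Rightarrow> (nat \<Rightarrow> nat) \<Rightarrow> bool" where
  "dominated k \<mu> \<alpha> \<longleftrightarrow> (\<forall>i. i \<notin> {1..k} \<longrightarrow> \<alpha> i = 0) \<and> (\<Sum>i\<in>{1..k}. \<alpha> i) = (\<Sum>i\<in>{1..k}. \<mu> i) \<and>
    (\<forall>I\<subseteq>{1..k}. (\<Sum>i\<in>I. \<alpha> i) \<le> (\<Sum>i\<in>{1..card I}. \<mu> i))"

lemma dominated_cong:
  assumes "\<And>i. 1 \<le> i \<Longrightarrow> i \<le> k \<Longrightarrow> \<mu> i = \<nu> i"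
  shows "dominated k \<mu> \<alpha> = dominated k \<nu> \<alpha>"
proof -
  have eq: "(\<Sum>i\<in>{1..j}. \<mu> i) = (\<Sum>i\<in>{1..j}. \<nu> i)" if "j \<le> k" for j
    using that assms by (intro sum.cong) auto
  have "card I \<le> k" if "I \<subseteq> {1..k}" for I :: "nat set"
    using card_mono[OF _ that] by simp
  then show ?thesis using eq unfolding dominated_def by (metis order_refl)
qed

lemma sum_fun_upd_notin: "x \<notin> I \<Longrightarrow> (\<Sum>i\<in>I. (f(x := y)) i) = (\<Sum>i\<in>I. f i)"
  by (intro sum.cong) auto

text \<open>Branching on the level of dominance. Given alpha, nu is the greedy filling between the
  shifted and the unshifted mu: sets with fewer than r elements inherit their bound directly, larger
  ones after the last index has been added to them.\<close>

lemma dominated_Suc: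
  assumes "\<And>i. 1 \<le> i \<Longrightarrow> i \<le> K \<Longrightarrow> \<mu> (Suc i) \<le> \<mu> i"
  shows "dominated (Suc K) \<mu> \<alpha> \<longleftrightarrow> (\<exists>\<nu>. (\<forall>i\<in>{1..K}. \<mu> (Suc i) \<le> \<nu> i \<and> \<nu> i \<le> \<mu> i) \<and>
    (\<Sum>i\<in>{1..K}. \<nu> i) + \<alpha> (Suc K) = (\<Sum>i\<in>{1..Suc K}. \<mu> i) \<and> dominated K \<nu> (\<alpha>(Suc K := 0)))"
    (is "_ \<longleftrightarrow> (\<exists>\<nu>. ?P \<nu>)")
proof
  let ?t = "\<alpha> (Suc K)"
  assume dom: "dominated (Suc K) \<mu> \<alpha>"
  then have dom_sum: "(\<Sum>i\<in>{1..K}. \<alpha> i) + ?t = (\<Sum>i\<in>{1..Suc K}. \<mu> i)"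
    and dom_le: "\<And>I. I \<subseteq> {1..Suc K} \<Longrightarrow> (\<Sum>i\<in>I. \<alpha> i) \<le> (\<Sum>i\<in>{1..card I}. \<mu> i)"
    by (auto simp: dominated_def)
  have "?t \<le> \<mu> 1" using dom_le[of "{Suc K}"] by simp
  moreover have "(\<Sum>i\<in>{1..Suc K}. \<mu> i) = \<mu> 1 + (\<Sum>i\<in>{1..K}. \<mu> (Suc i))"
    by (simp add: sum.atLeast_Suc_atMost sum.shift_bounds_cl_Suc_ivl del: sum.cl_ivl_Suc)
  moreover have "(\<Sum>i\<in>{1..K}. \<alpha> i) \<le> (\<Sum>i\<in>{1..K}. \<mu> i)" using dom_le[of "{1..K}"] by simp
  ultimately have "(\<Sum>i\<in>{1..K}. \<mu> (Suc i)) \<le> (\<Sum>i\<in>{1..Suc K}. \<mu> i) - ?t"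
    "(\<Sum>i\<in>{1..Suc K}. \<mu> i) - ?t \<le> (\<Sum>i\<in>{1..K}. \<mu> i)"
    using dom_sum by linarith+
  then obtain \<nu> r where r: "r \<le> K" and \<nu>: "\<forall>i\<in>{1..K}. \<mu> (Suc i) \<le> \<nu> i \<and> \<nu> i \<le> \<mu> i"
      "(\<Sum>i\<in>{1..K}. \<nu> i) = (\<Sum>i\<in>{1..Suc K}. \<mu> i) - ?t"
      "\<forall>i. 1 \<le> i \<and> i < r \<longrightarrow> \<nu> i = \<mu> i" "\<forall>i. r < i \<and> i \<le> K \<longrightarrow> \<nu> i = \<mu> (Suc i)"
    using greedy_fill[where l = "\<lambda>i. \<mu> (Suc i)" and u = \<mu> and k = K, OF assms] by blast
  have \<nu>_sum: "(\<Sum>i\<in>{1..K}. \<nu> i) + ?t = (\<Sum>i\<in>{1..Suc K}. \<mu> i)" using \<nu>(2) dom_sum by linarith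
  \<comment> \<open>Beyond r the entries of nu are those of mu shifted by one, so the equality of
    totals descends to all prefixes of length at least r.\<close>
  have high: "(\<Sum>i\<in>{1..j}. \<nu> i) + ?t = (\<Sum>i\<in>{1..Suc j}. \<mu> i)" if "r \<le> j" "j \<le> K" for j
    using \<open>j \<le> K\<close> \<open>r \<le> j\<close>
  proof (induction j rule: inc_induct)
    case base
    show ?case by (rule \<nu>_sum)
  next
    case (step j)
    then show ?case using \<nu>(4) by auto
  qed
  have "dominated K \<nu> (\<alpha>(Suc K := 0))"
    unfolding dominated_def
  proof (intro conjI allI impI)
    show "(\<Sum>i\<in>{1..K}. (\<alpha>(Suc K := 0)) i) = (\<Sum>i\<in>{1..K}. \<nu> i)"
      using \<nu>_sum dom_sum by (simp add: sum_upd_Suc)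
    show "(\<alpha>(Suc K := 0)) i = 0" if "i \<notin> {1..K}" for i using that dom by (auto simp: dominated_def)
    fix I :: "nat set" assume I: "I \<subseteq> {1..K}"
    then have fin: "finite I" and card: "card I \<le> K" and notin: "Suc K \<notin> I"
      using finite_subset card_mono[OF _ I] by auto
    have eq: "(\<Sum>i\<in>I. (\<alpha>(Suc K := 0)) i) = (\<Sum>i\<in>I. \<alpha> i)" using notin by (rule sum_fun_upd_notin)
    show "(\<Sum>i\<in>I. (\<alpha>(Suc K := 0)) i) \<le> (\<Sum>i\<in>{1..card I}. \<nu> i)"
    proof (cases "card I < r")
      case True
      have "(\<Sum>i\<in>I. \<alpha> i) \<le> (\<Sum>i\<in>{1..card I}. \<mu> i)" using I by (intro dom_le) auto
      also have "\<dots> = (\<Sum>i\<in>{1..card I}. \<nu> i)" using \<nu>(3) True by (intro sum.cong) auto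
      finally show ?thesis using eq by simp
    next
      case False
      have "(\<Sum>i\<in>insert (Suc K) I. \<alpha> i) \<le> (\<Sum>i\<in>{1..card (insert (Suc K) I)}. \<mu> i)"
        using I by (intro dom_le) auto
      also have "\<dots> = (\<Sum>i\<in>{1..card I}. \<nu> i) + ?t"
        using high[of "card I"] False card fin notin by simp
      finally show ?thesis using eq fin notin by simp
    qed
  qed
  then show "\<exists>\<nu>. ?P \<nu>" using \<nu>(1) \<nu>_sum by blast
next
  let ?t = "\<alpha> (Suc K)"
  assume "\<exists>\<nu>. ?P \<nu>"
  then obtain \<nu> where \<nu>: "\<forall>i\<in>{1..K}. \<mu> (Suc i) \<le> \<nu> i \<and> \<nu> i \<le> \<mu> i"
    and \<nu>_sum: "(\<Sum>i\<in>{1..K}. \<nu> i) + ?t = (\<Sum>i\<in>{1..Suc K}. \<mu> i)"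
    and dom: "dominated K \<nu> (\<alpha>(Suc K := 0))" by blast
  have \<alpha>_sum: "(\<Sum>i\<in>{1..K}. \<alpha> i) = (\<Sum>i\<in>{1..K}. \<nu> i)"
    using dom by (auto simp: dominated_def sum_upd_Suc)
  have high: "(\<Sum>i\<in>{1..j}. \<nu> i) + ?t \<le> (\<Sum>i\<in>{1..Suc j}. \<mu> i)" if "j \<le> K" for j
    using that
  proof (induction j rule: inc_induct)
    case base
    show ?case using \<nu>_sum by simp
  next
    case (step j)
    moreover have "\<mu> (Suc (Suc j)) \<le> \<nu> (Suc j)" using \<nu> step by auto
    ultimately show ?case by simp
  qed
  show "dominated (Suc K) \<mu> \<alpha>"
    unfolding dominated_def
  proof (intro conjI allI impI)
    show "\<alpha> i = 0" if "i \<notin> {1..Suc K}" for i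
      using dom that unfolding dominated_def by (metis Suc_n_not_le_n atLeastAtMost_iff fun_upd_other le_SucI order_refl
        le_add1 plus_1_eq_Suc)
    show "(\<Sum>i\<in>{1..Suc K}. \<alpha> i) = (\<Sum>i\<in>{1..Suc K}. \<mu> i)"
      using \<alpha>_sum \<nu>_sum by simp
    fix I :: "nat set" assume I: "I \<subseteq> {1..Suc K}"
    let ?I = "I - {Suc K}"
    have I': "?I \<subseteq> {1..K}" using I by (auto simp: le_Suc_eq)
    have "(\<Sum>i\<in>?I. \<alpha> i) = (\<Sum>i\<in>?I. (\<alpha>(Suc K := 0)) i)" by (rule sum_fun_upd_notin[symmetric]) simp
    also have "\<dots> \<le> (\<Sum>i\<in>{1..card ?I}. \<nu> i)" using dom I' unfolding dominated_def by blast
    finally have le: "(\<Sum>i\<in>?I. \<alpha> i) \<le> (\<Sum>i\<in>{1..card ?I}. \<nu> i)" .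
    have card: "card ?I \<le> K" using card_mono[OF _ I'] by simp
    have fin: "finite I" using I finite_subset by blast
    show "(\<Sum>i\<in>I. \<alpha> i) \<le> (\<Sum>i\<in>{1..card I}. \<mu> i)"
    proof (cases "Suc K \<in> I")
      case True
      have "card I = Suc (card ?I)" using fin True by (rule card.remove)
      moreover have "(\<Sum>i\<in>I. \<alpha> i) = ?t + (\<Sum>i\<in>?I. \<alpha> i)" using fin True by (rule sum.remove)
      ultimately show ?thesis using high[OF card] le by simp
    next
      case False
      have "(\<Sum>i\<in>{1..card ?I}. \<nu> i) \<le> (\<Sum>i\<in>{1..card ?I}. \<mu> i)" using \<nu> card by (intro sum_mono) auto
      then show ?thesis using False le by simp
    qed
  qed
qed

lemma lookup_single_mult:
  fixes f :: mpoly
  shows "Poly_Mapping.lookup (Poly_Mapping.single e 1 * f) (e + e') = Poly_Mapping.lookup f e'"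
proof (rule frag_induction[of f UNIV])
  fix x show "Poly_Mapping.lookup (Poly_Mapping.single e 1 * frag_of x) (e + e') = Poly_Mapping.lookup (frag_of x) e'"
    by (auto simp: mult_single lookup_single when_def)
qed (auto simp: right_diff_distrib lookup_minus)

lemma lookup_var_power_mult:
  assumes "\<And>e'. Poly_Mapping.lookup f e' \<noteq> 0 \<Longrightarrow> Poly_Mapping.lookup e' j = 0"
  shows "Poly_Mapping.lookup (var j ^ p * f) e =
    (if Poly_Mapping.lookup e j = p then Poly_Mapping.lookup f (Poly_Mapping.update j 0 e) else 0)"
proof (cases "Poly_Mapping.lookup e j = p")
  case True
  have "e = Poly_Mapping.single j p + Poly_Mapping.update j 0 e"
    by (rule poly_mapping_eqI) (auto simp: lookup_add lookup_single lookup_update when_def True)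
  then show ?thesis using lookup_single_mult[of "Poly_Mapping.single j p" f] True by (metis var_power)
next
  case False
  have "e \<notin> Poly_Mapping.keys (Poly_Mapping.single (Poly_Mapping.single j p) 1 * f)"
  proof
    assume "e \<in> Poly_Mapping.keys (Poly_Mapping.single (Poly_Mapping.single j p) 1 * f)"
    then obtain e' where "e = Poly_Mapping.single j p + e'" "e' \<in> Poly_Mapping.keys f"
      using keys_mult[of "Poly_Mapping.single (Poly_Mapping.single j p) 1" f] by auto
    then show False using False assms[of e'] by (auto simp: lookup_add in_keys_iff)
  qed
  then show ?thesis using False by (simp add: in_keys_iff var_power)
qed

definition parts :: "nat \<Rightarrow> (nat \<Rightarrow> nat) \<Rightarrow> nat \<Rightarrow> nat" where
  "parts k a i = a i - (k - i)"

lemma strict_decr_ge: "strict_decr k a \<Longrightarrow> 1 \<le> i \<Longrightarrow> i \<le> k \<Longrightarrow> k - i \<le> a i"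
  using strict_decr_le[of k a i k] by simp

lemma parts_add: "strict_decr k a \<Longrightarrow> 1 \<le> i \<Longrightarrow> i \<le> k \<Longrightarrow> parts k a i + (k - i) = a i"
  unfolding parts_def using strict_decr_ge[of k a i] by linarith

lemma parts_decr: "strict_decr k a \<Longrightarrow> 1 \<le> i \<Longrightarrow> i < k \<Longrightarrow> parts k a (Suc i) \<le> parts k a i"
  using strict_decr_le[of k a i "Suc i"] unfolding parts_def by auto

lemma sum_parts:
  assumes "strict_decr k a"
  shows "(\<Sum>i\<in>{1..k}. parts k a i) + (\<Sum>i\<in>{1..k}. k - i) = (\<Sum>i\<in>{1..k}. a i)"
  unfolding sum.distrib[symmetric] by (intro sum.cong refl parts_add[OF assms]) auto

lemma box_strict_decr: "c \<in> box a m \<Longrightarrow> strict_decr m c"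
  unfolding strict_decr_def box_def
proof (intro allI impI)
  fix i assume c: "c \<in> Pi\<^sub>E {1..m} (\<lambda>i. {a (Suc i)..<a i})" and i: "1 \<le> i \<and> i < m"
  have "c i \<in> {a (Suc i)..<a i}" "c (Suc i) \<in> {a (Suc (Suc i))..<a (Suc i)}"
    by (rule PiE_mem[OF c]; use i in simp)+
  then show "c (Suc i) < c i" by simp
qed

text \<open>Both claims need one induction: nonnegativity of the summands in the branching rule
  makes the support of the sum the union of their supports.\<close>

lemma lookup_schur:
  assumes "strict_decr k a"
  shows "Poly_Mapping.lookup (dd_longest 0 k (monomial k a)) e \<ge> 0 \<and>
    (Poly_Mapping.lookup (dd_longest 0 k (monomial k a)) e \<noteq> 0 \<longleftrightarrow> dominated k (parts k a) (Poly_Mapping.lookup e))"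
  using assms
proof (induction k arbitrary: a e)
  case 0
  have "e = 0 \<longleftrightarrow> (\<forall>i. Poly_Mapping.lookup e i = 0)" by (auto simp: poly_mapping_eq_iff fun_eq_iff)
  then show ?case by (auto simp: monomial_def lookup_one when_def dominated_def)
next
  case (Suc K)
  let ?e = "Poly_Mapping.update (Suc K) 0 e"
  let ?p = "\<lambda>c. (\<Sum>l\<in>{1..Suc K}. a l) - K - (\<Sum>l\<in>{1..K}. c l)"
  let ?f = "\<lambda>c. dd_longest 0 K (monomial K c)"
  let ?g = "\<lambda>c. Poly_Mapping.lookup (var (Suc K) ^ ?p c * ?f c) e"
  have e: "Poly_Mapping.lookup ?e = (Poly_Mapping.lookup e)(Suc K := 0)"
    by (auto simp: lookup_update)
  have g: "?g c = (if Poly_Mapping.lookup e (Suc K) = ?p c then Poly_Mapping.lookup (?f c) ?e else 0)"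
    if "c \<in> box a K" for c
    by (rule lookup_var_power_mult) (use Suc.IH[OF box_strict_decr[OF that]] in \<open>auto simp: dominated_def\<close>)
  have nonneg: "?g c \<ge> 0" if "c \<in> box a K" for c
    using g[OF that] Suc.IH[OF box_strict_decr[OF that]] by auto
  have sum: "Poly_Mapping.lookup (dd_longest 0 (Suc K) (monomial (Suc K) a)) e = (\<Sum>c\<in>box a K. ?g c)"
    unfolding dd_longest_0_monomial[OF Suc.prems] by (simp add: lookup_sum)
  \<comment> \<open>The staircase for K + 1 exceeds the one for K by K in total, the degree lost
    under the K letters of the top cycle.\<close>
  have stair: "(\<Sum>i\<in>{1..Suc K}. Suc K - i) = (\<Sum>i\<in>{1..K}. K - i) + K"
  proof -
    have "(\<Sum>i\<in>{1..K}. Suc K - i) = (\<Sum>i\<in>{1..K}. (K - i) + 1)" by (intro sum.cong) auto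
    then show ?thesis by (simp add: sum_Suc)
  qed
  have p_eq: "?p c = q \<longleftrightarrow> (\<Sum>i\<in>{1..K}. parts K c i) + q = (\<Sum>i\<in>{1..Suc K}. parts (Suc K) a i)"
    if c: "c \<in> box a K" for c q
  proof -
    have "(\<Sum>i\<in>{1..K}. c i) + K \<le> (\<Sum>i\<in>{1..Suc K}. a i)" using box_sum_le[OF c] by simp
    then show ?thesis using sum_parts[OF Suc.prems] sum_parts[OF box_strict_decr[OF c]] stair by linarith
  qed
  have decr: "parts (Suc K) a (Suc i) \<le> parts (Suc K) a i" if "1 \<le> i" "i \<le> K" for i
    using parts_decr[OF Suc.prems] that by simp
  have dom_Suc: "dominated (Suc K) (parts (Suc K) a) \<alpha> \<longleftrightarrow>
    (\<exists>\<nu>. (\<forall>i\<in>{1..K}. parts (Suc K) a (Suc i) \<le> \<nu> i \<and> \<nu> i \<le> parts (Suc K) a i) \<and>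
      (\<Sum>i\<in>{1..K}. \<nu> i) + \<alpha> (Suc K) = (\<Sum>i\<in>{1..Suc K}. parts (Suc K) a i) \<and>
      dominated K \<nu> (\<alpha>(Suc K := 0)))" for \<alpha>
    by (rule dominated_Suc) (rule decr)
  have "(\<Sum>c\<in>box a K. ?g c) \<noteq> 0 \<longleftrightarrow> (\<exists>c\<in>box a K. ?g c \<noteq> 0)"
    using sum_nonneg_eq_0_iff[of "box a K" ?g] nonneg by auto
  also have "\<dots> \<longleftrightarrow> (\<exists>c\<in>box a K. ?p c = Poly_Mapping.lookup e (Suc K) \<and>
     dominated K (parts K c) (Poly_Mapping.lookup ?e))"
  proof (rule bex_cong[OF refl])
    fix c assume c: "c \<in> box a K"
    show "?g c \<noteq> 0 \<longleftrightarrow> ?p c = Poly_Mapping.lookup e (Suc K) \<and> dominated K (parts K c) (Poly_Mapping.lookup ?e)"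
      unfolding g[OF c] using Suc.IH[OF box_strict_decr[OF c], of ?e] by metis
  qed
  also have "(\<exists>c\<in>box a K. ?p c = Poly_Mapping.lookup e (Suc K) \<and> dominated K (parts K c) (Poly_Mapping.lookup ?e))
    \<longleftrightarrow> dominated (Suc K) (parts (Suc K) a) (Poly_Mapping.lookup e)"
    unfolding dom_Suc e
  proof
    assume "\<exists>c\<in>box a K. ?p c = Poly_Mapping.lookup e (Suc K) \<and> dominated K (parts K c) ((Poly_Mapping.lookup e)(Suc K := 0))"
    then obtain c where c: "c \<in> box a K" "?p c = Poly_Mapping.lookup e (Suc K)"
       "dominated K (parts K c) ((Poly_Mapping.lookup e)(Suc K := 0))" by blast
    have "parts (Suc K) a (Suc i) \<le> parts K c i \<and> parts K c i \<le> parts (Suc K) a i" if "i \<in> {1..K}" for i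
    proof -
      have "c i \<in> {a (Suc i)..<a i}" using c(1) that unfolding box_def by blast
      then show ?thesis using that unfolding parts_def atLeastLessThan_iff atLeastAtMost_iff by linarith
    qed
    then show "\<exists>\<nu>. (\<forall>i\<in>{1..K}. parts (Suc K) a (Suc i) \<le> \<nu> i \<and> \<nu> i \<le> parts (Suc K) a i) \<and>
      (\<Sum>i\<in>{1..K}. \<nu> i) + Poly_Mapping.lookup e (Suc K) = (\<Sum>i\<in>{1..Suc K}. parts (Suc K) a i) \<and>
      dominated K \<nu> ((Poly_Mapping.lookup e)(Suc K := 0))"
      using c p_eq[OF c(1)] by blast
  next
    assume "\<exists>\<nu>. (\<forall>i\<in>{1..K}. parts (Suc K) a (Suc i) \<le> \<nu> i \<and> \<nu> i \<le> parts (Suc K) a i) \<and>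
      (\<Sum>i\<in>{1..K}. \<nu> i) + Poly_Mapping.lookup e (Suc K) = (\<Sum>i\<in>{1..Suc K}. parts (Suc K) a i) \<and>
      dominated K \<nu> ((Poly_Mapping.lookup e)(Suc K := 0))"
    then obtain \<nu> where \<nu>: "\<forall>i\<in>{1..K}. parts (Suc K) a (Suc i) \<le> \<nu> i \<and> \<nu> i \<le> parts (Suc K) a i"
      "(\<Sum>i\<in>{1..K}. \<nu> i) + Poly_Mapping.lookup e (Suc K) = (\<Sum>i\<in>{1..Suc K}. parts (Suc K) a i)"
      "dominated K \<nu> ((Poly_Mapping.lookup e)(Suc K := 0))" by blast
    define c where "c = restrict (\<lambda>i. \<nu> i + (K - i)) {1..K}"
    have "a (Suc i) \<le> \<nu> i + (K - i) \<and> \<nu> i + (K - i) < a i" if i: "i \<in> {1..K}" for i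
    proof -
      have "parts (Suc K) a (Suc i) \<le> \<nu> i \<and> \<nu> i \<le> parts (Suc K) a i" using \<nu>(1) i by blast
      then show ?thesis
        using i parts_add[OF Suc.prems, of i] parts_add[OF Suc.prems, of "Suc i"] by auto
    qed
    then have c: "c \<in> box a K" unfolding c_def box_def by auto
    have pc: "parts K c i = \<nu> i" if "1 \<le> i" "i \<le> K" for i using that by (simp add: parts_def c_def)
    then have "(\<Sum>i\<in>{1..K}. parts K c i) = (\<Sum>i\<in>{1..K}. \<nu> i)" by (intro sum.cong) auto
    moreover have "dominated K (parts K c) ((Poly_Mapping.lookup e)(Suc K := 0))"
      using \<nu>(3) dominated_cong[of K "parts K c" \<nu>] pc by blast
    ultimately show "\<exists>c\<in>box a K. ?p c = Poly_Mapping.lookup e (Suc K) \<and> dominated K (parts K c) ((Poly_Mapping.lookup e)(Suc K := 0))"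
      using c p_eq[OF c] \<nu>(2) by (intro bexI[of _ c]) auto
  qed
  finally show ?case using sum nonneg by (auto intro!: sum_nonneg)
qed

section \<open>Schur expansion of Grassmannian Grothendieck polynomials\<close>

text \<open>Interpolates between 1 for i = 1 and \<open>weight k\<close> for i = k, so that the
  weight can be multiplied out in rounds: passing from i to i + 1 brings in one factor 1 - x_l for
  each l > i.\<close>

definition partial_weight :: "nat \<Rightarrow> nat \<Rightarrow> mpoly" where
  "partial_weight k i = (\<Prod>l\<in>{1..k}. (1 - var l) ^ (min i l - 1))"

lemma partial_weight_1: "partial_weight k (Suc 0) = 1"
  unfolding partial_weight_def by (intro prod.neutral) auto

lemma partial_weight_top: "partial_weight k k = weight k"
  unfolding partial_weight_def weight_def by (intro prod.cong) auto

lemma partial_weight_Suc: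
  assumes "1 \<le> i"
  shows "partial_weight k (Suc i) = partial_weight k i * (\<Prod>l\<in>{Suc i..k}. (1 - var l))"
proof -
  have "(\<Prod>l\<in>{Suc i..k}. (1 - var l)) = (\<Prod>l\<in>{1..k}. if Suc i \<le> l then 1 - var l else 1)"
    by (rule prod.mono_neutral_cong_left) auto
  then have "partial_weight k i * (\<Prod>l\<in>{Suc i..k}. (1 - var l)) =
    (\<Prod>l\<in>{1..k}. (1 - var l) ^ (min i l - 1) * (if Suc i \<le> l then 1 - var l else 1))"
    by (simp only: partial_weight_def prod.distrib)
  also have "\<dots> = partial_weight k (Suc i)"
    unfolding partial_weight_def
  proof (intro prod.cong refl)
    fix l assume "l \<in> {1..k}"
    obtain p where p: "i = Suc p" using assms by (cases i) auto
    show "(1 - var l) ^ (min i l - 1) * (if Suc i \<le> l then 1 - var l else 1) = (1 - var l) ^ (min (Suc i) l - 1)"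
    proof (cases "Suc i \<le> l")
      case True
      then have "min i l - 1 = p" "min (Suc i) l - 1 = Suc p" by (auto simp: p)
      then show ?thesis using True by (simp add: mult.commute)
    next
      case False
      then have "min i l = min (Suc i) l" by auto
      then show ?thesis using False by simp
    qed
  qed
  finally show ?thesis by simp
qed

lemma swap_poly_partial_weight:
  assumes "1 \<le> j" "j < k" "i \<le> j"
  shows "swap_poly j (partial_weight k i) = partial_weight k i"
proof -
  have "(\<Prod>l\<in>{1..k}. (1 - var (swapidx j l)) ^ (min i l - 1)) = partial_weight k i"
    unfolding partial_weight_def
    by (rule prod.reindex_bij_witness[of _ "swapidx j" "swapidx j"])
      (use assms in \<open>auto simp: swapidx_def min_def split: if_splits\<close>)
  then show ?thesis by (simp add: partial_weight_def swap_poly_simps)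
qed

definition add_set :: "(nat \<Rightarrow> nat) \<Rightarrow> nat set \<Rightarrow> nat \<Rightarrow> nat" where
  "add_set a S i = a i + of_bool (i \<in> S)"

lemma prod_one_minus_var_mult_monomial:
  assumes "1 \<le> i"
  shows "(\<Prod>l\<in>{i..k}. (1 - var l)) * monomial k a = (\<Sum>S\<in>Pow {i..k}. (- 1) ^ card S * monomial k (add_set a S))"
proof -
  have "(\<Prod>l\<in>{i..k}. (- var l) + 1) = (\<Sum>S\<in>Pow {i..k}. (\<Prod>l\<in>S. - var l) * (\<Prod>l\<in>{i..k} - S. 1))"
    by (rule prod_add) simp
  moreover have "(\<Prod>l\<in>S. - var l) * monomial k a = (- 1) ^ card S * monomial k (add_set a S)" if "S \<in> Pow {i..k}" for S
  proof -
    have "S \<subseteq> {1..k}" using that assms by auto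
    then have "(\<Prod>l\<in>S. var l) = (\<Prod>l\<in>{1..k}. var l ^ of_bool (l \<in> S))"
      by (intro prod.mono_neutral_cong_left) auto
    then have "(\<Prod>l\<in>S. var l) * monomial k a = monomial k (add_set a S)"
      by (simp add: monomial_def add_set_def power_add prod.distrib mult.commute)
    moreover have "(\<Prod>l\<in>S. - var l) = (- 1) ^ card S * (\<Prod>l\<in>S. var l)"
      by (induction S rule: infinite_finite_induct) auto
    ultimately show ?thesis by (simp add: mult.assoc)
  qed
  ultimately show ?thesis by (simp add: sum_distrib_right)
qed

definition lenart :: "nat \<Rightarrow> nat \<Rightarrow> (nat \<Rightarrow> nat) \<Rightarrow> mpoly" where
  "lenart k i a = dd_longest 0 k (partial_weight k i * monomial k a)"

text \<open>Adding at most one to strictly decreasing entries can only produce a tie at some j and j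
  + 1 with j + 1 in S. Then i \<le> j, so the partial weight is symmetric under s_j like the
  monomial, and the plain operator vanishes.\<close>

lemma lenart_not_strict:
  assumes "strict_decr k a" "S \<subseteq> {Suc i..k}" "\<not> strict_decr k (add_set a S)"
  shows "lenart k i (add_set a S) = 0"
proof -
  obtain j where j: "1 \<le> j" "j < k" "\<not> add_set a S (Suc j) < add_set a S j"
    using assms(3) unfolding strict_decr_def by blast
  have "a (Suc j) < a j" using assms(1) j unfolding strict_decr_def by blast
  then have S: "Suc j \<in> S" "add_set a S j = add_set a S (Suc j)"
    using j(3) by (auto simp: add_set_def of_bool_def split: if_splits)
  then have "i \<le> j" using assms(2) by auto
  have "add_set a S \<circ> swapidx j = add_set a S"
    using S(2) by (auto simp: swapidx_def fun_eq_iff)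
  then have "swap_poly j (monomial k (add_set a S)) = monomial k (add_set a S)"
    using j swap_poly_monomial by metis
  then show ?thesis unfolding lenart_def
    using j \<open>i \<le> j\<close> by (intro dd_longest_0_symmetric[of j]) (auto simp: swap_poly_mult swap_poly_partial_weight)
qed

text \<open>Sequences that stop being strictly decreasing contribute zero rather than terms of the opposite
  sign, so that no cancellation occurs.\<close>

lemma lenart_Suc:
  assumes "strict_decr k a" "1 \<le> i"
  shows "lenart k (Suc i) a = (\<Sum>S | S \<subseteq> {Suc i..k} \<and> strict_decr k (add_set a S). (- 1) ^ card S * lenart k i (add_set a S))"
proof -
  have minus_one: "dd_longest 0 k ((- 1) ^ p * f) = (- 1) ^ p * dd_longest 0 k f" for p f
    by (rule dd_longest_mult_left) (simp add: swap_poly_simps)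
  have "partial_weight k (Suc i) * monomial k a =
     (\<Sum>S\<in>Pow {Suc i..k}. (- 1) ^ card S * (partial_weight k i * monomial k (add_set a S)))"
    using prod_one_minus_var_mult_monomial[of "Suc i" k a]
    by (simp add: partial_weight_Suc[OF assms(2)] mult.assoc sum_distrib_left mult.left_commute)
  then have "lenart k (Suc i) a = (\<Sum>S\<in>Pow {Suc i..k}. (- 1) ^ card S * lenart k i (add_set a S))"
    by (simp add: lenart_def dd_longest_sum minus_one)
  also have "\<dots> = (\<Sum>S | S \<subseteq> {Suc i..k} \<and> strict_decr k (add_set a S). (- 1) ^ card S * lenart k i (add_set a S))"
    by (rule sum.mono_neutral_right) (auto simp: lenart_not_strict[OF assms(1)])
  finally show ?thesis .
qed

section \<open>The staircase monomial and the normalising factor\<close>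

lemma strict_decr_staircase: "strict_decr k (\<lambda>i. k - i)"
  by (auto simp: strict_decr_def)

lemma schur_staircase: "dd_longest 0 k (monomial k (\<lambda>i. k - i)) = 1"
proof (induction k)
  case 0
  then show ?case by (simp add: monomial_def)
next
  case (Suc K)
  define c0 where "c0 = restrict (\<lambda>i. K - i) {1..K}"
  have "box (\<lambda>i. Suc K - i) K = Pi\<^sub>E {1..K} (\<lambda>i. {K - i})"
    unfolding box_def by (intro PiE_cong) auto
  also have "\<dots> = Pi\<^sub>E {1..K} (\<lambda>i. {c0 i})"
    unfolding c0_def by (intro PiE_cong) auto
  also have "\<dots> = {c0}" by (rule PiE_singleton) (unfold c0_def, rule restrict_extensional)
  finally have box: "box (\<lambda>i. Suc K - i) K = {c0}" .
  have m: "monomial K c0 = monomial K (\<lambda>i. K - i)" by (intro monomial_cong) (simp add: c0_def)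
  have "(\<Sum>l\<in>{1..Suc K}. Suc K - l) - K - (\<Sum>l\<in>{1..K}. c0 l) = 0"
  proof -
    have "(\<Sum>i\<in>{1..K}. Suc K - i) = (\<Sum>i\<in>{1..K}. c0 i + 1)" unfolding c0_def by (intro sum.cong) auto
    then show ?thesis by (simp add: sum_Suc)
  qed
  then show ?case
    unfolding dd_longest_0_monomial[OF strict_decr_staircase] box using Suc by (simp add: m)
qed

text \<open>The staircase has minimal gaps and position 1 is never raised, so no other position can
  be: only the empty set contributes in each round.\<close>

lemma lenart_staircase: "1 \<le> i \<Longrightarrow> lenart k i (\<lambda>i. k - i) = 1"
proof (induction i rule: dec_induct)
  case base
  then show ?case by (simp add: lenart_def partial_weight_1 schur_staircase)
next
  case (step i)
  let ?\<delta> = "\<lambda>i. k - i"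
  have "S = {}" if S: "S \<subseteq> {Suc i..k}" "strict_decr k (add_set ?\<delta> S)" for S
  proof (rule ccontr)
    assume "S \<noteq> {}"
    then obtain l where "l \<in> S" by blast
    then have l: "l \<in> S" "Suc i \<le> l" "l \<le> k" using S(1) by auto
    have "add_set ?\<delta> S l + (l - 1) \<le> add_set ?\<delta> S 1"
      by (rule strict_decr_le[OF S(2)]) (use l in auto)
    moreover have "1 \<notin> S" using S(1) step(1) by auto
    ultimately show False using l by (simp add: add_set_def)
  qed
  moreover have "add_set ?\<delta> {} = ?\<delta>" by (simp add: add_set_def fun_eq_iff)
  ultimately have "{S. S \<subseteq> {Suc i..k} \<and> strict_decr k (add_set ?\<delta> S)} = {{}}"
    using strict_decr_staircase[of k] by auto
  then show ?case
    using lenart_Suc[OF strict_decr_staircase step(1), of k] step.IH \<open>add_set ?\<delta> {} = ?\<delta>\<close> by simp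
qed

lemma dd_longest_1_staircase: "dd_longest 1 k (monomial k (\<lambda>i. k - i)) = 1"
proof (induction k)
  case 0
  then show ?case by (simp add: monomial_def)
next
  case (Suc K)
  have "dd_cycle 1 m (monomial (Suc K) (\<lambda>i. Suc K - i)) = monomial (Suc K) (\<lambda>i. if i \<le> m then K - i else Suc K - i)"
    if "m \<le> K" for m
    using that
  proof (induction m)
    case 0
    then show ?case by (auto intro!: monomial_cong)
  next
    case (Suc m)
    let ?c = "\<lambda>i. if i \<le> m then K - i else Suc K - i"
    have "dd_cycle 1 (Suc m) (monomial (Suc K) (\<lambda>i. Suc K - i)) = dd 1 (Suc m) (monomial (Suc K) ?c)"
      using Suc by simp
    also have "\<dots> = monomial (Suc K) (?c(Suc m := ?c (Suc (Suc m))))"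
      by (rule dd_1_monomial) (use Suc.prems in auto)
    also have "\<dots> = monomial (Suc K) (\<lambda>i. if i \<le> Suc m then K - i else Suc K - i)"
      by (rule monomial_cong) auto
    finally show ?case .
  qed
  from this[of K] have "dd_cycle 1 K (monomial (Suc K) (\<lambda>i. Suc K - i)) =
      monomial (Suc K) (\<lambda>i. if i \<le> K then K - i else Suc K - i)" by simp
  also have "\<dots> = monomial K (\<lambda>i. K - i)"
  proof -
    have "monomial K (\<lambda>i. if i \<le> K then K - i else Suc K - i) = monomial K (\<lambda>i. K - i)"
      by (rule monomial_cong) auto
    then show ?thesis by (simp add: monomial_def)
  qed
  finally show ?case using Suc by simp
qed

text \<open>The isobaric operator and the weighted plain one both give 1 at the staircase monomial;
  hence the factor between them is 1.\<close>

lemma dd_longest_1_eq_lenart: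
  assumes "1 \<le> k"
  shows "dd_longest 1 k (monomial k a) = lenart k k a"
proof -
  have "dd_longest 0 k (weight k) = 1"
    using dd_longest_1_mult_weight[of k "monomial k (\<lambda>i. k - i)"] lenart_staircase[OF assms, of k]
    by (simp add: lenart_def partial_weight_top dd_longest_1_staircase)
  then show ?thesis
    using dd_longest_1_mult_weight[of k "monomial k a"] by (simp add: lenart_def partial_weight_top)
qed

text \<open>Call the passage from i to i - 1 round i; it may raise the positions from i to k.
  Position r is thus open in the rounds 2, ..., min i r, at most min i r - 1 times; for i = k this
  is r - 1.\<close>

definition reachable :: "nat \<Rightarrow> nat \<Rightarrow> (nat \<Rightarrow> nat) \<Rightarrow> (nat \<Rightarrow> nat) \<Rightarrow> bool" where
  "reachable k i a b \<longleftrightarrow> strict_decr k b \<and> (\<forall>r\<in>{1..k}. a r \<le> b r \<and> b r \<le> a r + (min i r - 1))"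

lemma reachable_Suc:
  assumes a: "strict_decr k a" and "1 \<le> i"
  shows "reachable k (Suc i) a b \<longleftrightarrow>
    (\<exists>S. S \<subseteq> {Suc i..k} \<and> strict_decr k (add_set a S) \<and> reachable k i (add_set a S) b)"
proof
  assume b: "reachable k (Suc i) a b"
  \<comment> \<open>Only positions that exhaust their quota, b r = a r + i, have to be raised in
    this round; all others can wait.\<close>
  define S where "S = {r \<in> {Suc i..k}. b r = a r + i}"
  have le: "a r \<le> b r" "b r \<le> a r + (min (Suc i) r - 1)" if "1 \<le> r" "r \<le> k" for r
    using b that by (auto simp: reachable_def)
  have notin: "b r \<le> a r + (i - 1)" if "1 \<le> r" "r \<le> k" "r \<notin> S" for r
  proof (cases "Suc i \<le> r")
    case True
    then show ?thesis using le[OF that(1,2)] that assms(2) unfolding S_def by auto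
  next
    case False
    then show ?thesis using le[OF that(1,2)] by auto
  qed
  have "strict_decr k (add_set a S)"
    unfolding strict_decr_def
  proof (intro allI impI)
    fix j assume j: "1 \<le> j \<and> j < k"
    then have lt: "a (Suc j) < a j" "b (Suc j) < b j" using a b by (auto simp: strict_decr_def reachable_def)
    show "add_set a S (Suc j) < add_set a S j"
    proof (cases "Suc j \<in> S \<and> j \<notin> S")
      case True
      \<comment> \<open>The quotas leave a gap: b (j+1) < b j forces a (j+1) + 1 < a j, so position
        j + 1 may be raised alone.\<close>
      then have "b (Suc j) = a (Suc j) + i" "b j \<le> a j + (i - 1)" using notin[of j] j by (auto simp: S_def)
      then show ?thesis using True lt assms(2) by (simp add: add_set_def)
    next
      case False
      then show ?thesis using lt by (auto simp: add_set_def)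
    qed
  qed
  moreover have "reachable k i (add_set a S) b"
    unfolding reachable_def
  proof (intro conjI ballI)
    show "strict_decr k b" using b by (simp add: reachable_def)
    fix r assume r: "r \<in> {1..k}"
    show "add_set a S r \<le> b r"
      using le[of r] r assms(2) by (auto simp: add_set_def S_def)
    show "b r \<le> add_set a S r + (min i r - 1)"
      using le[of r] notin[of r] r assms(2) by (cases "r \<in> S"; cases "Suc i \<le> r") (auto simp: add_set_def S_def min_def)
  qed
  ultimately show "\<exists>S. S \<subseteq> {Suc i..k} \<and> strict_decr k (add_set a S) \<and> reachable k i (add_set a S) b"
    by (intro exI[of _ S]) (auto simp: S_def)
next
  assume "\<exists>S. S \<subseteq> {Suc i..k} \<and> strict_decr k (add_set a S) \<and> reachable k i (add_set a S) b"
  then obtain S where S: "S \<subseteq> {Suc i..k}" "reachable k i (add_set a S) b" by blast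
  show "reachable k (Suc i) a b"
    unfolding reachable_def
  proof (intro conjI ballI)
    show "strict_decr k b" using S by (simp add: reachable_def)
    fix r assume "r \<in> {1..k}"
    then have r: "add_set a S r \<le> b r" "b r \<le> add_set a S r + (min i r - 1)" using S by (auto simp: reachable_def)
    then show "a r \<le> b r" by (simp add: add_set_def)
    show "b r \<le> a r + (min (Suc i) r - 1)"
      using r(2) S(1) assms(2) by (cases "r \<in> S") (auto simp: add_set_def)
  qed
qed

lemma sum_add_set: "S \<subseteq> {1..k} \<Longrightarrow> (\<Sum>l\<in>{1..k}. add_set a S l) = (\<Sum>l\<in>{1..k}. a l) + card S"
  unfolding add_set_def sum.distrib by (simp add: Int_absorb1 of_bool_def flip: sum.inter_restrict)

lemma lookup_minus_one_power_mult:
  "Poly_Mapping.lookup ((- 1) ^ p * f) e = (- 1) ^ p * Poly_Mapping.lookup (f :: mpoly) e"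
  by (induction p) auto

text \<open>The parity of the excess of the degree of e over that of the Schur polynomial of a,
  which is |a| minus the size of the staircase. Adding all three numbers gives the same parity
  without truncated subtraction.\<close>

definition lenart_sign :: "nat \<Rightarrow> (nat \<Rightarrow> nat) \<Rightarrow> (nat \<Rightarrow>\<^sub>0 nat) \<Rightarrow> int" where
  "lenart_sign k a e = (- 1) ^ ((\<Sum>l\<in>{1..k}. Poly_Mapping.lookup e l) + (\<Sum>l\<in>{1..k}. k - l) + (\<Sum>l\<in>{1..k}. a l))"

text \<open>Enlarging a by S changes the sign by (-1)^(card S), the factor that S carries in
  \<open>lenart_Suc\<close>. After multiplication by the sign all summands are therefore nonnegative
  at e, and the support is the union over S.\<close>

lemma lookup_lenart:
  assumes "1 \<le> i" "strict_decr k a"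
  shows "lenart_sign k a e * Poly_Mapping.lookup (lenart k i a) e \<ge> 0 \<and>
    (Poly_Mapping.lookup (lenart k i a) e \<noteq> 0 \<longleftrightarrow>
      (\<exists>b. reachable k i a b \<and> dominated k (parts k b) (Poly_Mapping.lookup e)))"
  using assms
proof (induction i arbitrary: a rule: dec_induct)
  case base
  have L: "lenart k 1 a = dd_longest 0 k (monomial k a)" by (simp add: lenart_def partial_weight_1)
  have "lenart_sign k a e = 1" if "dominated k (parts k a) (Poly_Mapping.lookup e)"
  proof -
    have "(\<Sum>l\<in>{1..k}. Poly_Mapping.lookup e l) + (\<Sum>l\<in>{1..k}. k - l) = (\<Sum>l\<in>{1..k}. a l)"
      using that sum_parts[OF base] by (simp add: dominated_def)
    then show ?thesis by (simp add: lenart_sign_def)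
  qed
  moreover have "dominated k (parts k b) = dominated k (parts k a)" if "reachable k 1 a b" for b
  proof -
    have "b r = a r" if "1 \<le> r" "r \<le> k" for r
      using \<open>reachable k 1 a b\<close> that by (force simp: reachable_def)
    then show ?thesis by (intro ext dominated_cong) (simp add: parts_def)
  qed
  moreover have "reachable k 1 a a" using base by (simp add: reachable_def)
  ultimately have dom: "(\<exists>b. reachable k 1 a b \<and> dominated k (parts k b) (Poly_Mapping.lookup e)) \<longleftrightarrow>
      dominated k (parts k a) (Poly_Mapping.lookup e)"
    and sign: "dominated k (parts k a) (Poly_Mapping.lookup e) \<Longrightarrow> lenart_sign k a e = 1"
    by metis+
  show ?case
  proof (cases "dominated k (parts k a) (Poly_Mapping.lookup e)")
    case True
    then show ?thesis unfolding L dom using lookup_schur[OF base, of e] sign by simp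
  next
    case False
    then show ?thesis unfolding L dom using lookup_schur[OF base, of e] by simp
  qed
next
  case (step i)
  let ?A = "{S. S \<subseteq> {Suc i..k} \<and> strict_decr k (add_set a S)}"
  let ?c = "\<lambda>S. Poly_Mapping.lookup (lenart k i (add_set a S)) e"
  have fin: "finite ?A" by (rule finite_subset[of _ "Pow {Suc i..k}"]) auto
  have sign: "lenart_sign k a e * (- 1) ^ card S = lenart_sign k (add_set a S) e" if "S \<in> ?A" for S
  proof -
    have "S \<subseteq> {1..k}" using that by auto
    then show ?thesis unfolding lenart_sign_def by (simp only: sum_add_set add.assoc power_add mult.assoc)
  qed
  have sum: "Poly_Mapping.lookup (lenart k (Suc i) a) e = (\<Sum>S\<in>?A. (- 1) ^ card S * ?c S)"
    by (simp add: lenart_Suc[OF step.prems step(1)] lookup_sum lookup_minus_one_power_mult)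
  have eq: "lenart_sign k a e * Poly_Mapping.lookup (lenart k (Suc i) a) e = (\<Sum>S\<in>?A. lenart_sign k (add_set a S) e * ?c S)"
    unfolding sum sum_distrib_left
  proof (rule sum.cong[OF refl])
    fix S assume S: "S \<in> ?A"
    show "lenart_sign k a e * ((- 1) ^ card S * ?c S) = lenart_sign k (add_set a S) e * ?c S"
      by (simp only: mult.assoc[symmetric] sign[OF S])
  qed
  have nonneg: "lenart_sign k (add_set a S) e * ?c S \<ge> 0" if "S \<in> ?A" for S
  proof -
    have "strict_decr k (add_set a S)" using that by blast
    from step.IH[OF this] show ?thesis by (rule conjunct1)
  qed
  have nz: "lenart_sign k b e \<noteq> 0" for b by (simp add: lenart_sign_def)
  have "Poly_Mapping.lookup (lenart k (Suc i) a) e \<noteq> 0 \<longleftrightarrow> (\<exists>S\<in>?A. lenart_sign k (add_set a S) e * ?c S \<noteq> 0)"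
  proof -
    have "Poly_Mapping.lookup (lenart k (Suc i) a) e \<noteq> 0 \<longleftrightarrow>
        lenart_sign k a e * Poly_Mapping.lookup (lenart k (Suc i) a) e \<noteq> 0"
      by (simp only: mult_eq_0_iff nz simp_thms)
    also have "\<dots> \<longleftrightarrow> \<not> (\<forall>S\<in>?A. lenart_sign k (add_set a S) e * ?c S = 0)"
      unfolding eq using sum_nonneg_eq_0_iff[OF fin nonneg] by (rule arg_cong)
    finally show ?thesis by (simp only: Ball_def Bex_def not_all not_imp)
  qed
  also have "\<dots> \<longleftrightarrow> (\<exists>S\<in>?A. \<exists>b. reachable k i (add_set a S) b \<and> dominated k (parts k b) (Poly_Mapping.lookup e))"
  proof (rule bex_cong[OF refl])
    fix S assume "S \<in> ?A"
    then have "strict_decr k (add_set a S)" by blast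
    from step.IH[OF this] show "lenart_sign k (add_set a S) e * ?c S \<noteq> 0 \<longleftrightarrow>
        (\<exists>b. reachable k i (add_set a S) b \<and> dominated k (parts k b) (Poly_Mapping.lookup e))"
      by (simp only: mult_eq_0_iff nz simp_thms)
  qed
  also have "\<dots> \<longleftrightarrow> (\<exists>b. reachable k (Suc i) a b \<and> dominated k (parts k b) (Poly_Mapping.lookup e))"
    unfolding reachable_Suc[OF step.prems step(1)] by blast
  finally have "Poly_Mapping.lookup (lenart k (Suc i) a) e \<noteq> 0 \<longleftrightarrow>
    (\<exists>b. reachable k (Suc i) a b \<and> dominated k (parts k b) (Poly_Mapping.lookup e))" .
  moreover have "(\<Sum>S\<in>?A. lenart_sign k (add_set a S) e * ?c S) \<ge> 0" by (rule sum_nonneg) (rule nonneg)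
  ultimately show ?case unfolding eq by (rule conjI[rotated])
qed

section \<open>Integrality of generalized polymatroids\<close>

definition base_polytope :: "nat set \<Rightarrow> (nat set \<Rightarrow> int) \<Rightarrow> (nat \<Rightarrow> real) set" where
  "base_polytope E f = {t. (\<forall>i. i \<notin> E \<longrightarrow> t i = 0) \<and> (\<forall>I\<subseteq>E. (\<Sum>i\<in>I. t i) \<le> f I) \<and> (\<Sum>i\<in>E. t i) = f E}"

text \<open>Two-point convexity suffices: the integrality proof writes a point as a combination of
  two shifted ones.\<close>

definition segment_closed :: "(nat \<Rightarrow> real) set \<Rightarrow> bool" where
  "segment_closed C \<longleftrightarrow> (\<forall>x\<in>C. \<forall>y\<in>C. \<forall>u. 0 \<le> u \<and> u \<le> 1 \<longrightarrow> (\<lambda>i. u * x i + (1 - u) * y i) \<in> C)"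

definition fractional :: "nat set \<Rightarrow> (nat \<Rightarrow> real) \<Rightarrow> nat set" where
  "fractional E t = {i \<in> E. t i \<notin> \<int>}"

definition slack :: "nat set \<Rightarrow> (nat set \<Rightarrow> int) \<Rightarrow> (nat \<Rightarrow> real) \<Rightarrow> nat set set" where
  "slack E f t = {I. I \<subseteq> E \<and> (\<Sum>i\<in>I. t i) \<noteq> f I}"

lemma sum_shift:
  fixes t :: "nat \<Rightarrow> real"
  assumes "finite I" "i \<noteq> j"
  shows "(\<Sum>l\<in>I. (t(i := t i + \<epsilon>, j := t j - \<epsilon>)) l) = (\<Sum>l\<in>I. t l) + \<epsilon> * of_bool (i \<in> I) - \<epsilon> * of_bool (j \<in> I)"
proof -
  have "(\<Sum>l\<in>I. (t(i := t i + \<epsilon>, j := t j - \<epsilon>)) l) =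
     (\<Sum>l\<in>I. t l + (if l = i then \<epsilon> else 0) - (if l = j then \<epsilon> else 0))"
    using assms(2) by (intro sum.cong) auto
  then show ?thesis using assms(1) by (simp add: sum.distrib sum_subtractf sum.delta')
qed

text \<open>The shift can be blocked by coordinate i or j becoming integral or by a set with i but
  without j becoming tight; the minimum over \<open>A\<close> is the first such event. Tight sets
  contain both indices or neither and stay tight, so the measure drops.\<close>

lemma base_polytope_step:
  assumes E: "finite E" and t: "t \<in> base_polytope E f" and ij: "i \<noteq> j" "i \<in> fractional E t" "j \<in> fractional E t"
    and tight: "\<And>I. I \<subseteq> E \<Longrightarrow> (\<Sum>l\<in>I. t l) = f I \<Longrightarrow> i \<in> I \<longleftrightarrow> j \<in> I"
  obtains \<epsilon> where "\<epsilon> > 0" "t(i := t i + \<epsilon>, j := t j - \<epsilon>) \<in> base_polytope E f"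
    "card (fractional E (t(i := t i + \<epsilon>, j := t j - \<epsilon>))) + card (slack E f (t(i := t i + \<epsilon>, j := t j - \<epsilon>)))
      < card (fractional E t) + card (slack E f t)"
proof -
  let ?sum = "\<lambda>t I. \<Sum>l\<in>I. (t l :: real)"
  define A where "A = {of_int \<lceil>t i\<rceil> - t i, t j - of_int \<lfloor>t j\<rfloor>} \<union> (\<lambda>I. f I - ?sum t I) ` {I. I \<subseteq> E \<and> i \<in> I \<and> j \<notin> I}"
  define \<epsilon> where "\<epsilon> = Min A"
  let ?t = "t(i := t i + \<epsilon>, j := t j - \<epsilon>)"
  have le: "?sum t I \<le> f I" if "I \<subseteq> E" for I using t that by (auto simp: base_polytope_def)
  have iE: "i \<in> E" "j \<in> E" "t i \<notin> \<int>" "t j \<notin> \<int>" using ij by (auto simp: fractional_def)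
  have fin: "finite A" unfolding A_def using E by auto
  have pos: "x > 0" if "x \<in> A" for x
    using that unfolding A_def
  proof (elim UnE imageE)
    assume "x \<in> {of_int \<lceil>t i\<rceil> - t i, t j - of_int \<lfloor>t j\<rfloor>}"
    moreover have "of_int \<lceil>t i\<rceil> \<noteq> t i" "of_int \<lfloor>t j\<rfloor> \<noteq> t j" using iE by (metis Ints_of_int)+
    moreover have "t i \<le> of_int \<lceil>t i\<rceil>" "of_int \<lfloor>t j\<rfloor> \<le> t j" by auto
    ultimately show ?thesis by (elim insertE emptyE) linarith+
  next
    fix I assume I: "x = f I - ?sum t I" "I \<in> {I. I \<subseteq> E \<and> i \<in> I \<and> j \<notin> I}"
    then have "?sum t I \<noteq> f I" using tight by blast
    then show ?thesis using le[of I] I by auto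
  qed
  have "A \<noteq> {}" by (auto simp: A_def)
  then have "\<epsilon> \<in> A" unfolding \<epsilon>_def using fin by simp
  have \<epsilon>_le: "\<epsilon> \<le> x" if "x \<in> A" for x unfolding \<epsilon>_def using fin that by simp
  have \<epsilon>_pos: "\<epsilon> > 0" using pos \<open>\<epsilon> \<in> A\<close> by blast
  have sum_t: "?sum ?t I = ?sum t I + \<epsilon> * of_bool (i \<in> I) - \<epsilon> * of_bool (j \<in> I)" if "I \<subseteq> E" for I
    using sum_shift[OF finite_subset[OF that E] ij(1)] .
  have "?sum ?t I \<le> f I" if I: "I \<subseteq> E" for I
  proof (cases "i \<in> I \<and> j \<notin> I")
    case True
    then have "\<epsilon> \<le> f I - ?sum t I" using I by (intro \<epsilon>_le) (auto simp: A_def)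
    then show ?thesis using sum_t[OF I] True by simp
  next
    case False
    then show ?thesis using sum_t[OF I] le[OF I] \<epsilon>_pos by auto
  qed
  moreover have "?sum ?t E = f E" using sum_t[of E] t iE by (simp add: base_polytope_def)
  ultimately have base: "?t \<in> base_polytope E f" using t iE by (auto simp: base_polytope_def)
  have frac: "fractional E ?t \<subseteq> fractional E t" using iE by (auto simp: fractional_def)
  have tight_t: "?sum ?t I = f I" if "I \<subseteq> E" "?sum t I = f I" for I
    using sum_t[OF that(1)] tight[OF that] that by auto
  then have slack: "slack E f ?t \<subseteq> slack E f t" by (auto simp: slack_def)
  have fin': "finite (fractional E t)" "finite (slack E f t)" using E by (auto simp: fractional_def slack_def)
  have "fractional E ?t \<subset> fractional E t \<or> slack E f ?t \<subset> slack E f t"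
  proof -
    from \<open>\<epsilon> \<in> A\<close> consider "\<epsilon> = of_int \<lceil>t i\<rceil> - t i" | "\<epsilon> = t j - of_int \<lfloor>t j\<rfloor>"
      | I where "\<epsilon> = f I - ?sum t I" "I \<subseteq> E" "i \<in> I" "j \<notin> I" unfolding A_def by blast
    then show ?thesis
    proof cases
      case 1
      then have "i \<notin> fractional E ?t" using ij(1) by (simp add: fractional_def)
      then show ?thesis using frac ij by blast
    next
      case 2
      then have "j \<notin> fractional E ?t" by (simp add: fractional_def)
      then show ?thesis using frac ij by blast
    next
      case 3
      then have "?sum ?t I = f I" using sum_t[of I] by simp
      then have "I \<notin> slack E f ?t" "I \<in> slack E f t" using 3 \<epsilon>_pos by (auto simp: slack_def)
      then show ?thesis using slack by blast
    qed
  qed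
  then have "card (fractional E ?t) + card (slack E f ?t) < card (fractional E t) + card (slack E f t)"
  proof
    assume "fractional E ?t \<subset> fractional E t"
    then show ?thesis using psubset_card_mono[OF fin'(1)] card_mono[OF fin'(2) slack] by (meson add_less_le_mono)
  next
    assume "slack E f ?t \<subset> slack E f t"
    then show ?thesis using psubset_card_mono[OF fin'(2)] card_mono[OF fin'(1) frac] by (meson add_le_less_mono)
  qed
  then show ?thesis using that \<epsilon>_pos base by blast
qed

lemma sum_integral_except_one:
  fixes t :: "nat \<Rightarrow> real"
  assumes "finite D" "i \<in> D" "(\<Sum>l\<in>D. t l) \<in> \<int>" "\<And>l. l \<in> D \<Longrightarrow> l \<noteq> i \<Longrightarrow> t l \<in> \<int>"
  shows "t i \<in> \<int>"
proof -
  have "(\<Sum>l\<in>D - {i}. t l) \<in> \<int>" using assms by (intro Ints_sum) auto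
  moreover have "t i = (\<Sum>l\<in>D. t l) - (\<Sum>l\<in>D - {i}. t l)" using assms by (simp add: sum.remove)
  ultimately show ?thesis using assms(3) by (metis Ints_diff)
qed

text \<open>Tight sets form a lattice. If t is fractional, choose a fractional coordinate i whose smallest tight
  set is minimal; as f is integral, this set contains a second fractional coordinate j, and no tight
  set separates i from j. Hence t can be moved in both directions along the difference of the
  corresponding unit vectors, until a further coordinate becomes integral or a further set tight.\<close>

lemma base_polytope_integral:
  assumes E: "finite E" and sub: "submodular_on E (\<lambda>I. real_of_int (f I))"
    and C: "segment_closed C" "\<And>s. s \<in> base_polytope E f \<Longrightarrow> (\<And>i. s i \<in> \<int>) \<Longrightarrow> s \<in> C"
  shows "t \<in> base_polytope E f \<Longrightarrow> t \<in> C"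
proof (induction t rule: measure_induct_rule[of "\<lambda>t. card (fractional E t) + card (slack E f t)"])
  case (less t)
  let ?sum = "\<lambda>t I. \<Sum>l\<in>I. (t l :: real)"
  note t = less.prems
  show ?case
  proof (cases "fractional E t = {}")
    case True
    then have "t i \<in> \<int>" for i using t by (cases "i \<in> E") (auto simp: fractional_def base_polytope_def)
    then show ?thesis by (rule C(2)[OF t])
  next
    case False
    define T where "T = {I. I \<subseteq> E \<and> ?sum t I = f I}"
    have le: "?sum t I \<le> f I" if "I \<subseteq> E" for I using t that by (auto simp: base_polytope_def)
    have inter: "I \<inter> J \<in> T" if "I \<in> T" "J \<in> T" for I J
    proof -
      have IJ: "I \<subseteq> E" "J \<subseteq> E" "?sum t I = f I" "?sum t J = f J" using that by (auto simp: T_def)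
      have "?sum t (I \<union> J) + ?sum t (I \<inter> J) = ?sum t I + ?sum t J"
        using IJ E by (intro sum.union_inter) (auto intro: finite_subset)
      moreover have "real_of_int (f I) + f J \<ge> f (I \<union> J) + f (I \<inter> J)"
        using sub[unfolded submodular_on_def, rule_format, OF IJ(1,2)] by simp
      moreover have "I \<union> J \<subseteq> E" "I \<inter> J \<subseteq> E" using IJ by auto
      ultimately have "?sum t (I \<inter> J) = f (I \<inter> J)"
        using le[of "I \<union> J"] le[of "I \<inter> J"] IJ(3,4) by linarith
      then show ?thesis using IJ(1) unfolding T_def by blast
    qed
    have Inter: "\<Inter>F \<in> T" if "finite F" "F \<noteq> {}" "F \<subseteq> T" for F
      using that
    proof (induction rule: finite_ne_induct)
      case (singleton I)
      then show ?case by simp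
    next
      case (insert I F)
      then have "I \<inter> \<Inter>F \<in> T" by (intro inter) blast+
      then show ?case by simp
    qed
    have "E \<in> T" using t by (auto simp: T_def base_polytope_def)
    \<comment> \<open>The smallest tight set containing i; as E itself is tight, the intersection is
      over a nonempty family.\<close>
    define D where "D i = \<Inter>{I \<in> T. i \<in> I}" for i
    have finT: "finite T" using E by (auto simp: T_def)
    have D: "D i \<in> T" if "i \<in> E" for i
      unfolding D_def using finT that \<open>E \<in> T\<close> by (intro Inter) auto
    have D_sub: "D i \<subseteq> I" if "I \<in> T" "i \<in> I" for i I using that by (auto simp: D_def)
    have D_self: "i \<in> D i" for i by (auto simp: D_def)
    have finF: "finite (fractional E t)" using E by (simp add: fractional_def)
    then have "Min ((\<lambda>i. card (D i)) ` fractional E t) \<in> (\<lambda>i. card (D i)) ` fractional E t"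
      using False by (intro Min_in) auto
    then obtain i where i: "i \<in> fractional E t" and min: "Min ((\<lambda>i. card (D i)) ` fractional E t) = card (D i)"
      by blast
    have i_min: "card (D i) \<le> card (D l)" if "l \<in> fractional E t" for l
      unfolding min[symmetric] using finF that by (intro Min_le) auto
    have iE: "i \<in> E" "t i \<notin> \<int>" using i by (auto simp: fractional_def)
    have DE: "D i \<subseteq> E" "?sum t (D i) = f (D i)" using D[OF iE(1)] by (auto simp: T_def)
    have "?sum t (D i) \<in> \<int>" unfolding DE(2) by (rule Ints_of_int)
    then have "\<not> (\<forall>l\<in>D i. l \<noteq> i \<longrightarrow> t l \<in> \<int>)"
      using sum_integral_except_one[OF finite_subset[OF DE(1) E] D_self, of t] iE(2) by blast
    then obtain j where j: "j \<in> D i" "j \<noteq> i" "t j \<notin> \<int>" by blast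
    then have jf: "j \<in> fractional E t" using DE by (auto simp: fractional_def)
    then have jE: "j \<in> E" by (simp add: fractional_def)
    have "D j \<subseteq> D i" using D_sub[OF D[OF iE(1)] j(1)] .
    \<comment> \<open>Minimality of i among the fractional coordinates forces equality, which
      excludes a tight set with j but without i.\<close>
    then have "D j = D i" using i_min[OF jf] finite_subset[OF DE(1) E] by (intro card_seteq)
    then have tight: "i \<in> I \<longleftrightarrow> j \<in> I" if "I \<subseteq> E" "?sum t I = f I" for I
      using D_sub[of I i] D_sub[of I j] j(1) D_self that unfolding T_def by blast
    obtain \<epsilon> where \<epsilon>: "\<epsilon> > 0" "t(i := t i + \<epsilon>, j := t j - \<epsilon>) \<in> C"
    proof (rule base_polytope_step[OF E t j(2)[symmetric] i jf tight])
      fix \<epsilon> assume \<epsilon>: "\<epsilon> > 0" "t(i := t i + \<epsilon>, j := t j - \<epsilon>) \<in> base_polytope E f"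
        "card (fractional E (t(i := t i + \<epsilon>, j := t j - \<epsilon>))) + card (slack E f (t(i := t i + \<epsilon>, j := t j - \<epsilon>)))
          < card (fractional E t) + card (slack E f t)"
      show thesis by (rule that[OF \<epsilon>(1) less.IH[OF \<epsilon>(3,2)]])
    qed
    obtain \<delta> where \<delta>: "\<delta> > 0" "t(j := t j + \<delta>, i := t i - \<delta>) \<in> C"
    proof (rule base_polytope_step[OF E t j(2) jf i tight[symmetric]])
      fix \<epsilon> assume \<epsilon>: "\<epsilon> > 0" "t(j := t j + \<epsilon>, i := t i - \<epsilon>) \<in> base_polytope E f"
        "card (fractional E (t(j := t j + \<epsilon>, i := t i - \<epsilon>))) + card (slack E f (t(j := t j + \<epsilon>, i := t i - \<epsilon>)))
          < card (fractional E t) + card (slack E f t)"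
      show thesis by (rule that[OF \<epsilon>(1) less.IH[OF \<epsilon>(3,2)]])
    qed
    \<comment> \<open>The weight that balances the two opposite shifts: u \<epsilon> = (1 - u)
      \<delta>.\<close>
    define u where "u = \<delta> / (\<epsilon> + \<delta>)"
    have u: "0 \<le> u \<and> u \<le> 1" using \<epsilon>(1) \<delta>(1) by (simp add: u_def)
    have bal: "u * \<epsilon> = (1 - u) * \<delta>" using \<epsilon>(1) \<delta>(1) by (simp add: u_def field_simps)
    have "(\<lambda>l. u * (t(i := t i + \<epsilon>, j := t j - \<epsilon>)) l + (1 - u) * (t(j := t j + \<delta>, i := t i - \<delta>)) l) \<in> C"
      using C(1) \<epsilon>(2) \<delta>(2) u unfolding segment_closed_def by blast
    also have "(\<lambda>l. u * (t(i := t i + \<epsilon>, j := t j - \<epsilon>)) l + (1 - u) * (t(j := t j + \<delta>, i := t i - \<delta>)) l) = t"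
    proof
      fix l
      have "u * (t i + \<epsilon>) + (1 - u) * (t i - \<delta>) = t i" "u * (t j - \<epsilon>) + (1 - u) * (t j + \<delta>) = t j"
        using bal by algebra+
      moreover have "u * t l + (1 - u) * t l = t l" by (simp add: left_diff_distrib)
      ultimately show "u * (t(i := t i + \<epsilon>, j := t j - \<epsilon>)) l + (1 - u) * (t(j := t j + \<delta>, i := t i - \<delta>)) l = t l"
        using j(2) by simp
    qed
    finally show ?thesis .
  qed
qed

section \<open>Reduction of generalized polymatroids to base polytopes\<close>

definition polymatroid :: "nat set \<Rightarrow> (nat set \<Rightarrow> int) \<Rightarrow> (nat set \<Rightarrow> int) \<Rightarrow> (nat \<Rightarrow> real) set" where
  "polymatroid E y z = {t. (\<forall>i. i \<notin> E \<longrightarrow> t i = 0) \<and> (\<forall>I. I \<subseteq> E \<longrightarrow> y I \<le> (\<Sum>i\<in>I. t i) \<and> (\<Sum>i\<in>I. t i) \<le> z I)}"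

text \<open>A generalized polymatroid is the projection of a base polytope with the additional coordinate
  t 0 = - sum t E.\<close>

definition base_rank :: "nat set \<Rightarrow> (nat set \<Rightarrow> int) \<Rightarrow> (nat set \<Rightarrow> int) \<Rightarrow> nat set \<Rightarrow> int" where
  "base_rank E y z I = (if 0 \<in> I then - y (E - I) else z I)"

text \<open>If both sets contain 0, complementation turns the claim into supermodularity of y; if
  exactly one does, it is the mixed condition of a paramodular pair, applied to the complement of
  that set.\<close>

lemma submodular_base_rank:
  assumes "paramodular_on E (\<lambda>I. real_of_int (y I)) (\<lambda>I. real_of_int (z I))" "0 \<notin> E"
  shows "submodular_on (insert 0 E) (\<lambda>I. real_of_int (base_rank E y z I))"
proof -
  note para = assms(1)[unfolded paramodular_on_def]
  have y: "y I + y J \<le> y (I \<union> J) + y (I \<inter> J)" if "I \<subseteq> E" "J \<subseteq> E" for I J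
    using para[THEN conjunct1, unfolded supermodular_on_def submodular_on_def, rule_format, OF that] by linarith
  have z: "z I + z J \<ge> z (I \<union> J) + z (I \<inter> J)" if "I \<subseteq> E" "J \<subseteq> E" for I J
    using para[THEN conjunct2, THEN conjunct1, unfolded submodular_on_def, rule_format, OF that] by linarith
  have yz: "z I - y J \<ge> z (I - J) - y (J - I)" if "I \<subseteq> E" "J \<subseteq> E" for I J
    using para[THEN conjunct2, THEN conjunct2, rule_format, OF that] by linarith
  have mixed: "base_rank E y z I + base_rank E y z J \<ge> base_rank E y z (I \<union> J) + base_rank E y z (I \<inter> J)"
    if "I \<subseteq> E" "J \<subseteq> insert 0 E" "0 \<in> J" for I J
  proof -
    have "0 \<notin> I" using that assms(2) by blast
    have eq: "I - (E - J) = I \<inter> J" "E - J - I = E - (I \<union> J)" using that by blast+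
    show ?thesis using yz[of I "E - J"] that \<open>0 \<notin> I\<close> unfolding eq by (simp add: base_rank_def)
  qed
  have "base_rank E y z I + base_rank E y z J \<ge> base_rank E y z (I \<union> J) + base_rank E y z (I \<inter> J)"
    if IJ: "I \<subseteq> insert 0 E" "J \<subseteq> insert 0 E" for I J
  proof -
    consider "0 \<in> I" "0 \<in> J" | "0 \<notin> I" "0 \<in> J" | "0 \<in> I" "0 \<notin> J" | "0 \<notin> I" "0 \<notin> J" by blast
    then show ?thesis
    proof cases
      case 1
      have eq: "E - I \<union> (E - J) = E - I \<inter> J" "(E - I) \<inter> (E - J) = E - (I \<union> J)" by blast+
      show ?thesis using y[of "E - I" "E - J"] 1 unfolding eq by (simp add: base_rank_def)
    next
      case 2
      then show ?thesis using mixed[of I J] IJ by blast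
    next
      case 3
      then have "base_rank E y z J + base_rank E y z I \<ge> base_rank E y z (J \<union> I) + base_rank E y z (J \<inter> I)"
        using IJ by (intro mixed) blast+
      then show ?thesis by (simp only: Un_commute Int_commute add.commute)
    next
      case 4
      then have "I \<subseteq> E" "J \<subseteq> E" using IJ by blast+
      then show ?thesis using z[of I J] 4 by (simp add: base_rank_def)
    qed
  qed
  then show ?thesis unfolding submodular_on_def by (simp only: of_int_add[symmetric] of_int_le_iff) blast
qed

lemma sum_extend:
  fixes t :: "nat \<Rightarrow> real"
  assumes "finite E" "0 \<notin> E" "I \<subseteq> insert 0 E"
  shows "(\<Sum>i\<in>I. (t(0 := - (\<Sum>i\<in>E. t i))) i) = (if 0 \<in> I then - (\<Sum>i\<in>E - I. t i) else (\<Sum>i\<in>I. t i))"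
proof (cases "0 \<in> I")
  case True
  have fin: "finite I" using assms finite_subset by blast
  have I': "I - {0} \<subseteq> E" using assms by blast
  have "(\<Sum>i\<in>I. (t(0 := - (\<Sum>i\<in>E. t i))) i) = - (\<Sum>i\<in>E. t i) + (\<Sum>i\<in>I - {0}. t i)"
    using True fin by (simp add: sum.remove)
  moreover have "(\<Sum>i\<in>E. t i) = (\<Sum>i\<in>E - (I - {0}). t i) + (\<Sum>i\<in>I - {0}. t i)"
    using assms(1) I' by (rule sum.subset_diff[rotated])
  moreover have "E - (I - {0}) = E - I" using assms(2) by blast
  ultimately show ?thesis using True by simp
next
  case False
  then show ?thesis by (auto intro!: sum.cong)
qed

lemma polymatroid_integral:
  assumes E: "finite E" "0 \<notin> E" and para: "paramodular_on E (\<lambda>I. real_of_int (y I)) (\<lambda>I. real_of_int (z I))"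
    and "y {} = 0" and C: "segment_closed C" "\<And>s. s \<in> polymatroid E y z \<Longrightarrow> (\<And>i. s i \<in> \<int>) \<Longrightarrow> s \<in> C"
    and t: "t \<in> polymatroid E y z"
  shows "t \<in> C"
proof -
  let ?f = "base_rank E y z" and ?E = "insert 0 E"
  \<comment> \<open>The preimage of C under forgetting coordinate 0; it is again closed under
    segments.\<close>
  define C' where "C' = {s. s(0 := 0) \<in> C}"
  have "t(0 := - (\<Sum>i\<in>E. t i)) \<in> C'"
  proof (rule base_polytope_integral[of ?E ?f])
    show "finite ?E" using E by simp
    show "submodular_on ?E (\<lambda>I. real_of_int (?f I))" using para E(2) by (rule submodular_base_rank)
    show "segment_closed C'"
      unfolding segment_closed_def
    proof (intro ballI allI impI)
      fix x v :: "nat \<Rightarrow> real" and u :: real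
      assume xv: "x \<in> C'" "v \<in> C'" and u: "0 \<le> u \<and> u \<le> 1"
      have "(\<lambda>i. u * (x(0 := 0)) i + (1 - u) * (v(0 := 0)) i) \<in> C"
        using xv u C(1) unfolding C'_def segment_closed_def by blast
      moreover have "(\<lambda>i. u * (x(0 := 0)) i + (1 - u) * (v(0 := 0)) i) = (\<lambda>i. u * x i + (1 - u) * v i)(0 := 0)"
        by auto
      ultimately show "(\<lambda>i. u * x i + (1 - u) * v i) \<in> C'" by (simp add: C'_def)
    qed
    show "t(0 := - (\<Sum>i\<in>E. t i)) \<in> base_polytope ?E ?f"
      unfolding base_polytope_def
    proof (intro CollectI conjI allI impI)
      show "(t(0 := - (\<Sum>i\<in>E. t i))) i = 0" if "i \<notin> ?E" for i using t that by (auto simp: polymatroid_def)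
      show "(\<Sum>i\<in>I. (t(0 := - (\<Sum>i\<in>E. t i))) i) \<le> ?f I" if "I \<subseteq> ?E" for I
      proof (cases "0 \<in> I")
        case True
        have "y (E - I) \<le> (\<Sum>i\<in>E - I. t i)" using t by (auto simp: polymatroid_def)
        then show ?thesis using True unfolding sum_extend[OF E that] by (simp add: base_rank_def)
      next
        case False
        then have "I \<subseteq> E" using that by blast
        then have "(\<Sum>i\<in>I. t i) \<le> z I" using t by (auto simp: polymatroid_def)
        then show ?thesis using False unfolding sum_extend[OF E that] by (simp add: base_rank_def)
      qed
      have E_eq: "E - insert 0 E = {}" by blast
      show "(\<Sum>i\<in>?E. (t(0 := - (\<Sum>i\<in>E. t i))) i) = ?f ?E"
        unfolding sum_extend[OF E order_refl] base_rank_def E_eq by (simp add: \<open>y {} = 0\<close>)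
    qed
    fix s assume s: "s \<in> base_polytope ?E ?f" and int: "\<And>i. s i \<in> \<int>"
    let ?s = "s(0 := 0)"
    have E_eq: "E - insert 0 E = {}" by blast
    have "(\<Sum>i\<in>?E. s i) = 0" using s E_eq by (simp add: base_polytope_def base_rank_def \<open>y {} = 0\<close>)
    then have "s 0 = - (\<Sum>i\<in>E. s i)" using E by simp
    then have s0: "s = ?s(0 := - (\<Sum>i\<in>E. ?s i))"
      unfolding sum_fun_upd_notin[OF E(2)] by (simp add: fun_eq_iff)
    have bound: "(\<Sum>i\<in>I. s i) \<le> ?f I" if "I \<subseteq> ?E" for I
      using s that by (simp add: base_polytope_def)
    have s_sum: "(\<Sum>i\<in>I. s i) = (if 0 \<in> I then - (\<Sum>i\<in>E - I. ?s i) else (\<Sum>i\<in>I. ?s i))" if "I \<subseteq> ?E" for I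
    proof -
      have "(\<Sum>i\<in>I. s i) = (\<Sum>i\<in>I. (?s(0 := - (\<Sum>i\<in>E. ?s i))) i)"
        by (rule arg_cong[OF s0, of "\<lambda>s. \<Sum>i\<in>I. s i"])
      also note sum_extend[OF E that, of ?s]
      finally show ?thesis .
    qed
    have "?s \<in> polymatroid E y z"
      unfolding polymatroid_def
    proof (intro CollectI conjI allI impI)
      show "?s i = 0" if "i \<notin> E" for i using s that by (auto simp: base_polytope_def)
      fix I assume I: "I \<subseteq> E"
      then have "0 \<notin> I" and I': "I \<subseteq> ?E" using E(2) by blast+
      show "(\<Sum>i\<in>I. ?s i) \<le> z I"
        using bound[OF I'] s_sum[OF I'] \<open>0 \<notin> I\<close> unfolding base_rank_def by (simp only: if_False)
      let ?J = "insert 0 (E - I)"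
      have J: "?J \<subseteq> ?E" "0 \<in> ?J" by blast+
      have eq: "E - ?J = I" using I \<open>0 \<notin> I\<close> by blast
      have "- (\<Sum>i\<in>I. ?s i) \<le> - y I"
        using bound[OF J(1)] s_sum[OF J(1)] J(2) unfolding base_rank_def eq by (simp only: if_True of_int_minus)
      then show "y I \<le> (\<Sum>i\<in>I. ?s i)" by linarith
    qed
    then have "?s \<in> C" by (rule C(2)) (use int in auto)
    then show "s \<in> C'" by (simp add: C'_def)
  qed
  moreover have "t 0 = 0" using t E by (auto simp: polymatroid_def)
  ultimately show ?thesis by (simp add: C'_def fun_upd_idem)
qed

section \<open>The support as the set of lattice points\<close>

text \<open>A partition mu with mu_j \<le> nu_j + j - 1 for all j also has mu_i \<le> mu_j for j
  \<le> i. The minimum over j is therefore the i-th part of the largest such mu.\<close>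

definition max_part :: "(nat \<Rightarrow> nat) \<Rightarrow> nat \<Rightarrow> nat" where
  "max_part \<nu> i = Min ((\<lambda>j. \<nu> j + (j - 1)) ` {1..i})"

definition lower :: "nat \<Rightarrow> (nat \<Rightarrow> nat) \<Rightarrow> nat \<Rightarrow> nat" where
  "lower k \<nu> j = (\<Sum>i\<in>{1..j}. \<nu> (k + 1 - i))"

definition upper :: "(nat \<Rightarrow> nat) \<Rightarrow> nat \<Rightarrow> nat" where
  "upper \<nu> j = (\<Sum>i\<in>{1..j}. max_part \<nu> i)"

definition decr :: "nat \<Rightarrow> (nat \<Rightarrow> nat) \<Rightarrow> bool" where
  "decr k \<nu> \<longleftrightarrow> (\<forall>i. 1 \<le> i \<and> i < k \<longrightarrow> \<nu> (Suc i) \<le> \<nu> i)"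

lemma decr_le: "decr k \<nu> \<Longrightarrow> 1 \<le> i \<Longrightarrow> i \<le> j \<Longrightarrow> j \<le> k \<Longrightarrow> \<nu> j \<le> \<nu> i"
proof (induction j)
  case (Suc j)
  show ?case
  proof (cases "i = Suc j")
    case False
    moreover have "\<nu> (Suc j) \<le> \<nu> j" using Suc.prems False unfolding decr_def by auto
    moreover have "\<nu> j \<le> \<nu> i" using Suc.IH Suc.prems False by simp
    ultimately show ?thesis by (meson order_trans)
  qed simp
qed simp

lemma max_part_le: "1 \<le> j \<Longrightarrow> j \<le> i \<Longrightarrow> max_part \<nu> i \<le> \<nu> j + (j - 1)"
  unfolding max_part_def by (intro Min_le) auto

lemma le_max_part:
  "1 \<le> i \<Longrightarrow> (\<And>j. 1 \<le> j \<Longrightarrow> j \<le> i \<Longrightarrow> m \<le> \<nu> j + (j - 1)) \<Longrightarrow> m \<le> max_part \<nu> i"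
  unfolding max_part_def by (rule Min.boundedI) auto

lemma max_part_decr: "decr k (max_part \<nu>)"
  unfolding decr_def
proof (intro allI impI)
  fix i assume "1 \<le> i \<and> i < k"
  then show "max_part \<nu> (Suc i) \<le> max_part \<nu> i" by (intro le_max_part max_part_le) simp_all
qed

lemma parts_le_max_part:
  assumes "decr k \<nu>" "1 \<le> i" "i \<le> k"
  shows "\<nu> i \<le> max_part \<nu> i"
proof (rule le_max_part)
  fix j assume "1 \<le> j" "j \<le> i"
  then have "\<nu> i \<le> \<nu> j" using decr_le[OF assms(1), of j i] assms(3) by simp
  then show "\<nu> i \<le> \<nu> j + (j - 1)" by (rule trans_le_add1)
qed (use assms in simp)

lemma sum_split_reverse:
  fixes f :: "nat \<Rightarrow> nat"
  shows "j \<le> k \<Longrightarrow> (\<Sum>i\<in>{1..k}. f i) = (\<Sum>i\<in>{1..k - j}. f i) + (\<Sum>i\<in>{1..j}. f (k + 1 - i))"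
proof (induction j)
  case (Suc j)
  then have "k - j = Suc (k - Suc j)" by simp
  then show ?case using Suc by simp
qed simp

text \<open>From left to right, the lower bound for I comes from dominance for its complement.
  Conversely, the total of alpha is filled greedily between nu and the maximal partition; dominance
  for small I is then the upper bound for I, and for large I the lower bound for the
  complement.\<close>

lemma reachable_dominated_iff:
  assumes a: "strict_decr k a"
  shows "(\<exists>b. reachable k k a b \<and> dominated k (parts k b) \<alpha>) \<longleftrightarrow> (\<forall>i. i \<notin> {1..k} \<longrightarrow> \<alpha> i = 0) \<and>
    (\<forall>I\<subseteq>{1..k}. lower k (parts k a) (card I) \<le> (\<Sum>i\<in>I. \<alpha> i) \<and> (\<Sum>i\<in>I. \<alpha> i) \<le> upper (parts k a) (card I))"
    (is "?L \<longleftrightarrow> ?R")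
proof
  let ?\<nu> = "parts k a"
  have compl: "(\<Sum>i\<in>I. \<alpha> i) + (\<Sum>i\<in>{1..k} - I. \<alpha> i) = (\<Sum>i\<in>{1..k}. \<alpha> i)"
    "card ({1..k} - I) = k - card I" "card I \<le> k" if "I \<subseteq> {1..k}" for I
    using sum.subset_diff[OF that, of \<alpha>] card_Diff_subset[OF finite_subset[OF that] that] card_mono[OF _ that] by auto
  have \<nu>: "decr k ?\<nu>" using parts_decr[OF a] by (simp add: decr_def)
  {
    assume ?L
    then obtain b where b: "reachable k k a b" "dominated k (parts k b) \<alpha>" by blast
    let ?\<mu> = "parts k b"
    have sb: "strict_decr k b" using b(1) by (simp add: reachable_def)
    have \<mu>: "decr k ?\<mu>" using parts_decr[OF sb] by (simp add: decr_def)
    have le: "?\<nu> r \<le> ?\<mu> r" "?\<mu> r \<le> ?\<nu> r + (r - 1)" if "1 \<le> r" "r \<le> k" for r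
    proof -
      have "a r \<le> b r" "b r \<le> a r + (r - 1)" using b(1) that by (auto simp: reachable_def)
      then show "?\<nu> r \<le> ?\<mu> r" "?\<mu> r \<le> ?\<nu> r + (r - 1)"
        using parts_add[OF a that] parts_add[OF sb that] by linarith+
    qed
    have "?\<mu> i \<le> max_part ?\<nu> i" if "1 \<le> i" "i \<le> k" for i
    proof (rule le_max_part)
      fix j assume "1 \<le> j" "j \<le> i"
      then show "?\<mu> i \<le> ?\<nu> j + (j - 1)" using decr_le[OF \<mu>, of j i] le(2)[of j] that by simp
    qed (use that in simp)
    then have up: "(\<Sum>i\<in>{1..j}. ?\<mu> i) \<le> upper ?\<nu> j" if "j \<le> k" for j
      unfolding upper_def using that by (intro sum_mono) auto
    have low: "lower k ?\<nu> j \<le> (\<Sum>i\<in>{1..j}. ?\<mu> (k + 1 - i))" if "j \<le> k" for j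
      unfolding lower_def using that by (intro sum_mono le) auto
    have dom: "(\<Sum>i\<in>I. \<alpha> i) \<le> (\<Sum>i\<in>{1..card I}. ?\<mu> i)" if "I \<subseteq> {1..k}" for I
      using b(2) that unfolding dominated_def by simp
    show ?R
    proof (intro conjI allI impI)
      show "\<alpha> i = 0" if "i \<notin> {1..k}" for i using b(2) that by (simp add: dominated_def)
      fix I assume I: "I \<subseteq> {1..k}"
      show "(\<Sum>i\<in>I. \<alpha> i) \<le> upper ?\<nu> (card I)" using dom[OF I] up compl(3)[OF I] by (meson order_trans)
      have "(\<Sum>i\<in>{1..k} - I. \<alpha> i) \<le> (\<Sum>i\<in>{1..k - card I}. ?\<mu> i)"
        using dom[of "{1..k} - I"] compl(2)[OF I] by simp
      moreover have "(\<Sum>i\<in>{1..k}. \<alpha> i) = (\<Sum>i\<in>{1..k}. ?\<mu> i)" using b(2) by (simp add: dominated_def)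
      ultimately show "lower k ?\<nu> (card I) \<le> (\<Sum>i\<in>I. \<alpha> i)"
        using sum_split_reverse[OF compl(3)[OF I], of ?\<mu>] low[OF compl(3)[OF I]] compl(1)[OF I] by linarith
    qed
  next
    assume R: ?R
    then have zero: "\<And>i. i \<notin> {1..k} \<Longrightarrow> \<alpha> i = 0" by blast
    have low: "lower k ?\<nu> (card I) \<le> (\<Sum>i\<in>I. \<alpha> i)" and up: "(\<Sum>i\<in>I. \<alpha> i) \<le> upper ?\<nu> (card I)"
      if "I \<subseteq> {1..k}" for I using R that by blast+
    let ?d = "\<Sum>i\<in>{1..k}. \<alpha> i"
    have bounds: "(\<Sum>i\<in>{1..k}. ?\<nu> i) \<le> ?d" "?d \<le> (\<Sum>i\<in>{1..k}. max_part ?\<nu> i)"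
      using low[of "{1..k}"] up[of "{1..k}"] sum_split_reverse[of k k ?\<nu>] by (simp_all add: lower_def upper_def)
    obtain v r where r: "r \<le> k" and v: "\<forall>i\<in>{1..k}. ?\<nu> i \<le> v i \<and> v i \<le> max_part ?\<nu> i" "(\<Sum>i\<in>{1..k}. v i) = ?d"
      "\<forall>i. 1 \<le> i \<and> i < r \<longrightarrow> v i = max_part ?\<nu> i" "\<forall>i. r < i \<and> i \<le> k \<longrightarrow> v i = ?\<nu> i"
      using greedy_fill[OF parts_le_max_part[OF \<nu>] bounds] by blast
    \<comment> \<open>Before r the entries are those of the maximal partition, after r those of nu;
      next to r itself the two bounds on its entry are used.\<close>
    have v_decr: "v (Suc i) \<le> v i" if i: "1 \<le> i" "i < k" for i
    proof (cases "i < r")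
      case True
      have "v (Suc i) \<le> max_part ?\<nu> (Suc i)" using v(1) i by auto
      also have "\<dots> \<le> max_part ?\<nu> i" using max_part_decr[of k ?\<nu>] i unfolding decr_def by blast
      finally show ?thesis using v(3) True i by simp
    next
      case False
      then have "v (Suc i) = ?\<nu> (Suc i)" using v(4) i by simp
      also have "\<dots> \<le> ?\<nu> i" using \<nu> i unfolding decr_def by blast
      also have "\<dots> \<le> v i" using v(1) i by auto
      finally show ?thesis .
    qed
    define b where "b i = v i + (k - i)" for i
    have sb: "strict_decr k b"
      unfolding strict_decr_def b_def
    proof (intro allI impI)
      fix i assume "1 \<le> i \<and> i < k"
      then show "v (Suc i) + (k - Suc i) < v i + (k - i)" using v_decr[of i] by linarith
    qed
    have pb: "parts k b = v" by (simp add: parts_def b_def fun_eq_iff)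
    have "reachable k k a b"
      unfolding reachable_def
    proof (intro conjI sb ballI)
      fix i assume i: "i \<in> {1..k}"
      then have vi: "?\<nu> i \<le> v i" "v i \<le> max_part ?\<nu> i" using v(1) by blast+
      moreover have "max_part ?\<nu> i \<le> ?\<nu> i + (i - 1)" using i by (intro max_part_le) auto
      ultimately show "a i \<le> b i" "b i \<le> a i + (min k i - 1)"
        using i parts_add[OF a, of i] by (auto simp: b_def)
    qed
    moreover have "dominated k v \<alpha>"
      unfolding dominated_def
    proof (intro conjI allI impI)
      show "\<alpha> i = 0" if "i \<notin> {1..k}" for i using zero that .
      show "?d = (\<Sum>i\<in>{1..k}. v i)" using v(2) by simp
      fix I assume I: "I \<subseteq> {1..k}"
      let ?j = "card I"
      show "(\<Sum>i\<in>I. \<alpha> i) \<le> (\<Sum>i\<in>{1..?j}. v i)"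
      proof (cases "?j < r")
        case True
        then have "upper ?\<nu> ?j = (\<Sum>i\<in>{1..?j}. v i)" unfolding upper_def using v(3) by (intro sum.cong) auto
        then show ?thesis using up[OF I] by simp
      next
        case False
        have "(\<Sum>i\<in>{1..k - ?j}. v (k + 1 - i)) = lower k ?\<nu> (k - ?j)"
          unfolding lower_def
        proof (intro sum.cong refl)
          fix i assume "i \<in> {1..k - ?j}"
          then have "1 \<le> i" "i \<le> k - ?j" by simp_all
          then have "r < k + 1 - i \<and> k + 1 - i \<le> k" using False by linarith
          then show "v (k + 1 - i) = ?\<nu> (k + 1 - i)" using v(4) by blast
        qed
        moreover have "lower k ?\<nu> (k - ?j) \<le> (\<Sum>i\<in>{1..k} - I. \<alpha> i)"
          using low[of "{1..k} - I"] compl(2)[OF I] by simp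
        moreover have "(\<Sum>i\<in>{1..k}. v i) = (\<Sum>i\<in>{1..?j}. v i) + (\<Sum>i\<in>{1..k - ?j}. v (k + 1 - i))"
          using sum_split_reverse[of "k - ?j" k v] compl(3)[OF I] by simp
        ultimately show ?thesis using compl(1)[OF I] v(2) by linarith
      qed
    qed
    ultimately show ?L using pb by metis
  }
qed

section \<open>Paramodularity of the two bounds\<close>

lemma upper_concave:
  "m + p + q \<le> k \<Longrightarrow> upper \<nu> (m + p + q) + upper \<nu> m \<le> upper \<nu> (m + p) + upper \<nu> (m + q)"
proof (induction p)
  case (Suc p)
  have "max_part \<nu> (Suc (m + p + q)) \<le> max_part \<nu> (Suc (m + p))"
    using decr_le[OF max_part_decr[of k]] Suc.prems by simp
  then show ?case using Suc by (simp add: upper_def)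
qed simp

lemma lower_convex:
  assumes "decr k \<nu>"
  shows "m + p + q \<le> k \<Longrightarrow> lower k \<nu> (m + p) + lower k \<nu> (m + q) \<le> lower k \<nu> (m + p + q) + lower k \<nu> m"
proof (induction p)
  case (Suc p)
  have "\<nu> (k - (m + p)) \<le> \<nu> (k - (m + p + q))"
    using Suc.prems by (intro decr_le[OF assms]) auto
  then show ?case using Suc by (simp add: lower_def)
qed simp

text \<open>Each of the c further small parts of nu is paired with a part of the maximal partition.
  The condition i + j + c \<le> k puts the latter at an earlier or equal position, where it is at
  least as large.\<close>

lemma upper_lower_cross:
  assumes "decr k \<nu>"
  shows "i + j + c \<le> k \<Longrightarrow> lower k \<nu> (j + c) + upper \<nu> i \<le> upper \<nu> (i + c) + lower k \<nu> j"
proof (induction c arbitrary: i)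
  case (Suc c)
  have "\<nu> (k - (j + c)) \<le> \<nu> (Suc i)" using Suc.prems by (intro decr_le[OF assms]) auto
  also have "\<dots> \<le> max_part \<nu> (Suc i)" using Suc.prems by (intro parts_le_max_part[OF assms]) auto
  finally have "\<nu> (k - (j + c)) \<le> max_part \<nu> (Suc i)" .
  moreover have "lower k \<nu> (j + c) + upper \<nu> (Suc i) \<le> upper \<nu> (Suc i + c) + lower k \<nu> j"
    using Suc.IH[of "Suc i"] Suc.prems by simp
  ultimately show ?case by (simp add: upper_def lower_def)
qed simp

text \<open>The bounds depend on cardinalities only. With m common elements of I and J within 1..k,
  and p and q elements in only one of them, the three conditions become convexity of
  \<open>lower\<close>, concavity of \<open>upper\<close> and the cross inequality.\<close>

lemma paramodular_bounds:
  assumes "decr k \<nu>"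
  shows "paramodular_on E (\<lambda>I. real_of_int (int (lower k \<nu> (card (I \<inter> {1..k})))))
     (\<lambda>I. real_of_int (int (upper \<nu> (card (I \<inter> {1..k})))))"
proof -
  have cards: "\<exists>m p q. m + p + q \<le> k \<and> card (I \<inter> {1..k}) = m + p \<and> card (J \<inter> {1..k}) = m + q \<and>
     card ((I \<union> J) \<inter> {1..k}) = m + p + q \<and> card ((I \<inter> J) \<inter> {1..k}) = m \<and>
     card ((I - J) \<inter> {1..k}) = p \<and> card ((J - I) \<inter> {1..k}) = q" for I J :: "nat set"
  proof -
    let ?m = "(I \<inter> J) \<inter> {1..k}" and ?p = "(I - J) \<inter> {1..k}" and ?q = "(J - I) \<inter> {1..k}"
    have "I \<inter> {1..k} = ?m \<union> ?p" "J \<inter> {1..k} = ?m \<union> ?q" "(I \<union> J) \<inter> {1..k} = (?m \<union> ?p) \<union> ?q" by blast+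
    moreover have "card (?m \<union> ?p) = card ?m + card ?p" "card (?m \<union> ?q) = card ?m + card ?q"
       "card ((?m \<union> ?p) \<union> ?q) = card (?m \<union> ?p) + card ?q" by (rule card_Un_disjoint; blast)+
    moreover have "card ((I \<union> J) \<inter> {1..k}) \<le> k" using card_mono[of "{1..k}" "(I \<union> J) \<inter> {1..k}"] by simp
    ultimately show ?thesis by (intro exI[of _ "card ?m"] exI[of _ "card ?p"] exI[of _ "card ?q"]) simp
  qed
  show ?thesis
    unfolding paramodular_on_def supermodular_on_def submodular_on_def
  proof (intro conjI allI impI)
    fix I J :: "nat set"
    obtain m p q where c: "m + p + q \<le> k" "card (I \<inter> {1..k}) = m + p" "card (J \<inter> {1..k}) = m + q"
      "card ((I \<union> J) \<inter> {1..k}) = m + p + q" "card ((I \<inter> J) \<inter> {1..k}) = m"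
      "card ((I - J) \<inter> {1..k}) = p" "card ((J - I) \<inter> {1..k}) = q" using cards by metis
    show "- real_of_int (int (lower k \<nu> (card ((I \<union> J) \<inter> {1..k})))) + - real_of_int (int (lower k \<nu> (card (I \<inter> J \<inter> {1..k}))))
      \<le> - real_of_int (int (lower k \<nu> (card (I \<inter> {1..k})))) + - real_of_int (int (lower k \<nu> (card (J \<inter> {1..k}))))"
      unfolding c using lower_convex[OF assms c(1)] by linarith
    show "real_of_int (int (upper \<nu> (card ((I \<union> J) \<inter> {1..k})))) + real_of_int (int (upper \<nu> (card (I \<inter> J \<inter> {1..k}))))
      \<le> real_of_int (int (upper \<nu> (card (I \<inter> {1..k})))) + real_of_int (int (upper \<nu> (card (J \<inter> {1..k}))))"
      unfolding c using upper_concave[OF c(1), of \<nu>] by linarith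
    show "real_of_int (int (upper \<nu> (card ((I - J) \<inter> {1..k})))) - real_of_int (int (lower k \<nu> (card ((J - I) \<inter> {1..k}))))
      \<le> real_of_int (int (upper \<nu> (card (I \<inter> {1..k})))) - real_of_int (int (lower k \<nu> (card (J \<inter> {1..k}))))"
      unfolding c using upper_lower_cross[OF assms, of p q m] c(1) by (simp add: add.commute)
  qed
qed

section \<open>Newton polytopes and their integer points\<close>

lemma segment_closed_newton: "segment_closed (newton f)"
  unfolding segment_closed_def
proof (intro ballI allI impI)
  fix x y :: "nat \<Rightarrow> real" and u :: real
  assume "x \<in> newton f" "y \<in> newton f" and u: "0 \<le> u \<and> u \<le> 1"
  then obtain S v T w where S: "finite S" "S \<noteq> {}" "S \<subseteq> supp f" "\<forall>a\<in>S. v a \<ge> 0" "sum v S = 1"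
      "\<forall>i. x i = (\<Sum>a\<in>S. v a * exp_vec a i)"
    and T: "finite T" "T \<noteq> {}" "T \<subseteq> supp f" "\<forall>a\<in>T. w a \<ge> 0" "sum w T = 1"
      "\<forall>i. y i = (\<Sum>a\<in>T. w a * exp_vec a i)" unfolding newton_def by auto
  define c where "c a = u * (if a \<in> S then v a else 0) + (1 - u) * (if a \<in> T then w a else 0)" for a
  have restr: "(\<Sum>a\<in>S \<union> T. (if a \<in> S then g a else 0)) = (\<Sum>a\<in>S. g a)"
    "(\<Sum>a\<in>S \<union> T. (if a \<in> T then g a else 0)) = (\<Sum>a\<in>T. g a)" for g :: "_ \<Rightarrow> real"
    by (rule sum.mono_neutral_cong_right; use S(1) T(1) in auto)+
  have sum_c: "(\<Sum>a\<in>S \<union> T. c a * g a) = u * (\<Sum>a\<in>S. v a * g a) + (1 - u) * (\<Sum>a\<in>T. w a * g a)" for g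
  proof -
    have "c a * g a = u * (if a \<in> S then v a * g a else 0) + (1 - u) * (if a \<in> T then w a * g a else 0)" for a
      by (simp add: c_def distrib_right)
    then show ?thesis by (simp only: sum.distrib sum_distrib_left[symmetric] restr)
  qed
  have "sum c (S \<union> T) = 1" using sum_c[of "\<lambda>_. 1"] S(5) T(5) by simp
  moreover have "\<forall>a\<in>S \<union> T. c a \<ge> 0" using S(4) T(4) u by (auto simp: c_def)
  moreover have "\<forall>i. u * x i + (1 - u) * y i = (\<Sum>a\<in>S \<union> T. c a * exp_vec a i)"
    using S(6) T(6) by (simp add: sum_c)
  ultimately show "(\<lambda>i. u * x i + (1 - u) * y i) \<in> newton f"
    unfolding newton_def using S(1-3) T(1-3) by (intro CollectI exI[of _ "S \<union> T"] exI[of _ c]) auto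
qed

lemma exp_vec_in_newton: "e \<in> supp f \<Longrightarrow> exp_vec e \<in> newton f"
  unfolding newton_def by (intro CollectI exI[of _ "{e}"] exI[of _ "\<lambda>_. 1"]) auto

lemma newton_subset_polymatroid:
  assumes "\<And>e. e \<in> supp f \<Longrightarrow> exp_vec e \<in> polymatroid E y z"
  shows "newton f \<subseteq> polymatroid E y z"
proof
  fix t assume "t \<in> newton f"
  then obtain S u where S: "finite S" "S \<subseteq> supp f" "\<forall>a\<in>S. u a \<ge> 0" "sum u S = 1"
    "\<forall>i. t i = (\<Sum>a\<in>S. u a * exp_vec a i)" unfolding newton_def by auto
  have P: "exp_vec a \<in> polymatroid E y z" if "a \<in> S" for a using assms S(2) that by blast
  show "t \<in> polymatroid E y z"
    unfolding polymatroid_def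
  proof (intro CollectI conjI allI impI)
    fix i assume i: "i \<notin> E"
    have "(\<Sum>a\<in>S. u a * exp_vec a i) = 0"
    proof (intro sum.neutral ballI)
      fix a assume "a \<in> S"
      then show "u a * exp_vec a i = 0" using P i by (simp add: polymatroid_def)
    qed
    then show "t i = 0" using S(5) by simp
  next
    fix I assume I: "I \<subseteq> E"
    have sum_t: "(\<Sum>i\<in>I. t i) = (\<Sum>a\<in>S. u a * (\<Sum>i\<in>I. exp_vec a i))"
      using S(5) by (simp add: sum_distrib_left sum.swap[of _ S])
    have bounds: "u a * y I \<le> u a * (\<Sum>i\<in>I. exp_vec a i)" "u a * (\<Sum>i\<in>I. exp_vec a i) \<le> u a * z I" if "a \<in> S" for a
      using P[OF that] I S(3) that by (auto simp: polymatroid_def intro!: mult_left_mono)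
    have "(\<Sum>a\<in>S. u a * y I) \<le> (\<Sum>i\<in>I. t i)" "(\<Sum>i\<in>I. t i) \<le> (\<Sum>a\<in>S. u a * z I)"
      unfolding sum_t by (rule sum_mono, rule bounds, assumption)+
    then show "y I \<le> (\<Sum>i\<in>I. t i)" "(\<Sum>i\<in>I. t i) \<le> z I"
      using S(4) by (simp_all flip: sum_distrib_right)
  qed
qed

lemma integral_point_eq_exp_vec:
  assumes "finite E" "\<And>i. i \<notin> E \<Longrightarrow> t i = 0" "\<And>i. t i \<in> \<int>" "\<And>i. t i \<ge> 0"
  obtains e where "exp_vec e = t"
proof
  let ?e = "Abs_poly_mapping (\<lambda>i. nat \<lfloor>t i\<rfloor>)"
  have "finite {i. nat \<lfloor>t i\<rfloor> \<noteq> 0}"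
    by (rule finite_subset[OF _ assms(1)]) (use assms(2) in force)
  then have "Poly_Mapping.lookup ?e = (\<lambda>i. nat \<lfloor>t i\<rfloor>)" by (rule lookup_Abs_poly_mapping)
  moreover have "real (nat \<lfloor>t i\<rfloor>) = t i" for i
    using assms(3)[of i] assms(4)[of i] by (auto elim!: Ints_cases)
  ultimately show "exp_vec ?e = t" by (simp add: exp_vec_def)
qed

lemma supp_dd_longest_1_monomial:
  assumes "1 \<le> k" "strict_decr k a"
  shows "e \<in> supp (dd_longest 1 k (monomial k a)) \<longleftrightarrow> (\<forall>i. i \<notin> {1..k} \<longrightarrow> Poly_Mapping.lookup e i = 0) \<and>
    (\<forall>I\<subseteq>{1..k}. lower k (parts k a) (card I) \<le> (\<Sum>i\<in>I. Poly_Mapping.lookup e i) \<and>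
      (\<Sum>i\<in>I. Poly_Mapping.lookup e i) \<le> upper (parts k a) (card I))"
  using lookup_lenart[OF assms, of e]
  unfolding supp_def dd_longest_1_eq_lenart[OF assms(1)] reachable_dominated_iff[OF assms(2)] by blast

theorem theorem3p19:
  fixes n :: nat and w :: "nat \<Rightarrow> nat"
  assumes "w permutes {1..n}" and "grassmannian n w"
  shows "SNP (groth n w) \<and> gen_polymatroid n (newton (groth n w)) \<and>
         (\<forall>a \<in> supp (groth n w). absv a < total_deg (groth n w) \<longrightarrow>
            (\<exists>b \<in> supp (groth n w). (\<forall>i. Poly_Mapping.lookup a i \<le> Poly_Mapping.lookup b i) \<and> a \<noteq> b
                                   \<and> absv b = absv a + 1))"
proof -
  obtain k c where k: "1 \<le> k" "k < n" and c: "strict_decr k c" and "groth n w = dd_longest 1 k (monomial k c)"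
    using groth_grassmannian[OF assms] .
  define \<nu> where "\<nu> = parts k c"
  define f where "f = groth n w"
  have \<nu>: "decr k \<nu>" using parts_decr[OF c] by (simp add: decr_def \<nu>_def)
  have supp: "e \<in> supp f \<longleftrightarrow> (\<forall>i. i \<notin> {1..k} \<longrightarrow> Poly_Mapping.lookup e i = 0) \<and>
    (\<forall>I\<subseteq>{1..k}. lower k \<nu> (card I) \<le> (\<Sum>i\<in>I. Poly_Mapping.lookup e i) \<and>
      (\<Sum>i\<in>I. Poly_Mapping.lookup e i) \<le> upper \<nu> (card I))" for e
    unfolding f_def \<open>groth n w = _\<close> \<nu>_def using supp_dd_longest_1_monomial[OF k(1) c] .
  \<comment> \<open>Only x_1, ..., x_k occur, so indices beyond k are discarded; for such i the
    bound \<open>z {i} = 0\<close> makes the coordinate vanish.\<close>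
  define y where "y I = int (lower k \<nu> (card (I \<inter> {1..k})))" for I
  define z where "z I = int (upper \<nu> (card (I \<inter> {1..k})))" for I
  let ?P = "polymatroid {1..n} y z"
  have para: "paramodular_on {1..n} (\<lambda>I. real_of_int (y I)) (\<lambda>I. real_of_int (z I))"
    unfolding y_def z_def using \<nu> by (rule paramodular_bounds)
  have supp_iff: "e \<in> supp f \<longleftrightarrow> exp_vec e \<in> ?P" for e
  proof
    assume e: "e \<in> supp f"
    show "exp_vec e \<in> ?P"
      unfolding polymatroid_def
    proof (intro CollectI conjI allI impI)
      show "exp_vec e i = 0" if "i \<notin> {1..n}" for i
      proof -
        have "i \<notin> {1..k}" using that k by auto
        then show ?thesis using e supp by (simp add: exp_vec_def)
      qed
      fix I assume I: "I \<subseteq> {1..n}"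
      have "(\<Sum>i\<in>I. Poly_Mapping.lookup e i) = (\<Sum>i\<in>I \<inter> {1..k}. Poly_Mapping.lookup e i)"
        using e supp I finite_subset[OF I] by (intro sum.mono_neutral_right) auto
      then have "(\<Sum>i\<in>I. exp_vec e i) = real (\<Sum>i\<in>I \<inter> {1..k}. Poly_Mapping.lookup e i)"
        by (simp add: exp_vec_def flip: of_nat_sum)
      moreover have "lower k \<nu> (card (I \<inter> {1..k})) \<le> (\<Sum>i\<in>I \<inter> {1..k}. Poly_Mapping.lookup e i)"
        "(\<Sum>i\<in>I \<inter> {1..k}. Poly_Mapping.lookup e i) \<le> upper \<nu> (card (I \<inter> {1..k}))"
        using e supp by simp_all
      ultimately show "y I \<le> (\<Sum>i\<in>I. exp_vec e i)" "(\<Sum>i\<in>I. exp_vec e i) \<le> z I"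
        by (simp_all only: y_def z_def of_int_of_nat_eq of_nat_le_iff)
    qed
  next
    assume e: "exp_vec e \<in> ?P"
    have bounds: "y I \<le> real (\<Sum>i\<in>I. Poly_Mapping.lookup e i)" "real (\<Sum>i\<in>I. Poly_Mapping.lookup e i) \<le> z I"
      if "I \<subseteq> {1..n}" for I
      using e that by (simp_all add: polymatroid_def exp_vec_def)
    show "e \<in> supp f"
      unfolding supp
    proof (intro conjI allI impI)
      show "Poly_Mapping.lookup e i = 0" if "i \<notin> {1..k}" for i
      proof (cases "i \<in> {1..n}")
        case True
        then show ?thesis using bounds(2)[of "{i}"] that by (simp add: z_def upper_def)
      next
        case False
        then show ?thesis using e by (simp add: polymatroid_def exp_vec_def)
      qed
      fix I assume I: "I \<subseteq> {1..k}"
      then have "I \<subseteq> {1..n}" "I \<inter> {1..k} = I" using k by auto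
      then show "lower k \<nu> (card I) \<le> (\<Sum>i\<in>I. Poly_Mapping.lookup e i)"
        "(\<Sum>i\<in>I. Poly_Mapping.lookup e i) \<le> upper \<nu> (card I)"
        using bounds[of I] by (simp_all only: y_def z_def of_int_of_nat_eq of_nat_le_iff)
    qed
  qed
  have integral: "t \<in> exp_vec ` supp f" if t: "t \<in> ?P" "\<And>i. t i \<in> \<int>" for t
  proof -
    have zero: "t i = 0" if "i \<notin> {1..n}" for i using t(1) that by (simp add: polymatroid_def)
    have "t i \<ge> 0" for i
    proof (cases "i \<in> {1..n}")
      case True
      then have "{i} \<subseteq> {1..n}" by blast
      then have "y {i} \<le> (\<Sum>i\<in>{i}. t i)" using t(1) unfolding polymatroid_def by blast
      then show ?thesis by (simp add: y_def)
    qed (use zero in simp)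
    then obtain e where "exp_vec e = t"
      using integral_point_eq_exp_vec[of "{1..n}" t] zero t(2) by blast
    then show ?thesis using t(1) supp_iff by blast
  qed
  have newton_le: "newton f \<subseteq> ?P"
    by (rule newton_subset_polymatroid) (simp add: supp_iff)
  have "t \<in> newton f" if "t \<in> ?P" for t
  proof (rule polymatroid_integral[OF _ _ para])
    show "segment_closed (newton f)" by (rule segment_closed_newton)
    fix s assume "s \<in> ?P" "\<And>i. s i \<in> \<int>"
    then show "s \<in> newton f" using integral exp_vec_in_newton by blast
  next
    show "y {} = 0" by (simp add: y_def lower_def)
  qed (use that in simp_all)
  then have newton_eq: "newton f = ?P" using newton_le by blast
  have "SNP f" unfolding SNP_def using newton_le integral by blast
  moreover have "gen_polymatroid n (newton f)"
    unfolding gen_polymatroid_def newton_eq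
    by (rule exI[of _ "\<lambda>I. real_of_int (y I)"], rule exI[of _ "\<lambda>I. real_of_int (z I)"])
      (use para in \<open>simp add: polymatroid_def\<close>)
  moreover have "\<exists>b\<in>supp f. (\<forall>i. Poly_Mapping.lookup a i \<le> Poly_Mapping.lookup b i) \<and> a \<noteq> b \<and> absv b = absv a + 1"
    if a: "a \<in> supp f" and deg: "absv a < total_deg f" for a
  proof -
    let ?a = "Poly_Mapping.lookup a"
    have absv: "absv e = (\<Sum>i\<in>{1..k}. Poly_Mapping.lookup e i)" if "e \<in> supp f" for e
      unfolding absv_def using that supp by (intro sum.mono_neutral_left) (auto simp: in_keys_iff)
    have "finite (supp f)" unfolding supp_def by (rule finite_lookup)
    then have "total_deg f \<in> absv ` supp f" unfolding total_deg_def using a by (intro Max_in) auto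
    then obtain e where "e \<in> supp f" "total_deg f = absv e" by blast
    then have "absv a < (\<Sum>i\<in>{1..k}. Poly_Mapping.lookup e i)" "(\<Sum>i\<in>{1..k}. Poly_Mapping.lookup e i) \<le> upper \<nu> k"
      using deg absv supp by force+
    then have less: "(\<Sum>i\<in>{1..k}. ?a i) < upper \<nu> k" using absv[OF a] by simp
    have a_le: "(\<Sum>i\<in>I. ?a i) \<le> upper \<nu> (card I)" if "I \<subseteq> {1..k}" for I using a supp that by blast
    \<comment> \<open>An index outside every set that is tight for \<open>upper\<close>, so that
      raising its exponent breaks no bound. If every index lay in a tight set, the union of these
      sets, all of 1..k, would be tight, against \<open>less\<close>.\<close>
    obtain i where i: "i \<in> {1..k}" "\<And>I. I \<subseteq> {1..k} \<Longrightarrow> i \<in> I \<Longrightarrow> (\<Sum>i\<in>I. ?a i) < upper \<nu> (card I)"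
    proof (rule ccontr)
      assume "\<not> thesis"
      then have "\<forall>i\<in>{1..k}. \<exists>I. I \<subseteq> {1..k} \<and> i \<in> I \<and> (\<Sum>i\<in>I. ?a i) = upper \<nu> (card I)"
        using that a_le by (meson le_neq_implies_less)
      then obtain U where U: "\<And>i. i \<in> {1..k} \<Longrightarrow> U i \<subseteq> {1..k} \<and> i \<in> U i \<and> (\<Sum>i\<in>U i. ?a i) = upper \<nu> (card (U i))"
        by metis
      \<comment> \<open>Tight sets are collected one index at a time, so that binary unions suffice;
        the empty set is tight.\<close>
      have "\<exists>V\<subseteq>{1..k}. J \<subseteq> V \<and> (\<Sum>i\<in>V. ?a i) = upper \<nu> (card V)" if "finite J" "J \<subseteq> {1..k}" for J
        using that
      proof (induction J rule: finite_induct)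
        case empty
        show ?case by (intro exI[of _ "{}"]) (simp add: upper_def)
      next
        case (insert i J)
        then obtain V where V: "V \<subseteq> {1..k}" "J \<subseteq> V" "(\<Sum>i\<in>V. ?a i) = upper \<nu> (card V)" by auto
        have Ui: "U i \<subseteq> {1..k}" "i \<in> U i" "(\<Sum>i\<in>U i. ?a i) = upper \<nu> (card (U i))" using U[of i] insert by auto
        have fin: "finite V" "finite (U i)" using V(1) Ui(1) finite_subset by blast+
        let ?m = "card (V \<inter> U i)" and ?p = "card (V - U i)" and ?q = "card (U i - V)"
        have cards: "card V = ?m + ?p" "card (U i) = ?m + ?q" "card (V \<union> U i) = ?m + ?p + ?q"
        proof -
          show V_eq: "card V = ?m + ?p" using card_Int_Diff[OF fin(1)] .
          show "card (U i) = ?m + ?q" using card_Int_Diff[OF fin(2), of V] by (simp add: Int_commute)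
          have "card (V \<union> (U i - V)) = card V + card (U i - V)" using fin by (intro card_Un_disjoint) auto
          then show "card (V \<union> U i) = ?m + ?p + ?q" using V_eq by simp
        qed
        have VU: "V \<union> U i \<subseteq> {1..k}" "V \<inter> U i \<subseteq> {1..k}" using V(1) Ui(1) by blast+
        then have "card (V \<union> U i) \<le> k" using card_mono[OF _ VU(1)] by simp
        then have "upper \<nu> (card (V \<union> U i)) + upper \<nu> ?m \<le> upper \<nu> (card V) + upper \<nu> (card (U i))"
          unfolding cards by (rule upper_concave)
        moreover have "(\<Sum>i\<in>V \<union> U i. ?a i) + (\<Sum>i\<in>V \<inter> U i. ?a i) = (\<Sum>i\<in>V. ?a i) + (\<Sum>i\<in>U i. ?a i)"
          using fin by (rule sum.union_inter)
        ultimately have "(\<Sum>i\<in>V \<union> U i. ?a i) = upper \<nu> (card (V \<union> U i))"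
          using a_le[OF VU(1)] a_le[OF VU(2)] V(3) Ui(3) by linarith
        then show ?case using VU(1) V(2) Ui(2) by (intro exI[of _ "V \<union> U i"]) blast
      qed
      from this[of "{1..k}"] obtain V where "V = {1..k}" "(\<Sum>i\<in>V. ?a i) = upper \<nu> (card V)" by auto
      then show False using less by simp
    qed
    define b where "b = a + Poly_Mapping.single i 1"
    have lookup_b: "Poly_Mapping.lookup b l = ?a l + (if l = i then 1 else 0)" for l
      by (simp add: b_def lookup_add lookup_single when_def)
    have sum_b: "(\<Sum>l\<in>I. Poly_Mapping.lookup b l) = (\<Sum>l\<in>I. ?a l) + (if i \<in> I then 1 else 0)" if "finite I" for I
      unfolding lookup_b sum.distrib using that by simp
    have "b \<in> supp f"
      unfolding supp
    proof (intro conjI allI impI)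
      show "Poly_Mapping.lookup b l = 0" if "l \<notin> {1..k}" for l
        using that a supp i(1) by (auto simp: lookup_b)
      fix I assume I: "I \<subseteq> {1..k}"
      then have fin: "finite I" using finite_subset by blast
      have "lower k \<nu> (card I) \<le> (\<Sum>i\<in>I. ?a i)" using a supp I by blast
      then show "lower k \<nu> (card I) \<le> (\<Sum>l\<in>I. Poly_Mapping.lookup b l)" by (simp add: sum_b[OF fin])
      show "(\<Sum>l\<in>I. Poly_Mapping.lookup b l) \<le> upper \<nu> (card I)"
        using i(2)[OF I] a_le[OF I] by (cases "i \<in> I") (simp_all add: sum_b[OF fin])
    qed
    moreover have "absv b = absv a + 1"
      using absv[OF \<open>b \<in> supp f\<close>] absv[OF a] sum_b[of "{1..k}"] i(1) by simp
    moreover have "a \<noteq> b" using lookup_b[of i] by (metis add_cancel_left_right zero_neq_one)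
    ultimately show ?thesis using lookup_b by (intro bexI[of _ b]) auto
  qed
  ultimately show ?thesis unfolding f_def by blast
qed

end
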